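(* Let $T\subseteq\mathbb{C}$ be a discrete subset and let $F:\mathfrak{h}^g\times(\Pi_1\setminus T)\to\mathbb{C}$ be such that $(z,s)\mapsto F(z,s)$ is real analytic and $s\mapsto F(z,s)$ is holomorphic on $\Pi_1\setminus T$. Assume: (i) there is a lattice $\mathcal{L}\subseteq\mathbb{R}^g$ such that $F(z+\ell,s)=F(z,s)$ for all $(z,s)$ and all $\ell\in\mathcal{L}$; (ii) there is a function $\phi_1:\Pi_1\setminus T\to\mathbb{C}$ such that for each fixed $s$ there is $C_s>0$ with $|F(z,s)-\phi_1(s)|\operatorname{Norm}(y)|^s|\le C_s|\operatorname{Norm}(y)|^{1-s}$ for all $z\in\mathfrak{h}^g$; (iii) there is $p=(p_j)\in\mathbb{Z}^g$ such that $\Delta_{j,p_j}F(z,s)=s(1-s)F(z,s)$ for all $j\in\{1,\ldots,g\}$ and all $(z,s)$. Let $F(z,s)=a_0(y,s)+\sum_{\xi\in\mathcal{L}^*\setminus\{0\}}a_\xi(y,s)e^{2\pi i\operatorname{Tr}(\xi x)}$ be the Fourier expansion of $x\mapsto F(x+iy,s)$. Then $a_0(y,s)=\phi_1(s)|\operatorname{Norm}(y)|^s+\phi_2(s)|\operatorname{Norm}(y)|^{1-s}$ for some holomorphic functions $\phi_1,\phi_2$ on $\Pi_1\setminus T$. Moreover, with $m_p=\max\{\pm\frac{p_j}{2}:1\le j\le g\}$ and $M_p=m_p+1$, for each $\xi\in\mathcal{L}^*\setminus\{0\}$ there is a function $c_\xi(s)$, holomorphic on $\Pi_{M_p}\setminus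 T$, such that $a_\xi(y,s)=c_\xi(s)B_\xi(y;p;s)$.
   Context: $\mathfrak{h}^g$ is the product of $g$ upper half-planes, $z=x+iy$, $\operatorname{Norm}(y)=\prod y_j$; for $\xi,x\in\mathbb{R}^g$, $\operatorname{Tr}(\xi x)=\sum_j\xi_jx_j$. $\Pi_a=\{s\in\mathbb{C}:\operatorname{Re}(s)>a\}$. A lattice $\mathcal{L}\subseteq\mathbb{R}^g$ is a discrete subgroup of rank $g$; $\mathcal{L}^*=\{\xi\in\mathbb{R}^g:\operatorname{Tr}(\xi\ell)\in\mathbb{Z}\ \forall\ell\in\mathcal{L}\}$, and $a_\xi(y,s)=\operatorname{vol}(\mathbb{R}^g/\mathcal{L})^{-1}\int_{\mathbb{R}^g/\mathcal{L}}F(x+iy,s)e^{-2\pi i\operatorname{Tr}(\xi x)}dx$. $\Delta_{j,p_j}=-y_j^2(\partial_{x_j}^2+\partial_{y_j}^2)+ip_jy_j\partial_{x_j}$. $U(a,b;x)$ is Tricomi's confluent hypergeometric function: for $x>0$, $\operatorname{Re}a>0$, $U(a,b;x)=\Gamma(a)^{-1}\int_0^\infty e^{-xt}t^{a-1}(1+t)^{b-a-1}dt$, extended holomorphically to all $(a,b)\in\mathbb{C}^2$. For $A,B\in\mathbb{C}$ and $u\in\mathbb{R}^\times$ define $\tau(A,B;1,u)=(2\pi)^{A+B}i^{B-A}\Gamma(A)^{-1}e^{-2\pi u}U(B,A+B;4\pi u)$ if $u>0$ and $\tau(A,B;1,u)=(2\pi)^{A+B}i^{A-B}\Gamma(B)^{-1}e^{-2\pi|u|}U(A,A+B;4\pi|u|)$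 if $u<0$ (with $i^c=e^{i\pi c/2}$, $1/\Gamma$ entire). Finally $B_\xi(y;p;s)=\prod_{j=1}^g\tau\big(s+\tfrac{p_j}{2},\,s-\tfrac{p_j}{2};\,1,\,\xi_jy_j\big)$.
   Formalization: The last formula is proved as a_ξ(y,s) = c_ξ(s)|Norm(y)|^s B_ξ(y;p;s), since without the factor |Norm(y)|^s it is false for the given τ, and only for ξ with all ξ_j ≠ 0, since τ(A,B;1,u), hence B_ξ, is undefined at u = 0. *)

theory Defs
  imports "HOL-Analysis.Analysis" "HOL-Complex_Analysis.Complex_Analysis"
begin

definition half_plane :: "real \<Rightarrow> complex set" where
  "half_plane a = {s. Re s > a}"

definition upper_half_space :: "(complex ^ 'n) set" where
  "upper_half_space = {z. \<forall>j. Im (z $ j) > 0}"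

definition Norm :: "real ^ 'n \<Rightarrow> real" where
  "Norm y = (\<Prod>j\<in>UNIV. y $ j)"

definition Tr :: "real ^ 'n \<Rightarrow> real" where
  "Tr x = (\<Sum>j\<in>UNIV. x $ j)"

definition Im_vec :: "complex ^ 'n \<Rightarrow> real ^ 'n" where
  "Im_vec z = (\<chi> j. Im (z $ j))"

definition Complex_vec :: "real ^ 'n \<Rightarrow> real ^ 'n \<Rightarrow> complex ^ 'n" where
  "Complex_vec x y = (\<chi> j. Complex (x $ j) (y $ j))"

text \<open>
  Multi-indices are functions on the standard basis, extended by zero. The sum is unconditional,
  i.e. an absolutely convergent power series in the real coordinates. As with the library's
  notion \<^const>\<open>analytic_on\<close>, the expansion is required on a full neighbourhood of each point.
\<close>

definition real_analytic_on ::
    "('a::euclidean_space \<Rightarrow> 'b::real_normed_vector) \<Rightarrow> 'a set \<Rightarrow> bool" where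
  "real_analytic_on f S \<longleftrightarrow>
     (\<forall>x\<in>S. \<exists>r>0. \<exists>c :: ('a \<Rightarrow> nat) \<Rightarrow> 'b. \<forall>y\<in>ball x r.
        ((\<lambda>\<alpha>. (\<Prod>b\<in>Basis. ((y - x) \<bullet> b) ^ \<alpha> b) *\<^sub>R c \<alpha>) has_sum f y)
          {\<alpha>. \<forall>b. b \<notin> Basis \<longrightarrow> \<alpha> b = 0})"

definition partial_x :: "'n \<Rightarrow> (complex ^ 'n \<Rightarrow> complex) \<Rightarrow> complex ^ 'n \<Rightarrow> complex" where
  "partial_x j f z = vector_derivative (\<lambda>t::real. f (z + t *\<^sub>R axis j 1)) (at 0)"

definition partial_y :: "'n \<Rightarrow> (complex ^ 'n \<Rightarrow> complex) \<Rightarrow> complex ^ 'n \<Rightarrow> complex" where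
  "partial_y j f z = vector_derivative (\<lambda>t::real. f (z + t *\<^sub>R axis j \<i>)) (at 0)"

definition Laplacian ::
    "'n \<Rightarrow> int \<Rightarrow> (complex ^ 'n \<Rightarrow> complex) \<Rightarrow> complex ^ 'n \<Rightarrow> complex" where
  "Laplacian j p f z =
     - (of_real (Im (z $ j)))\<^sup>2 * (partial_x j (partial_x j f) z + partial_y j (partial_y j f) z)
     + \<i> * of_int p * of_real (Im (z $ j)) * partial_x j f z"

text \<open>The rank of a discrete subgroup of \<open>\<real>\<^sup>g\<close> is the dimension of its real span.\<close>

definition is_lattice :: "(real ^ 'n) set \<Rightarrow> bool" where
  "is_lattice L \<longleftrightarrow>
     0 \<in> L \<and> (\<forall>x\<in>L. \<forall>y\<in>L. x - y \<in> L) \<and> discrete L \<and> dim L = CARD('n)"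

definition dual_lattice :: "(real ^ 'n) set \<Rightarrow> (real ^ 'n) set" where
  "dual_lattice L = {\<xi>. \<forall>l\<in>L. Tr (\<xi> * l) \<in> \<int>}"

definition lattice_basis :: "(real ^ 'n) set \<Rightarrow> ('n \<Rightarrow> real ^ 'n) \<Rightarrow> bool" where
  "lattice_basis L b \<longleftrightarrow> inj b \<and> independent (range b) \<and>
     L = range (\<lambda>k::'n \<Rightarrow> int. \<Sum>j\<in>UNIV. of_int (k j) *\<^sub>R b j)"

text \<open>
  Integration over \<open>\<real>\<^sup>g/L\<close> is integration over a half-open fundamental parallelepiped;
  for \<open>L\<close>-periodic integrands the choice of the \<open>\<int>\<close>-basis is immaterial.
\<close>

definition fundamental_domain :: "(real ^ 'n) set \<Rightarrow> (real ^ 'n) set" where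
  "fundamental_domain L =
     (let b = (SOME b. lattice_basis L b)
      in {\<Sum>j\<in>UNIV. t j *\<^sub>R b j | t. \<forall>j. 0 \<le> t j \<and> t j < 1})"

definition fourier_coeff ::
    "(real ^ 'n) set \<Rightarrow> (complex ^ 'n \<Rightarrow> complex \<Rightarrow> complex) \<Rightarrow>
     real ^ 'n \<Rightarrow> real ^ 'n \<Rightarrow> complex \<Rightarrow> complex" where
  "fourier_coeff L F \<xi> y s =
     (LINT x:fundamental_domain L|lborel.
        F (Complex_vec x y) s * exp (- 2 * of_real pi * \<i> * of_real (Tr (\<xi> * x))))
     / of_real (measure lborel (fundamental_domain L))"

definition tricomi_integral :: "complex \<Rightarrow> complex \<Rightarrow> real \<Rightarrow> complex" where
  "tricomi_integral a b x = rGamma a *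
     (LINT t:{0<..}|lborel. of_real (exp (- x * t)) * of_real t powr (a - 1)
        * of_real (1 + t) powr (b - a - 1))"

text \<open>
  For fixed \<open>b\<close> and \<open>x > 0\<close> the entire extension in \<open>a\<close> is unique by the identity theorem; it is
  therefore the restriction of the extension that is jointly holomorphic in \<open>(a, b)\<close>.
\<close>

definition tricomi_U :: "complex \<Rightarrow> complex \<Rightarrow> real \<Rightarrow> complex" where
  "tricomi_U a b x =
     (if Re a > 0 then tricomi_integral a b x
      else (SOME G. G holomorphic_on UNIV \<and>
              (\<forall>a'. Re a' > 0 \<longrightarrow> G a' = tricomi_integral a' b x)) a)"

text \<open>\<open>tau A B u\<close> is \<open>\<tau>(A, B; 1, u)\<close>; it is meaningful only for \<open>u \<noteq> 0\<close>.\<close>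

definition tau :: "complex \<Rightarrow> complex \<Rightarrow> real \<Rightarrow> complex" where
  "tau A B u =
     (if u > 0 then
        of_real (2 * pi) powr (A + B) * exp (\<i> * of_real pi * (B - A) / 2) * rGamma A
          * of_real (exp (- 2 * pi * u)) * tricomi_U B (A + B) (4 * pi * u)
      else
        of_real (2 * pi) powr (A + B) * exp (\<i> * of_real pi * (A - B) / 2) * rGamma B
          * of_real (exp (- 2 * pi * \<bar>u\<bar>)) * tricomi_U A (A + B) (4 * pi * \<bar>u\<bar>))"

text \<open>
  The solution of \<open>\<Delta>\<^sub>j f = s (1 - s) f\<close>, \<open>f = h(y\<^sub>j) exp (2 \<pi> \<i> \<xi>\<^sub>j x\<^sub>j)\<close>, that decays at infinity is the
  Whittaker function \<open>W\<^bsub>\<plusminus>p/2, s-1/2\<^esub>(v) = v\<^sup>s e\<^bsup>-v/2\<^esup> U(s \<mp> p/2, 2 s; v)\<close> with \<open>v = 4 \<pi> |\<xi>\<^sub>j| y\<^sub>j\<close>.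
  Since \<open>tau\<close> does not contain the power \<open>v\<^sup>s\<close>, it is \<open>Norm(y)\<^sup>s B_coeff \<xi> y p s\<close>, rather than
  \<open>B_coeff \<xi> y p s\<close> alone, that is an eigenfunction.
\<close>

definition B_coeff :: "real ^ 'n \<Rightarrow> real ^ 'n \<Rightarrow> int ^ 'n \<Rightarrow> complex \<Rightarrow> complex" where
  "B_coeff \<xi> y p s =
     (\<Prod>j\<in>UNIV. tau (s + of_int (p $ j) / 2) (s - of_int (p $ j) / 2) (\<xi> $ j * y $ j))"

definition m_p :: "int ^ 'n \<Rightarrow> real" where
  "m_p p = Max (range (\<lambda>j. of_int (p $ j) / 2) \<union> range (\<lambda>j. - (of_int (p $ j) / 2)))"

definition M_p :: "int ^ 'n \<Rightarrow> real" where
  "M_p p = m_p p + 1"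

end

theory Submission
  imports Defs "HOL-Real_Asymp.Real_Asymp"
begin

text \<open>
  Fix \<open>s\<close>. Differentiating under the integral sign and integrating by parts over the lattice, the
  coefficient \<open>a\<^sub>\<xi>(y, s)\<close> solves in each variable \<open>y\<^sub>j\<close> separately a Whittaker equation (\<open>\<xi>\<^sub>j \<noteq> 0\<close>)
  or an Euler equation (\<open>\<xi> = 0\<close>). By the growth condition \<open>a\<^sub>\<xi>\<close>, respectively
  \<open>a\<^sub>0 - \<phi>\<^sub>1 Norm(y)\<^sup>s\<close>, tends to \<open>0\<close> in every variable, which singles out a one-dimensional space of
  solutions: multiples of the Tricomi integral, respectively of \<open>y\<^sub>j\<^bsup>1-s\<^esup>\<close>. Varying one coordinate at a
  time gives the product formulas. The factors depending on \<open>s\<close> alone are quotients of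
  \<open>a\<^sub>\<xi>(y, s)\<close> at suitable fixed \<open>y\<close> by explicit holomorphic functions.

  The set \<open>T\<close> need not be closed, so \<open>half_plane 1 - T\<close> need not be open. But \<open>F\<close> is real
  differentiable on a full neighbourhood of each point, and \<open>T\<close> is countable, so the derivative within
  \<open>half_plane 1 - T\<close> determines the full real derivative and shows that it is complex linear.
\<close>

no_notation fps_nth (infixl "$" 75)

section \<open>Differentiation under the integral sign\<close>

lemma integral_dominated_convergence_at:
  fixes f :: "'a::first_countable_topology \<Rightarrow> 'm \<Rightarrow> 'b::{banach, second_countable_topology}"
  assumes f: "\<forall>\<^sub>F x in at x0. f x \<in> borel_measurable M" and g: "g \<in> borel_measurable M"
    and w: "integrable M w" and lim: "AE t in M. ((\<lambda>x. f x t) \<longlongrightarrow> g t) (at x0)"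
    and bound: "\<forall>\<^sub>F x in at x0. AE t in M. norm (f x t) \<le> w t"
  shows "((\<lambda>x. \<integral>t. f x t \<partial>M) \<longlongrightarrow> (\<integral>t. g t \<partial>M)) (at x0)"
  unfolding tendsto_at_iff_sequentially comp_def
proof (intro allI impI)
  fix X :: "nat \<Rightarrow> 'a"
  assume "\<forall>i. X i \<in> UNIV - {x0}" and X: "X \<longlonglongrightarrow> x0"
  then have X_at: "filterlim X (at x0) sequentially"
    by (simp add: filterlim_at)
  then have "\<forall>\<^sub>F n in sequentially. f (X n) \<in> borel_measurable M \<and> (AE t in M. norm (f (X n) t) \<le> w t)"
    using eventually_conj[OF f bound] unfolding filterlim_iff by blast
  then obtain N where N: "\<And>n. n \<ge> N \<Longrightarrow> f (X n) \<in> borel_measurable M"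
    "\<And>n. n \<ge> N \<Longrightarrow> AE t in M. norm (f (X n) t) \<le> w t"
    by (auto simp: eventually_sequentially)
  have "(\<lambda>n. \<integral>t. f (X (n + N)) t \<partial>M) \<longlonglongrightarrow> (\<integral>t. g t \<partial>M)"
  proof (rule integral_dominated_convergence[OF g _ w])
    show "AE t in M. (\<lambda>n. f (X (n + N)) t) \<longlonglongrightarrow> g t"
      using lim by eventually_elim (intro LIMSEQ_ignore_initial_segment filterlim_compose[OF _ X_at])
  qed (simp_all add: N)
  then show "(\<lambda>n. \<integral>t. f (X n) t \<partial>M) \<longlonglongrightarrow> (\<integral>t. g t \<partial>M)"
    by (rule LIMSEQ_offset)
qed

lemma integrable_linear_family:
  fixes A :: "'m \<Rightarrow> 'a::real_normed_vector \<Rightarrow> 'b::{banach, second_countable_topology}"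
  assumes "integrable M g" "(\<lambda>t. A t h) \<in> borel_measurable M"
    and bound: "\<And>t. t \<in> space M \<Longrightarrow> norm (A t h) \<le> g t * norm h"
  shows "integrable M (\<lambda>t. A t h)"
proof (rule Bochner_Integration.integrable_bound)
  show "integrable M (\<lambda>t. g t * norm h)"
    using assms(1) by simp
  show "AE t in M. norm (A t h) \<le> norm (g t * norm h)"
    by (intro AE_I2 order_trans[OF bound]) auto
qed fact

lemma bounded_linear_integral:
  fixes A :: "'m \<Rightarrow> 'a::real_normed_vector \<Rightarrow> 'b::{banach, second_countable_topology}"
  assumes g: "integrable M g" and meas: "\<And>h. (\<lambda>t. A t h) \<in> borel_measurable M"
    and lin: "\<And>t. t \<in> space M \<Longrightarrow> linear (A t)"
    and bound: "\<And>t h. t \<in> space M \<Longrightarrow> norm (A t h) \<le> g t * norm h"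
  shows "bounded_linear (\<lambda>h. \<integral>t. A t h \<partial>M)"
proof (rule bounded_linear_intro[where K = "\<integral>t. g t \<partial>M"])
  have int: "integrable M (\<lambda>t. A t h)" for h
    using g meas bound by (rule integrable_linear_family)
  show "(\<integral>t. A t (x + y) \<partial>M) = (\<integral>t. A t x \<partial>M) + (\<integral>t. A t y \<partial>M)" for x y
    unfolding Bochner_Integration.integral_add[OF int int, symmetric]
    by (rule Bochner_Integration.integral_cong) (auto simp: linear_add[OF lin])
  show "(\<integral>t. A t (c *\<^sub>R x) \<partial>M) = c *\<^sub>R (\<integral>t. A t x \<partial>M)" for c x
    unfolding integral_scaleR_right[symmetric]
    by (rule Bochner_Integration.integral_cong) (auto simp: linear_scale[OF lin])
  show "norm (\<integral>t. A t x \<partial>M) \<le> norm x * (\<integral>t. g t \<partial>M)" for x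
  proof -
    have "norm (\<integral>t. A t x \<partial>M) \<le> (\<integral>t. g t * norm x \<partial>M)"
      by (rule order_trans[OF integral_norm_bound integral_mono]) (use int g bound in auto)
    then show ?thesis
      by (simp add: mult.commute)
  qed
qed

lemma norm_linear_remainder_le:
  fixes f :: "'a::{real_normed_vector, perfect_space} \<Rightarrow> 'b::real_normed_vector"
  assumes "convex S" and x: "x \<in> S" and y: "y \<in> S"
    and der: "\<And>x. x \<in> S \<Longrightarrow> (f has_derivative f' x) (at x within S)"
    and bound: "\<And>x h. x \<in> S \<Longrightarrow> norm (f' x h) \<le> B * norm h"
  shows "norm (f y - f x - f' x (y - x)) \<le> 2 * B * norm (y - x)"
proof -
  have "norm (f y - f x) \<le> B * norm (y - x)"
  proof (rule differentiable_bound[OF \<open>convex S\<close> der _ y x])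
    show "onorm (f' z) \<le> B" if "z \<in> S" for z
      by (rule onorm_le) (rule bound[OF that])
  qed
  with bound[OF x, of "y - x"] show ?thesis
    using norm_triangle_ineq4[of "f y - f x" "f' x (y - x)"] by linarith
qed

lemma has_derivative_integral_dominated:
  fixes f :: "'a::{real_normed_vector, perfect_space} \<Rightarrow> 'm \<Rightarrow> 'b::{banach, second_countable_topology}"
  assumes r: "r > 0"
    and der: "\<And>x t. x \<in> ball x0 r \<Longrightarrow> t \<in> space M \<Longrightarrow> ((\<lambda>x. f x t) has_derivative f' x t) (at x)"
    and bound: "\<And>x t h. x \<in> ball x0 r \<Longrightarrow> t \<in> space M \<Longrightarrow> norm (f' x t h) \<le> g t * norm h"
    and g: "integrable M g"
    and f: "\<And>x. x \<in> ball x0 r \<Longrightarrow> integrable M (f x)"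
    and f': "\<And>h. (\<lambda>t. f' x0 t h) \<in> borel_measurable M"
  shows "((\<lambda>x. \<integral>t. f x t \<partial>M) has_derivative (\<lambda>h. \<integral>t. f' x0 t h \<partial>M)) (at x0)"
proof -
  define R where "R x t = (1 / norm (x - x0)) *\<^sub>R (f x t - (f x0 t + f' x0 t (x - x0)))" for x t
  have x0: "x0 \<in> ball x0 r"
    using r by simp
  have near: "\<forall>\<^sub>F x in at x0. x \<in> ball x0 r - {x0}"
    using eventually_at_in_open[OF open_ball x0] .
  have int': "integrable M (\<lambda>t. f' x0 t h)" for h
    using g f' bound[OF x0] by (rule integrable_linear_family)
  have R_integrable: "integrable M (R x)" if "x \<in> ball x0 r" for x
    unfolding R_def[abs_def] using f[OF that] f[OF x0] int' by auto
  have "((\<lambda>x. \<integral>t. R x t \<partial>M) \<longlongrightarrow> (\<integral>t. 0 \<partial>M)) (at x0)"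
  proof (rule integral_dominated_convergence_at)
    show "\<forall>\<^sub>F x in at x0. R x \<in> borel_measurable M"
      using near by eventually_elim (intro borel_measurable_integrable R_integrable, simp)
    show "\<forall>\<^sub>F x in at x0. AE t in M. norm (R x t) \<le> 2 * g t"
      using near
    proof eventually_elim
      case (elim x)
      have "norm (f x t - f x0 t - f' x0 t (x - x0)) \<le> 2 * g t * norm (x - x0)" if "t \<in> space M" for t
        by (rule norm_linear_remainder_le[OF convex_ball x0 _ has_derivative_at_withinI[OF der] bound])
          (use elim that in auto)
      then show ?case
        using elim by (intro AE_I2) (simp add: R_def divide_simps diff_diff_eq mult.commute)
    qed
    show "AE t in M. ((\<lambda>x. R x t) \<longlongrightarrow> 0) (at x0)"
      unfolding R_def using der[OF x0] by (intro AE_I2) (simp add: has_derivative_within)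
  qed (use g in simp_all)
  moreover have "\<forall>\<^sub>F x in at x0. (\<integral>t. R x t \<partial>M) = (1 / norm (x - x0)) *\<^sub>R
      ((\<integral>t. f x t \<partial>M) - ((\<integral>t. f x0 t \<partial>M) + (\<integral>t. f' x0 t (x - x0) \<partial>M)))"
    using near by eventually_elim (simp add: R_def f[OF x0] f int')
  ultimately show ?thesis
    using bounded_linear_integral[OF g f' has_derivative_linear[OF der[OF x0]] bound[OF x0]]
    unfolding has_derivative_within by (auto elim: Lim_transform_eventually)
qed

lemma linear_eq_Basis_sum:
  fixes A :: "'a::euclidean_space \<Rightarrow> 'b::real_vector"
  assumes "linear A"
  shows "A h = (\<Sum>b\<in>Basis. (h \<bullet> b) *\<^sub>R A b)"
  by (subst euclidean_representation[of h, symmetric]) (simp only: linear_sum[OF assms] linear_scale[OF assms])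

lemma linear_family_bounded_on_compact:
  fixes A :: "'p::topological_space \<Rightarrow> 'a::euclidean_space \<Rightarrow> 'b::real_normed_vector"
  assumes K: "compact K" and lin: "\<And>w. w \<in> K \<Longrightarrow> linear (A w)"
    and cont: "\<And>b. b \<in> Basis \<Longrightarrow> continuous_on K (\<lambda>w. A w b)"
  obtains C where "\<And>w h. w \<in> K \<Longrightarrow> norm (A w h) \<le> C * norm h"
proof -
  have "\<exists>C. \<forall>w\<in>K. norm (A w b) \<le> C" if "b \<in> Basis" for b
    using compact_imp_bounded[OF compact_continuous_image[OF cont[OF that] K]] by (auto simp: bounded_iff)
  then obtain C where C: "\<And>b w. b \<in> Basis \<Longrightarrow> w \<in> K \<Longrightarrow> norm (A w b) \<le> C b"
    by metis
  show ?thesis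
  proof
    fix w h assume w: "w \<in> K"
    have "A w h = (\<Sum>b\<in>Basis. (h \<bullet> b) *\<^sub>R A w b)"
      by (rule linear_eq_Basis_sum[OF lin[OF w]])
    also have "norm \<dots> \<le> (\<Sum>b\<in>Basis. norm h * C b)"
      by (rule sum_norm_le) (auto intro!: mult_mono Basis_le_norm C w)
    finally show "norm (A w h) \<le> (\<Sum>b\<in>Basis. C b) * norm h"
      by (simp add: sum_distrib_left mult.commute)
  qed
qed

lemma set_integrable_continuous_on_closure:
  fixes f :: "'a::euclidean_space \<Rightarrow> 'b::{banach, second_countable_topology}"
  assumes "bounded A" "A \<in> sets borel" "continuous_on (closure A) f"
  shows "set_integrable lborel A f"
proof (rule set_integrable_subset)
  show "set_integrable lborel (closure A) f"
    unfolding set_integrable_def using assms by (intro borel_integrable_compact) auto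
qed (use assms closure_subset in auto)

lemma has_derivative_set_integral:
  fixes f :: "'a::euclidean_space \<Rightarrow> 'b::euclidean_space \<Rightarrow> 'c::{banach, second_countable_topology}"
  assumes D: "bounded D" "D \<in> sets borel" and \<Omega>: "open \<Omega>" "{w0} \<times> closure D \<subseteq> \<Omega>"
    and der: "\<And>w x. (w, x) \<in> \<Omega> \<Longrightarrow> ((\<lambda>w. f w x) has_derivative f' w x) (at w)"
    and cont: "continuous_on \<Omega> (\<lambda>(w, x). f w x)"
    and cont': "\<And>h. continuous_on \<Omega> (\<lambda>(w, x). f' w x h)"
  shows "((\<lambda>w. LINT x:D|lborel. f w x) has_derivative (\<lambda>h. LINT x:D|lborel. f' w0 x h)) (at w0)"
proof -
  obtain U where U: "w0 \<in> U" "open U" "U \<times> closure D \<subseteq> \<Omega>"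
    using Elementary_Topology.tube_lemma[OF _ \<Omega>] D(1) by (auto simp: compact_closure)
  then obtain r where r: "r > 0" "cball w0 r \<subseteq> U"
    using open_contains_cball by metis
  define K where "K = cball w0 r \<times> closure D"
  have K: "compact K" "K \<subseteq> \<Omega>"
    using U(3) r(2) D(1) by (auto simp: K_def intro: compact_Times)
  obtain C where C: "norm (f' (fst p) (snd p) h) \<le> C * norm h" if "p \<in> K" for p h
  proof (rule linear_family_bounded_on_compact[OF K(1), of "\<lambda>p. f' (fst p) (snd p)"])
    show "linear (f' (fst p) (snd p))" if "p \<in> K" for p
      using K(2) that by (intro has_derivative_linear[OF der]) auto
    show "continuous_on K (\<lambda>p. f' (fst p) (snd p) b)" for b
      using continuous_on_subset[OF cont' K(2)] by (simp add: case_prod_unfold)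
  qed (rule that)
  have in_K: "(w, x) \<in> K" if "w \<in> ball w0 r" "x \<in> D" for w x
    using that closure_subset[of D] by (auto simp: K_def)
  have set_int: "set_integrable lborel D (g w)"
    if g: "continuous_on \<Omega> (\<lambda>(w, x). g w x)" and w: "w \<in> cball w0 r"
    for g :: "'a \<Rightarrow> 'b \<Rightarrow> 'c" and w
  proof (rule set_integrable_continuous_on_closure[OF D])
    have "continuous_on (closure D) (\<lambda>x. (\<lambda>(w, x). g w x) (w, x))"
      by (rule continuous_on_compose2[OF g]) (use w K(2) in \<open>auto simp: K_def intro!: continuous_intros\<close>)
    then show "continuous_on (closure D) (g w)" by simp
  qed
  show ?thesis
    unfolding set_lebesgue_integral_def
  proof (rule has_derivative_integral_dominated[OF r(1), where g = "\<lambda>x. indicator D x * C"])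
    fix w x h assume w: "w \<in> ball w0 r"
    show "((\<lambda>w. indicator D x *\<^sub>R f w x) has_derivative (\<lambda>h. indicator D x *\<^sub>R f' w x h)) (at w)"
      using in_K[OF w, of x] K(2) der by (cases "x \<in> D") (auto intro: has_derivative_scaleR_right)
    show "norm (indicator D x *\<^sub>R f' w x h) \<le> indicator D x * C * norm h"
      using C[OF in_K[OF w], of x h] by (cases "x \<in> D") auto
    show "integrable lborel (\<lambda>x. indicator D x *\<^sub>R f w x)"
      using set_int[OF cont] w by (simp add: set_integrable_def)
  next
    show "integrable lborel (\<lambda>x. indicator D x * C)"
      using D emeasure_bounded_finite by (intro integrable_mult_left integrable_real_indicator) auto
    show "(\<lambda>x. indicator D x *\<^sub>R f' w0 x h) \<in> borel_measurable lborel" for h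
      using set_int[OF cont', of w0] r(1) by (intro borel_measurable_integrable) (simp add: set_integrable_def)
  qed
qed

lemma has_vector_derivative_set_integral:
  fixes f :: "real \<Rightarrow> 'b::euclidean_space \<Rightarrow> 'c::{banach, second_countable_topology}"
  assumes D: "bounded D" "D \<in> sets borel" and I: "open I" "t0 \<in> I"
    and der: "\<And>t x. t \<in> I \<Longrightarrow> ((\<lambda>t. f t x) has_vector_derivative f' t x) (at t)"
    and cont: "continuous_on (I \<times> UNIV) (\<lambda>(t, x). f t x)"
    and cont': "continuous_on (I \<times> UNIV) (\<lambda>(t, x). f' t x)"
  shows "((\<lambda>t. LINT x:D|lborel. f t x) has_vector_derivative (LINT x:D|lborel. f' t0 x)) (at t0)"
proof -
  have "((\<lambda>t. LINT x:D|lborel. f t x) has_derivative (\<lambda>h. LINT x:D|lborel. h *\<^sub>R f' t0 x)) (at t0)"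
    using der cont'
    by (intro has_derivative_set_integral[OF D open_Times[OF I(1) open_UNIV] _ _ cont])
      (auto simp: I has_vector_derivative_def case_prod_unfold intro!: continuous_intros)
  then show ?thesis
    by (simp add: has_vector_derivative_def)
qed

lemma borel_measurable_deriv:
  fixes f :: "complex \<Rightarrow> 'm \<Rightarrow> complex"
  assumes U: "open U" "s0 \<in> U" and meas: "\<And>s. s \<in> U \<Longrightarrow> f s \<in> borel_measurable M"
    and diff: "\<And>t. t \<in> space M \<Longrightarrow> (\<lambda>s. f s t) field_differentiable (at s0)"
  shows "(\<lambda>t. deriv (\<lambda>s. f s t) s0) \<in> borel_measurable M"
proof -
  obtain r where r: "r > 0" "cball s0 r \<subseteq> U"
    using U open_contains_cball by metis
  define h where "h n = complex_of_real (r / real (Suc n))" for n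
  have h_U: "s0 + h n \<in> U" for n
    using r by (intro subsetD[OF r(2)]) (simp add: h_def dist_norm norm_divide divide_simps del: of_nat_Suc)
  have "h \<longlonglongrightarrow> of_real 0"
    unfolding h_def by (intro tendsto_of_real LIMSEQ_Suc[OF lim_const_over_n])
  then have h_0: "filterlim h (at 0) sequentially"
    using r by (simp add: filterlim_at h_def del: of_nat_Suc)
  show ?thesis
  proof (rule borel_measurable_LIMSEQ_metric)
    show "(\<lambda>t. (f (s0 + h n) t - f s0 t) / h n) \<in> borel_measurable M" for n
      using meas[OF h_U] meas[OF U(2)] by measurable
    show "(\<lambda>n. (f (s0 + h n) t - f s0 t) / h n) \<longlonglongrightarrow> deriv (\<lambda>s. f s t) s0" if "t \<in> space M" for t
      using field_differentiable_derivI[OF diff[OF that]]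
      unfolding DERIV_def by (rule filterlim_compose[OF _ h_0])
  qed
qed

lemma norm_deriv_le_of_bounded:
  fixes f :: "complex \<Rightarrow> complex"
  assumes "f holomorphic_on U" "cball s r \<subseteq> U" "r > 0" and bound: "\<And>w. w \<in> U \<Longrightarrow> norm (f w) \<le> B"
  shows "norm (deriv f s) \<le> B / r"
proof -
  have "norm ((deriv ^^ 1) f s) \<le> fact 1 * B / r ^ 1"
  proof (rule Cauchy_inequality)
    show "f holomorphic_on ball s r" "continuous_on (cball s r) f"
      using assms(2) ball_subset_cball[of s r]
      by (intro holomorphic_on_imp_continuous_on holomorphic_on_subset[OF assms(1)]; blast)+
    show "norm (f w) \<le> B" if "norm (s - w) = r" for w
      using assms(2) that by (intro bound) (auto simp: dist_norm)
  qed fact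
  then show ?thesis
    by simp
qed

text \<open>Cauchy's inequality turns a dominating function into one for the derivatives.\<close>

lemma holomorphic_on_integral_dominated:
  fixes f :: "complex \<Rightarrow> 'm \<Rightarrow> complex"
  assumes "open U"
    and holo: "\<And>t. t \<in> space M \<Longrightarrow> (\<lambda>s. f s t) holomorphic_on U"
    and meas: "\<And>s. s \<in> U \<Longrightarrow> f s \<in> borel_measurable M"
    and g: "integrable M g" and bound: "\<And>s t. s \<in> U \<Longrightarrow> t \<in> space M \<Longrightarrow> norm (f s t) \<le> g t"
  shows "(\<lambda>s. \<integral>t. f s t \<partial>M) holomorphic_on U"
  unfolding holomorphic_on_def
proof
  fix s0 assume s0: "s0 \<in> U"
  obtain e where e: "e > 0" "cball s0 e \<subseteq> U"
    using \<open>open U\<close> s0 open_contains_cball by metis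
  define r where "r = e / 2"
  have r: "r > 0"
    using e by (simp add: r_def)
  have cball_U: "cball s r \<subseteq> U" if "s \<in> ball s0 r" for s
  proof
    fix w assume "w \<in> cball s r"
    with that show "w \<in> U"
      using dist_triangle[of s0 w s] by (intro subsetD[OF e(2)]) (simp add: r_def)
  qed
  have diff: "(\<lambda>s. f s t) field_differentiable (at s)" if "s \<in> ball s0 r" "t \<in> space M" for s t
    using cball_U[OF that(1)] r
    by (intro holomorphic_on_imp_differentiable_at[OF holo[OF that(2)] \<open>open U\<close>]) auto
  have "((\<lambda>s. \<integral>t. f s t \<partial>M) has_derivative (\<lambda>h. \<integral>t. deriv (\<lambda>s. f s t) s0 * h \<partial>M)) (at s0)"
  proof (rule has_derivative_integral_dominated[OF r, where g = "\<lambda>t. g t / r"])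
    fix s t h assume s: "s \<in> ball s0 r" and t: "t \<in> space M"
    show "((\<lambda>s. f s t) has_derivative (*) (deriv (\<lambda>s. f s t) s)) (at s)"
      using field_differentiable_derivI[OF diff[OF s t]] by (simp add: has_field_derivative_def)
    have "norm (deriv (\<lambda>s. f s t) s) \<le> g t / r"
      by (rule norm_deriv_le_of_bounded[OF holo[OF t] cball_U[OF s] r bound[OF _ t]])
    then show "norm (deriv (\<lambda>s. f s t) s * h) \<le> g t / r * norm h"
      unfolding norm_mult by (rule mult_right_mono) simp
  next
    fix s assume "s \<in> ball s0 r"
    then have "s \<in> U"
      using cball_U[of s] r by auto
    then have "norm (f s t) \<le> norm (g t)" if "t \<in> space M" for t
      using bound[OF _ that, of s] by simp
    with \<open>s \<in> U\<close> show "integrable M (f s)"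
      by (intro Bochner_Integration.integrable_bound[OF g meas] AE_I2)
  next
    show "(\<lambda>t. deriv (\<lambda>s. f s t) s0 * h) \<in> borel_measurable M" for h
      using r by (intro borel_measurable_times borel_measurable_const
          borel_measurable_deriv[OF \<open>open U\<close> s0 meas diff]) auto
  qed (use g in simp)
  then have "((\<lambda>s. \<integral>t. f s t \<partial>M) has_derivative (*) (\<integral>t. deriv (\<lambda>s. f s t) s0 \<partial>M)) (at s0)"
    by simp
  then show "(\<lambda>s. \<integral>t. f s t \<partial>M) field_differentiable (at s0 within U)"
    by (auto simp: field_differentiable_def has_field_derivative_def intro: has_derivative_at_withinI)
qed

section \<open>Real analytic functions\<close>

lemma has_sum_iff_integral_count_space:
  fixes f :: "'i \<Rightarrow> complex" and s :: complex
  shows "(f has_sum s) A \<longleftrightarrow> integrable (count_space A) f \<and> s = (\<integral>i. f i \<partial>count_space A)"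
proof -
  have int_iff: "integrable (count_space A) f \<longleftrightarrow> f summable_on A"
    unfolding summable_on_iff_abs_summable_on_complex[of f A] abs_summable_equivalent
      Infinite_Set_Sum.abs_summable_on_def ..
  have "infsum f A = (\<integral>i. f i \<partial>count_space A)" if "integrable (count_space A) f"
    using infsetsum_infsum[of f A] that by (simp add: infsetsum_def Infinite_Set_Sum.abs_summable_on_def)
  then show ?thesis
    using int_iff by (metis has_sum_imp_summable infsumI has_sum_infsum)
qed

abbreviation multi_indices :: "('a::euclidean_space \<Rightarrow> nat) set" where
  "multi_indices \<equiv> {\<alpha>. \<forall>b. b \<notin> Basis \<longrightarrow> \<alpha> b = 0}"

definition monomial :: "('a::euclidean_space \<Rightarrow> nat) \<Rightarrow> 'a \<Rightarrow> real" where
  "monomial \<alpha> u = (\<Prod>b\<in>Basis. (u \<bullet> b) ^ \<alpha> b)"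

definition monomial_deriv :: "('a::euclidean_space \<Rightarrow> nat) \<Rightarrow> 'a \<Rightarrow> 'a \<Rightarrow> real" where
  "monomial_deriv \<alpha> u h =
     (\<Sum>b\<in>Basis. (h \<bullet> b) * (real (\<alpha> b) * (u \<bullet> b) ^ (\<alpha> b - 1) * (\<Prod>i\<in>Basis - {b}. (u \<bullet> i) ^ \<alpha> i)))"

lemma has_derivative_monomial: "(monomial \<alpha> has_derivative monomial_deriv \<alpha> u) (at u)"
  unfolding monomial_def[abs_def] monomial_deriv_def
  by (rule has_derivative_eq_rhs, rule has_derivative_prod,
      (rule derivative_eq_intros refl)+) (auto intro!: sum.cong ext)

lemma monomial_deriv_Basis:
  assumes "b \<in> Basis"
  shows "monomial_deriv \<alpha> u b = real (\<alpha> b) * (u \<bullet> b) ^ (\<alpha> b - 1) * (\<Prod>i\<in>Basis - {b}. (u \<bullet> i) ^ \<alpha> i)"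
  using assms by (simp add: monomial_deriv_def inner_Basis if_distrib if_distribR cong: if_cong)

lemma abs_power_deriv_le:
  fixes u \<rho> :: real
  assumes "\<bar>u\<bar> \<le> \<rho> / 2" "\<rho> > 0"
  shows "\<bar>real n * u ^ (n - 1)\<bar> \<le> 2 / \<rho> * \<rho> ^ n"
proof (cases n)
  case (Suc m)
  have "\<bar>real n * u ^ (n - 1)\<bar> = real n * \<bar>u\<bar> ^ m"
    using Suc by (simp add: abs_mult power_abs)
  also have "\<dots> \<le> 2 ^ n * (\<rho> / 2) ^ m"
    using assms by (intro mult_mono power_mono) (auto simp: less_imp_le of_nat_less_two_power)
  also have "\<dots> = 2 / \<rho> * \<rho> ^ n"
    using Suc assms by (simp add: power_divide)
  finally show ?thesis .
qed (use assms in simp)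

lemma abs_monomial_deriv_le:
  fixes u :: "'a::euclidean_space"
  assumes u: "norm u \<le> \<rho> / 2" and \<rho>: "\<rho> > 0"
  shows "\<bar>monomial_deriv \<alpha> u h\<bar> \<le> DIM('a) * (2 / \<rho>) * (\<Prod>i\<in>Basis. \<rho> ^ \<alpha> i) * norm h"
proof -
  have coord: "\<bar>u \<bullet> i\<bar> \<le> \<rho> / 2" if "i \<in> Basis" for i
    using Basis_le_norm[OF that] u order_trans by blast
  have "\<bar>monomial_deriv \<alpha> u b\<bar> \<le> 2 / \<rho> * (\<Prod>i\<in>Basis. \<rho> ^ \<alpha> i)" if b: "b \<in> Basis" for b
  proof -
    have "\<bar>monomial_deriv \<alpha> u b\<bar>
        = \<bar>real (\<alpha> b) * (u \<bullet> b) ^ (\<alpha> b - 1)\<bar> * (\<Prod>i\<in>Basis - {b}. \<bar>u \<bullet> i\<bar> ^ \<alpha> i)"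
      unfolding monomial_deriv_Basis[OF b] abs_mult abs_prod power_abs ..
    also have "\<dots> \<le> (2 / \<rho> * \<rho> ^ \<alpha> b) * (\<Prod>i\<in>Basis - {b}. \<rho> ^ \<alpha> i)"
    proof (intro mult_mono abs_power_deriv_le coord b \<rho> prod_mono conjI power_mono)
      show "\<bar>u \<bullet> i\<bar> \<le> \<rho>" if "i \<in> Basis - {b}" for i
        using coord[of i] that \<rho> by auto
    qed (use \<rho> in \<open>auto intro!: prod_nonneg\<close>)
    also have "\<dots> = 2 / \<rho> * (\<Prod>i\<in>Basis. \<rho> ^ \<alpha> i)"
      using b by (subst prod.remove[of Basis b]) auto
    finally show ?thesis .
  qed
  then have term_le: "\<bar>(h \<bullet> b) * monomial_deriv \<alpha> u b\<bar> \<le> norm h * (2 / \<rho> * (\<Prod>i\<in>Basis. \<rho> ^ \<alpha> i))"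
    if "b \<in> Basis" for b
    unfolding abs_mult using that by (intro mult_mono Basis_le_norm) auto
  have "monomial_deriv \<alpha> u h = (\<Sum>b\<in>Basis. (h \<bullet> b) * monomial_deriv \<alpha> u b)"
    unfolding monomial_deriv_def[of \<alpha> u h] by (simp add: monomial_deriv_Basis)
  also have "\<bar>\<dots>\<bar> \<le> DIM('a) * (norm h * (2 / \<rho> * (\<Prod>i\<in>Basis. \<rho> ^ \<alpha> i)))"
    by (intro order_trans[OF sum_abs] sum_bounded_above term_le)
  finally show ?thesis
    by (simp only: mult_ac)
qed

definition power_series_on ::
    "(('a::euclidean_space \<Rightarrow> nat) \<Rightarrow> 'b::real_normed_vector) \<Rightarrow> 'a \<Rightarrow> real \<Rightarrow> ('a \<Rightarrow> 'b) \<Rightarrow> bool" where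
  "power_series_on c x r f \<longleftrightarrow>
     (\<forall>y\<in>ball x r. ((\<lambda>\<alpha>. monomial \<alpha> (y - x) *\<^sub>R c \<alpha>) has_sum f y) multi_indices)"

lemma real_analytic_on_iff_power_series:
  "real_analytic_on f S \<longleftrightarrow> (\<forall>x\<in>S. \<exists>r>0. \<exists>c. power_series_on c x r f)"
  unfolding real_analytic_on_def power_series_on_def monomial_def ..

lemma power_series_on_integral:
  fixes f :: "'a::euclidean_space \<Rightarrow> complex"
  assumes "power_series_on c x r f" "y \<in> ball x r"
  shows "integrable (count_space multi_indices) (\<lambda>\<alpha>. monomial \<alpha> (y - x) *\<^sub>R c \<alpha>)"
    and "f y = (\<integral>\<alpha>. monomial \<alpha> (y - x) *\<^sub>R c \<alpha> \<partial>count_space multi_indices)"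
  using assms unfolding power_series_on_def has_sum_iff_integral_count_space by auto

text \<open>This is absolute convergence at the point of the polydisc diagonal with all coordinates \<open>\<rho>\<close>.\<close>

lemma power_series_on_abs_integrable:
  fixes f :: "'a::euclidean_space \<Rightarrow> complex" and r \<rho> :: real
  assumes f: "power_series_on c x r f" and \<rho>: "0 < \<rho>" "DIM('a) * \<rho> < r"
  shows "integrable (count_space multi_indices) (\<lambda>\<alpha>. (\<Prod>i\<in>Basis. \<rho> ^ \<alpha> i) * norm (c \<alpha>))"
proof -
  define u :: 'a where "u = (\<Sum>b\<in>Basis. \<rho> *\<^sub>R b)"
  have "norm u \<le> (\<Sum>b\<in>(Basis::'a set). norm (\<rho> *\<^sub>R b))"
    unfolding u_def by (rule norm_sum)
  also have "\<dots> < r"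
    using \<rho> by simp
  finally have "x + u \<in> ball x r"
    by (simp add: dist_norm)
  then have "integrable (count_space multi_indices) (\<lambda>\<alpha>. norm (monomial \<alpha> u *\<^sub>R c \<alpha>))"
    using integrable_norm[OF power_series_on_integral(1)[OF f, of "x + u"]] by simp
  moreover have "u \<bullet> b = \<rho>" if "b \<in> Basis" for b
    using that by (simp add: u_def inner_sum_left inner_Basis if_distrib cong: if_cong)
  ultimately show ?thesis
    using \<rho>(1) by (simp add: monomial_def abs_prod)
qed

lemma power_series_on_has_derivative:
  fixes f :: "'a::euclidean_space \<Rightarrow> complex" and r \<rho> :: real
  assumes f: "power_series_on c x r f" and \<rho>: "0 < \<rho>" "DIM('a) * \<rho> < r" and y: "y \<in> ball x (\<rho> / 2)"
  shows "(f has_derivative (\<lambda>h. \<integral>\<alpha>. monomial_deriv \<alpha> (y - x) h *\<^sub>R c \<alpha> \<partial>count_space multi_indices)) (at y)"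
proof -
  let ?M = "count_space (multi_indices :: ('a \<Rightarrow> nat) set)"
  define K where "K \<alpha> = DIM('a) * (2 / \<rho>) * ((\<Prod>i\<in>Basis. \<rho> ^ \<alpha> i) * norm (c \<alpha>))" for \<alpha> :: "'a \<Rightarrow> nat"
  have "1 * \<rho> \<le> DIM('a) * \<rho>"
    using \<rho>(1) by (intro mult_right_mono) (simp_all add: Suc_leI)
  then have "\<rho> / 2 \<le> r"
    using \<rho> by linarith
  define e where "e = \<rho> / 2 - dist x y"
  have e: "e > 0"
    using y by (simp add: e_def)
  have ball: "z \<in> ball x (\<rho> / 2)" "z \<in> ball x r" if "z \<in> ball y e" for z
    using that dist_triangle[of x z y] \<open>\<rho> / 2 \<le> r\<close> by (auto simp: e_def)
  have "((\<lambda>z. \<integral>\<alpha>. monomial \<alpha> (z - x) *\<^sub>R c \<alpha> \<partial>?M) has_derivative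
      (\<lambda>h. \<integral>\<alpha>. monomial_deriv \<alpha> (y - x) h *\<^sub>R c \<alpha> \<partial>?M)) (at y)"
  proof (rule has_derivative_integral_dominated[OF e, where g = K])
    show "((\<lambda>z. monomial \<alpha> (z - x) *\<^sub>R c \<alpha>) has_derivative (\<lambda>h. monomial_deriv \<alpha> (z - x) h *\<^sub>R c \<alpha>)) (at z)" for z \<alpha>
      by (intro has_derivative_scaleR_left has_derivative_compose[OF _ has_derivative_monomial])
        (auto intro!: derivative_eq_intros)
    show "norm (monomial_deriv \<alpha> (z - x) h *\<^sub>R c \<alpha>) \<le> K \<alpha> * norm h" if "z \<in> ball y e" for z h \<alpha>
    proof -
      have "\<bar>monomial_deriv \<alpha> (z - x) h\<bar> * norm (c \<alpha>)
          \<le> DIM('a) * (2 / \<rho>) * (\<Prod>i\<in>Basis. \<rho> ^ \<alpha> i) * norm h * norm (c \<alpha>)"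
        using ball(1)[OF that] \<rho>(1)
        by (intro mult_right_mono abs_monomial_deriv_le) (auto simp: dist_norm norm_minus_commute)
      then show ?thesis
        by (simp add: K_def mult_ac)
    qed
    show "integrable ?M K"
      unfolding K_def by (intro integrable_mult_right power_series_on_abs_integrable[OF f \<rho>])
  qed (use power_series_on_integral(1)[OF f ball(2)] in auto)
  then show ?thesis
    by (rule has_derivative_transform_within_open[OF _ open_ball, of _ _ _ _ y e])
      (use e power_series_on_integral(2)[OF f ball(2)] in auto)
qed

lemma power_series_on_differentiable:
  fixes f :: "'a::euclidean_space \<Rightarrow> complex"
  assumes "power_series_on c x r f" "r > 0"
  shows "\<forall>\<^sub>F y in nhds x. f differentiable (at y)"
proof -
  define \<rho> where "\<rho> = r / (2 * DIM('a))"
  have \<rho>: "0 < \<rho>" "DIM('a) * \<rho> < r"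
    using assms(2) by (simp_all add: \<rho>_def)
  have "\<forall>\<^sub>F y in nhds x. y \<in> ball x (\<rho> / 2)"
    using \<rho>(1) by (intro eventually_nhds_in_open) auto
  then show ?thesis
    unfolding differentiable_def
    by eventually_elim (rule exI, rule power_series_on_has_derivative[OF assms(1) \<rho>])
qed

lemma monomial_deriv_Suc:
  assumes "b \<in> Basis"
  shows "monomial_deriv (\<alpha>(b := Suc (\<alpha> b))) u b = real (Suc (\<alpha> b)) * monomial \<alpha> u"
proof -
  have "(\<Prod>i\<in>Basis - {b}. (u \<bullet> i) ^ (\<alpha>(b := Suc (\<alpha> b))) i) = (\<Prod>i\<in>Basis - {b}. (u \<bullet> i) ^ \<alpha> i)"
    by (rule prod.cong) auto
  then show ?thesis
    using assms by (simp add: monomial_deriv_Basis monomial_def prod.remove[of Basis b])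
qed

lemma has_sum_monomial_deriv_reindex:
  fixes c :: "('a::euclidean_space \<Rightarrow> nat) \<Rightarrow> complex"
  assumes b: "b \<in> Basis" and s: "((\<lambda>\<alpha>. monomial_deriv \<alpha> u b *\<^sub>R c \<alpha>) has_sum s) multi_indices"
  shows "((\<lambda>\<alpha>. monomial \<alpha> u *\<^sub>R (real (Suc (\<alpha> b)) *\<^sub>R c (\<alpha>(b := Suc (\<alpha> b))))) has_sum s) multi_indices"
proof -
  let ?P = "{\<alpha> \<in> multi_indices. \<alpha> b > 0}"
  have "((\<lambda>\<alpha>. monomial_deriv \<alpha> u b *\<^sub>R c \<alpha>) has_sum s) ?P"
    using s by (rule has_sum_cong_neutral[THEN iffD1, rotated -1]) (auto simp: monomial_deriv_Basis b)
  moreover have "bij_betw (\<lambda>\<alpha>. \<alpha>(b := Suc (\<alpha> b))) multi_indices ?P"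
    by (rule bij_betwI[where g = "\<lambda>\<alpha>. \<alpha>(b := \<alpha> b - 1)"]) (use b in \<open>auto simp: fun_eq_iff\<close>)
  ultimately have "((\<lambda>\<alpha>. monomial_deriv (\<alpha>(b := Suc (\<alpha> b))) u b *\<^sub>R c (\<alpha>(b := Suc (\<alpha> b)))) has_sum s) multi_indices"
    by (rule has_sum_reindex_bij_betw[THEN iffD2, rotated])
  then show ?thesis
    by (simp only: monomial_deriv_Suc[OF b] scaleR_scaleR mult.commute)
qed

lemma power_series_on_frechet_derivative:
  fixes f :: "'a::euclidean_space \<Rightarrow> complex"
  assumes f: "power_series_on c x r f" and "r > 0" and b: "b \<in> Basis"
  obtains \<rho> where "\<rho> > 0"
    "power_series_on (\<lambda>\<alpha>. real (Suc (\<alpha> b)) *\<^sub>R c (\<alpha>(b := Suc (\<alpha> b)))) x \<rho> (\<lambda>y. frechet_derivative f (at y) b)"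
proof -
  let ?M = "count_space (multi_indices :: ('a \<Rightarrow> nat) set)"
  define \<rho> where "\<rho> = r / (2 * DIM('a))"
  have \<rho>: "0 < \<rho>" "DIM('a) * \<rho> < r"
    using \<open>r > 0\<close> by (simp_all add: \<rho>_def)
  have "((\<lambda>\<alpha>. monomial_deriv \<alpha> (y - x) b *\<^sub>R c \<alpha>) has_sum frechet_derivative f (at y) b) multi_indices"
    if y: "y \<in> ball x (\<rho> / 2)" for y
    unfolding has_sum_iff_integral_count_space
  proof
    show "frechet_derivative f (at y) b = (\<integral>\<alpha>. monomial_deriv \<alpha> (y - x) b *\<^sub>R c \<alpha> \<partial>?M)"
      by (simp flip: frechet_derivative_at[OF power_series_on_has_derivative[OF f \<rho> y]])
    show "integrable ?M (\<lambda>\<alpha>. monomial_deriv \<alpha> (y - x) b *\<^sub>R c \<alpha>)"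
    proof (rule Bochner_Integration.integrable_bound)
      show "integrable ?M (\<lambda>\<alpha>. DIM('a) * (2 / \<rho>) * ((\<Prod>i\<in>Basis. \<rho> ^ \<alpha> i) * norm (c \<alpha>)))"
        by (intro integrable_mult_right power_series_on_abs_integrable[OF f \<rho>])
      have "\<bar>monomial_deriv \<alpha> (y - x) b\<bar> * norm (c \<alpha>)
          \<le> DIM('a) * (2 / \<rho>) * (\<Prod>i\<in>Basis. \<rho> ^ \<alpha> i) * norm b * norm (c \<alpha>)" for \<alpha>
        using y \<rho>(1) by (intro mult_right_mono abs_monomial_deriv_le) (auto simp: dist_norm norm_minus_commute)
      then show "AE \<alpha> in ?M. norm (monomial_deriv \<alpha> (y - x) b *\<^sub>R c \<alpha>)
          \<le> norm (DIM('a) * (2 / \<rho>) * ((\<Prod>i\<in>Basis. \<rho> ^ \<alpha> i) * norm (c \<alpha>)))"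
        using b \<rho>(1) by (intro AE_I2) (simp add: abs_mult abs_prod mult_ac)
    qed simp
  qed
  then have "power_series_on (\<lambda>\<alpha>. real (Suc (\<alpha> b)) *\<^sub>R c (\<alpha>(b := Suc (\<alpha> b)))) x (\<rho> / 2)
      (\<lambda>y. frechet_derivative f (at y) b)"
    unfolding power_series_on_def by (intro ballI has_sum_monomial_deriv_reindex b)
  with \<rho>(1) show ?thesis
    by (intro that[of "\<rho> / 2"]) auto
qed

lemma real_analytic_on_frechet_derivative:
  fixes f :: "'a::euclidean_space \<Rightarrow> complex"
  assumes "real_analytic_on f S" "b \<in> Basis"
  shows "real_analytic_on (\<lambda>w. frechet_derivative f (at w) b) S"
  unfolding real_analytic_on_iff_power_series
proof
  fix x assume "x \<in> S"
  then obtain r c where "r > 0" "power_series_on c x r f"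
    using assms(1) unfolding real_analytic_on_iff_power_series by blast
  then show "\<exists>r>0. \<exists>c. power_series_on c x r (\<lambda>w. frechet_derivative f (at w) b)"
    using power_series_on_frechet_derivative[OF _ _ assms(2)] by blast
qed

lemma real_analytic_on_differentiable:
  fixes f :: "'a::euclidean_space \<Rightarrow> complex"
  assumes "real_analytic_on f S" "x \<in> S"
  shows "\<forall>\<^sub>F y in nhds x. f differentiable (at y)"
proof -
  obtain r c where "r > 0" "power_series_on c x r f"
    using assms unfolding real_analytic_on_iff_power_series by blast
  then show ?thesis
    by (intro power_series_on_differentiable)
qed

lemma real_analytic_on_continuous:
  fixes f :: "'a::euclidean_space \<Rightarrow> complex"
  assumes "real_analytic_on f S"
  shows "continuous_on S f"
  using real_analytic_on_differentiable[OF assms]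
  by (auto intro!: continuous_at_imp_continuous_on differentiable_imp_continuous_within
      dest: eventually_nhds_x_imp_x)

lemma real_analytic_on_cong:
  assumes "real_analytic_on f S" and U: "open U" "S \<subseteq> U" and eq: "\<And>x. x \<in> U \<Longrightarrow> f x = g x"
  shows "real_analytic_on g S"
  unfolding real_analytic_on_iff_power_series
proof
  fix x assume "x \<in> S"
  then obtain r c where r: "r > 0" and f: "power_series_on c x r f"
    using assms(1) unfolding real_analytic_on_iff_power_series by blast
  obtain e where e: "e > 0" "ball x e \<subseteq> U"
    using U \<open>x \<in> S\<close> open_contains_ball by blast
  have "power_series_on c x (min r e) g"
    unfolding power_series_on_def
  proof
    fix y assume "y \<in> ball x (min r e)"
    then have "y \<in> ball x r" and [symmetric]: "f y = g y"
      using e(2) eq by auto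
    then show "((\<lambda>\<alpha>. monomial \<alpha> (y - x) *\<^sub>R c \<alpha>) has_sum g y) multi_indices"
      using f by (simp add: power_series_on_def)
  qed
  then show "\<exists>r>0. \<exists>c. power_series_on c x r g"
    using r e(1) by (intro exI[of _ "min r e"]) auto
qed

definition extend_multi_index :: "('a \<Rightarrow> nat) \<Rightarrow> 'a \<times> 'b::zero \<Rightarrow> nat" where
  "extend_multi_index \<alpha> = (\<lambda>(u, v). if v = 0 then \<alpha> u else 0)"

lemma Pair_mem_Basis_iff:
  fixes u :: "'a::euclidean_space" and v :: "'b::euclidean_space"
  shows "(u, v) \<in> Basis \<longleftrightarrow> u \<in> Basis \<and> v = 0 \<or> u = 0 \<and> v \<in> Basis"
  by (auto simp: Basis_prod_def)

lemma bij_betw_extend_multi_index: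
  "bij_betw extend_multi_index multi_indices
    {\<beta> \<in> multi_indices. \<forall>v\<in>Basis. \<beta> (0 :: 'a::euclidean_space, v :: 'b::euclidean_space) = 0}"
proof (rule bij_betwI[where g = "\<lambda>\<beta> u. \<beta> (u, 0)"])
  fix \<beta> :: "'a \<times> 'b \<Rightarrow> nat" assume \<beta>: "\<beta> \<in> {\<beta> \<in> multi_indices. \<forall>v\<in>Basis. \<beta> (0, v) = 0}"
  show "extend_multi_index (\<lambda>u. \<beta> (u, 0)) = \<beta>"
  proof
    show "extend_multi_index (\<lambda>u. \<beta> (u, 0)) w = \<beta> w" for w
      using \<beta> by (cases w; cases "w \<in> Basis") (auto simp: extend_multi_index_def Pair_mem_Basis_iff)
  qed
qed (auto simp: extend_multi_index_def Pair_mem_Basis_iff split: if_splits)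

lemma monomial_Pair_0:
  fixes u :: "'a::euclidean_space"
  shows "monomial \<beta> (u, 0 :: 'b::euclidean_space) = monomial (\<lambda>b. \<beta> (b, 0)) u * (\<Prod>v\<in>Basis. 0 ^ \<beta> (0, v))"
  unfolding monomial_def Basis_prod_def
  by (subst prod.union_disjoint) (auto simp: prod.reindex inj_on_def)

lemma monomial_extend_multi_index:
  fixes u :: "'a::euclidean_space"
  shows "monomial (extend_multi_index \<alpha>) (u, 0 :: 'b::euclidean_space) = monomial \<alpha> u"
proof -
  have "(\<Prod>v\<in>(Basis::'b set). (0::real) ^ extend_multi_index \<alpha> (0::'a, v)) = 1"
    by (rule prod.neutral) (auto simp: extend_multi_index_def)
  then show ?thesis
    unfolding monomial_Pair_0 by (simp add: extend_multi_index_def)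
qed

lemma power_series_on_slice:
  fixes f :: "'a::euclidean_space \<times> 'b::euclidean_space \<Rightarrow> complex"
  assumes "power_series_on c (x, t) r f"
  shows "power_series_on (\<lambda>\<alpha>. c (extend_multi_index \<alpha>)) x r (\<lambda>y. f (y, t))"
  unfolding power_series_on_def
proof
  fix y assume "y \<in> ball x r"
  then have "(y, t) \<in> ball (x, t) r"
    by (simp add: dist_Pair_Pair)
  then have "((\<lambda>\<beta>. monomial \<beta> ((y, t) - (x, t)) *\<^sub>R c \<beta>) has_sum f (y, t)) multi_indices"
    using assms unfolding power_series_on_def by blast
  then have "((\<lambda>\<beta>. monomial \<beta> (y - x, 0) *\<^sub>R c \<beta>) has_sum f (y, t)) multi_indices"
    by (simp only: diff_Pair diff_self)
  then have "((\<lambda>\<beta>. monomial \<beta> (y - x, 0) *\<^sub>R c \<beta>) has_sum f (y, t))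
      {\<beta> \<in> multi_indices. \<forall>v\<in>Basis. \<beta> (0, v) = 0}"
    by (rule has_sum_cong_neutral[THEN iffD1, rotated -1]) (auto simp: monomial_Pair_0)
  then have "((\<lambda>\<alpha>. monomial (extend_multi_index \<alpha>) (y - x, 0 :: 'b) *\<^sub>R c (extend_multi_index \<alpha>))
      has_sum f (y, t)) multi_indices"
    by (rule has_sum_reindex_bij_betw[OF bij_betw_extend_multi_index, THEN iffD2])
  then show "((\<lambda>\<alpha>. monomial \<alpha> (y - x) *\<^sub>R c (extend_multi_index \<alpha>)) has_sum f (y, t)) multi_indices"
    by (simp only: monomial_extend_multi_index)
qed

lemma real_analytic_on_slice:
  fixes f :: "'a::euclidean_space \<times> 'b::euclidean_space \<Rightarrow> complex"
  assumes "real_analytic_on f (S \<times> T)" "t \<in> T"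
  shows "real_analytic_on (\<lambda>x. f (x, t)) S"
  using assms power_series_on_slice unfolding real_analytic_on_iff_power_series by blast

lemma real_analytic_on_C1:
  fixes f :: "'a::euclidean_space \<Rightarrow> complex"
  assumes f: "real_analytic_on f S"
  obtains \<Omega> where "open \<Omega>" "S \<subseteq> \<Omega>" "\<And>w. w \<in> \<Omega> \<Longrightarrow> f differentiable (at w)"
    "\<And>h. continuous_on \<Omega> (\<lambda>w. frechet_derivative f (at w) h)"
proof -
  define \<Omega>0 where "\<Omega>0 = interior {w. f differentiable (at w)}"
  define \<Omega>' where "\<Omega>' b = interior {w. (\<lambda>w. frechet_derivative f (at w) b) differentiable (at w)}" for b
  define \<Omega> where "\<Omega> = \<Omega>0 \<inter> (\<Inter>b\<in>Basis. \<Omega>' b)"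
  have diff: "f differentiable (at w)" if "w \<in> \<Omega>" for w
    using that interior_subset by (auto simp: \<Omega>_def \<Omega>0_def)
  have nhds_interior: "x \<in> interior {w. P w}" if "\<forall>\<^sub>F w in nhds x. P w" for x :: 'a and P
    using that by (auto simp: eventually_nhds interior_def)
  have cont_Basis: "continuous_on \<Omega> (\<lambda>w. frechet_derivative f (at w) b)" if "b \<in> Basis" for b
    using that interior_subset[of "{w. (\<lambda>w. frechet_derivative f (at w) b) differentiable (at w)}"]
    by (intro continuous_at_imp_continuous_on ballI differentiable_imp_continuous_within) (auto simp: \<Omega>_def \<Omega>'_def)
  show ?thesis
  proof
    show "open \<Omega>"
      unfolding \<Omega>_def \<Omega>0_def \<Omega>'_def by (intro open_Int open_INT) auto
    show "S \<subseteq> \<Omega>"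
      using real_analytic_on_differentiable[OF f]
        real_analytic_on_differentiable[OF real_analytic_on_frechet_derivative[OF f]]
      by (auto simp: \<Omega>_def \<Omega>0_def \<Omega>'_def intro: nhds_interior)
    show "continuous_on \<Omega> (\<lambda>w. frechet_derivative f (at w) h)" for h
    proof (rule continuous_on_eq)
      show "continuous_on \<Omega> (\<lambda>w. \<Sum>b\<in>Basis. (h \<bullet> b) *\<^sub>R frechet_derivative f (at w) b)"
        by (intro continuous_intros cont_Basis)
    qed (rule linear_eq_Basis_sum[OF linear_frechet_derivative[OF diff], symmetric])
  qed (fact diff)
qed

section \<open>Discrete subgroups and lattices\<close>

definition int_span :: "'a::real_vector set \<Rightarrow> 'a set" where
  "int_span E = range (\<lambda>k. \<Sum>v\<in>E. of_int (k v) *\<^sub>R v)"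

lemma int_span_insert:
  assumes "finite E" "u \<notin> E" "x - of_int n *\<^sub>R u \<in> int_span E"
  shows "x \<in> int_span (insert u E)"
proof -
  obtain k where "x - of_int n *\<^sub>R u = (\<Sum>v\<in>E. of_int (k v) *\<^sub>R v)"
    using assms(3) by (auto simp: int_span_def)
  moreover have "(\<Sum>v\<in>E. of_int (k v) *\<^sub>R v) = (\<Sum>v\<in>E. of_int ((k(u := n)) v) *\<^sub>R v)"
    using assms(2) by (intro sum.cong) auto
  ultimately have "x = (\<Sum>v\<in>insert u E. of_int ((k(u := n)) v) *\<^sub>R v)"
    using assms(1,2) by (simp add: algebra_simps)
  then show ?thesis
    unfolding int_span_def by blast
qed

lemma int_span_near_span:
  fixes E :: "'a::real_normed_vector set"
  assumes "finite E" "z \<in> span E"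
  obtains w where "w \<in> int_span E" "norm (z - w) \<le> (\<Sum>v\<in>E. norm v)"
proof -
  obtain t where t: "z = (\<Sum>v\<in>E. t v *\<^sub>R v)"
    using assms span_finite by auto
  define w where "w = (\<Sum>v\<in>E. of_int \<lfloor>t v\<rfloor> *\<^sub>R v)"
  have "z - w = (\<Sum>v\<in>E. frac (t v) *\<^sub>R v)"
    by (simp add: t w_def frac_def scaleR_diff_left sum_subtractf)
  also have "norm \<dots> \<le> (\<Sum>v\<in>E. norm v)"
    by (intro sum_norm_le) (auto simp: mult_left_le_one_le frac_ge_0 less_imp_le[OF frac_lt_1])
  finally show ?thesis
    by (intro that[of w]) (auto simp: w_def int_span_def)
qed

lemma exists_coordinate_functional:
  fixes E :: "'a::real_vector set"
  assumes "independent E" "e \<notin> span E"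
  obtains \<phi> :: "'a \<Rightarrow> real" where "linear \<phi>" "\<phi> e = 1" "\<And>x. x \<in> span E \<Longrightarrow> \<phi> x = 0"
    "\<And>x. x \<in> span (insert e E) \<Longrightarrow> x - \<phi> x *\<^sub>R e \<in> span E"
proof -
  have "e \<notin> E"
    using assms(2) span_base by blast
  moreover have "independent (insert e E)"
    using assms \<open>e \<notin> E\<close> by (simp add: independent_insert)
  ultimately obtain \<phi> :: "'a \<Rightarrow> real"
    where lin: "linear \<phi>" and \<phi>: "\<phi> e = 1" "\<And>x. x \<in> E \<Longrightarrow> \<phi> x = 0"
    using linear_independent_extend[of "insert e E" "\<lambda>x. if x = e then 1 else 0"] by (metis insertCI)
  have \<phi>_span: "\<phi> x = 0" if "x \<in> span E" for x
    using linear_eq_0_on_span[OF lin \<phi>(2) that] .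
  have "x - \<phi> x *\<^sub>R e \<in> span E" if x: "x \<in> span (insert e E)" for x
  proof -
    obtain k where k: "x - k *\<^sub>R e \<in> span E"
      using x unfolding span_breakdown_eq by blast
    then have "\<phi> x = k"
      using \<phi>_span[OF k] by (simp add: linear_diff[OF lin] linear_scale[OF lin] \<phi>(1))
    with k show ?thesis
      by simp
  qed
  then show ?thesis
    using that lin \<phi>(1) \<phi>_span by blast
qed

locale discrete_subgroup =
  fixes L :: "'a::euclidean_space set"
  assumes zero_mem: "0 \<in> L" and diff_mem: "x \<in> L \<Longrightarrow> y \<in> L \<Longrightarrow> x - y \<in> L"
    and discrete: "discrete L"
begin

lemma uminus_mem: "x \<in> L \<Longrightarrow> - x \<in> L"
  using diff_mem[OF zero_mem] by simp

lemma add_mem: "x \<in> L \<Longrightarrow> y \<in> L \<Longrightarrow> x + y \<in> L"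
  using diff_mem[OF _ uminus_mem] by simp

lemma scale_int_mem:
  assumes "x \<in> L"
  shows "of_int n *\<^sub>R x \<in> L"
proof -
  have nat: "real m *\<^sub>R x \<in> L" for m
    by (induction m) (use assms in \<open>auto simp: zero_mem add_mem algebra_simps\<close>)
  show ?thesis
    using nat[of "nat n"] uminus_mem[OF nat[of "nat (- n)"]] by (cases "n \<ge> 0") auto
qed

lemma int_span_subset:
  assumes "E \<subseteq> L"
  shows "int_span E \<subseteq> L"
proof -
  have "(\<Sum>v\<in>E. of_int (k v) *\<^sub>R v) \<in> L" for k :: "'a \<Rightarrow> int"
    using assms by (induction E rule: infinite_finite_induct) (auto intro: zero_mem add_mem scale_int_mem)
  then show ?thesis
    by (auto simp: int_span_def)
qed

lemma finite_Int_bounded: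
  assumes "bounded B"
  shows "finite (L \<inter> B)"
proof -
  obtain e where e: "e > 0" "\<And>y. y \<in> L \<Longrightarrow> dist 0 y < e \<Longrightarrow> y = 0"
    using zero_mem discrete unfolding discrete_def isolated_in_dist_Ex_iff by blast
  have "x = y" if "x \<in> L" "y \<in> L" "dist x y < e" for x y
    using e(2)[OF diff_mem[OF that(1,2)]] that(3) by (simp add: dist_norm norm_minus_commute)
  then have "uniform_discrete (L \<inter> B)"
    using e(1) unfolding uniform_discrete_def by blast
  then show ?thesis
    using assms uniform_discrete_finite_iff bounded_Int by blast
qed

text \<open>Modulo \<open>int_span E\<close>, every value of \<open>\<phi>\<close> in \<open>{0<..1}\<close> is attained in one fixed ball.\<close>

lemma minimal_positive_coordinate:
  assumes E: "finite E" "E \<subseteq> L" and e: "e \<in> L"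
    and \<phi>: "linear \<phi>" "\<phi> e = 1" "\<And>x. x \<in> span E \<Longrightarrow> \<phi> x = 0"
      "\<And>x. x \<in> span (insert e E) \<Longrightarrow> x - \<phi> x *\<^sub>R e \<in> span E"
  obtains u where "u \<in> L" "u \<in> span (insert e E)" "\<phi> u > 0"
    "\<And>x. x \<in> L \<Longrightarrow> x \<in> span (insert e E) \<Longrightarrow> \<phi> x > 0 \<Longrightarrow> \<phi> u \<le> \<phi> x"
proof -
  define R where "R = norm e + (\<Sum>v\<in>E. norm v)"
  define Q where "Q = {x \<in> L \<inter> cball 0 R. x \<in> span (insert e E) \<and> \<phi> x > 0}"
  have reduce: "\<exists>x'\<in>Q. \<phi> x' = \<phi> x"
    if x: "x \<in> L" "x \<in> span (insert e E)" "0 < \<phi> x" "\<phi> x \<le> 1" for x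
  proof -
    obtain w where w: "w \<in> int_span E" "norm (x - \<phi> x *\<^sub>R e - w) \<le> (\<Sum>v\<in>E. norm v)"
      using int_span_near_span[OF E(1) \<phi>(4)[OF x(2)]] by blast
    have w_span: "w \<in> span E"
      using w(1) by (auto simp: int_span_def intro: span_sum span_scale span_base)
    have "norm (x - w) \<le> norm (\<phi> x *\<^sub>R e) + norm (x - \<phi> x *\<^sub>R e - w)"
      using norm_triangle_ineq[of "\<phi> x *\<^sub>R e" "x - \<phi> x *\<^sub>R e - w"] by (simp add: algebra_simps)
    also have "\<dots> \<le> R"
      using w(2) x(3,4) by (auto simp: R_def intro!: add_mono mult_left_le_one_le)
    finally have "norm (x - w) \<le> R" .
    moreover have "x - w \<in> L" "x - w \<in> span (insert e E)" "\<phi> (x - w) = \<phi> x"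
      using x w(1) int_span_subset[OF E(2)] w_span span_mono[of E "insert e E"]
      by (auto intro: diff_mem span_diff simp: linear_diff[OF \<phi>(1)] \<phi>(3))
    ultimately show ?thesis
      using x(3) by (intro bexI[of _ "x - w"]) (auto simp: Q_def)
  qed
  have e_Q: "e \<in> Q"
    using e \<phi>(2) by (simp add: Q_def R_def span_base sum_nonneg)
  have "finite Q"
    by (rule finite_subset[OF _ finite_Int_bounded[of "cball 0 R"]]) (auto simp: Q_def)
  then obtain u where u: "u \<in> Q" "\<And>x. x \<in> Q \<Longrightarrow> \<phi> u \<le> \<phi> x"
    using e_Q arg_min_if_finite(1)[of Q \<phi>] arg_min_least[of Q _ \<phi>] by blast
  have "\<phi> u \<le> \<phi> x" if "x \<in> L" "x \<in> span (insert e E)" "\<phi> x > 0" for x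
  proof (cases "\<phi> x \<le> 1")
    case True
    then show ?thesis
      using reduce[OF that] u(2) by metis
  next
    case False
    then show ?thesis
      using u(2)[OF e_Q] \<phi>(2) by simp
  qed
  then show ?thesis
    using u(1) by (intro that[of u]) (auto simp: Q_def)
qed

lemma int_basis_extend:
  assumes E: "finite E" "independent E" "E \<subseteq> L" "L \<inter> span E \<subseteq> int_span E"
    and e: "e \<in> L" "e \<notin> span E"
  obtains u where "u \<in> L" "u \<notin> span E" "span (insert u E) = span (insert e E)"
    "L \<inter> span (insert e E) \<subseteq> int_span (insert u E)"
proof -
  obtain \<phi> :: "'a \<Rightarrow> real" where \<phi>: "linear \<phi>" "\<phi> e = 1" "\<And>x. x \<in> span E \<Longrightarrow> \<phi> x = 0"
    "\<And>x. x \<in> span (insert e E) \<Longrightarrow> x - \<phi> x *\<^sub>R e \<in> span E"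
    using exists_coordinate_functional[OF E(2) e(2)] by blast
  obtain u where u: "u \<in> L" "u \<in> span (insert e E)" "\<phi> u > 0"
    and min: "\<And>x. x \<in> L \<Longrightarrow> x \<in> span (insert e E) \<Longrightarrow> \<phi> x > 0 \<Longrightarrow> \<phi> u \<le> \<phi> x"
    using minimal_positive_coordinate[OF E(1,3) e(1) \<phi>] by blast
  have u_E: "u \<notin> span E" "u \<notin> E"
    using u(3) \<phi>(3) span_base by force+
  have "u - \<phi> u *\<^sub>R e \<in> span (insert u E)"
    using \<phi>(4)[OF u(2)] span_mono[of E "insert u E"] by blast
  then have "(1 / \<phi> u) *\<^sub>R (u - (u - \<phi> u *\<^sub>R e)) \<in> span (insert u E)"
    by (rule span_scale[OF span_diff[OF span_base[OF insertI1]]])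
  then have "e \<in> span (insert u E)"
    using u(3) by simp
  then have span_eq: "span (insert u E) = span (insert e E)"
    using u(2) by (auto simp: span_eq intro: span_base)
  have "x \<in> int_span (insert u E)" if "x \<in> L" "x \<in> span (insert e E)" for x
  proof -
    define n where "n = \<lfloor>\<phi> x / \<phi> u\<rfloor>"
    define y where "y = x - of_int n *\<^sub>R u"
    have y: "y \<in> L" "y \<in> span (insert e E)"
      using that u by (auto simp: y_def intro: diff_mem scale_int_mem span_diff span_scale)
    have "of_int n \<le> \<phi> x / \<phi> u" "\<phi> x / \<phi> u < of_int n + 1"
      unfolding n_def by linarith+
    then have "0 \<le> \<phi> y" "\<phi> y < \<phi> u"
      using u(3) by (auto simp: y_def linear_diff[OF \<phi>(1)] linear_scale[OF \<phi>(1)] field_simps)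
    then have "\<phi> y = 0"
      using min[OF y] by linarith
    then have "y \<in> int_span E"
      using \<phi>(4)[OF y(2)] y(1) E(4) by auto
    then show ?thesis
      unfolding y_def by (rule int_span_insert[OF E(1) u_E(2)])
  qed
  then show ?thesis
    by (intro that[of u] u u_E span_eq) blast
qed

lemma exists_int_basis:
  assumes "finite E" "independent E" "E \<subseteq> L"
  shows "\<exists>B\<subseteq>L. independent B \<and> card B = card E \<and> span B = span E \<and> L \<inter> span E \<subseteq> int_span B"
  using assms
proof (induction E)
  case empty
  then show ?case
    by (auto simp: int_span_def)
next
  case (insert e E)
  have e: "e \<notin> span E" "e \<in> L" and E: "independent E" "E \<subseteq> L"
    using insert.hyps insert.prems by (auto simp: independent_insert)
  obtain B where B: "B \<subseteq> L" "independent B" "card B = card E" "span B = span E" "L \<inter> span B \<subseteq> int_span B"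
    using insert.IH[OF E] by metis
  have "finite B"
    using B(2) by (rule independent_imp_finite)
  obtain u where u: "u \<in> L" "u \<notin> span B" "span (insert u B) = span (insert e B)"
    "L \<inter> span (insert e B) \<subseteq> int_span (insert u B)"
    using int_basis_extend[OF \<open>finite B\<close> B(2,1,5) e(2)] e(1) B(4) by auto
  have "u \<notin> B"
    using u(2) span_base by blast
  moreover have "span (insert e B) = span (insert e E)"
    using B(4) by (simp add: span_insert)
  ultimately show ?case
    using u B(1-3) insert.hyps(1,2) \<open>finite B\<close>
    by (intro exI[of _ "insert u B"]) (simp add: independent_insert)
qed

end

lemma lattice_basis_exists:
  fixes L :: "(real ^ 'n) set"
  assumes "is_lattice L"
  shows "\<exists>b. lattice_basis L b"
proof -
  interpret discrete_subgroup L
    using assms by unfold_locales (auto simp: is_lattice_def)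
  obtain E where E: "E \<subseteq> L" "independent E" "L \<subseteq> span E" "card E = dim L"
    using basis_exists by blast
  obtain B where B: "B \<subseteq> L" "independent B" "card B = card E" "L \<inter> span E \<subseteq> int_span B"
    using exists_int_basis[OF independent_imp_finite[OF E(2)] E(2,1)] by blast
  have card_B: "card B = CARD('n)"
    using B(3) E(4) assms by (simp add: is_lattice_def)
  have L_eq: "L = int_span B"
    using B(4) E(3) int_span_subset[OF B(1)] by blast
  obtain b :: "'n \<Rightarrow> real ^ 'n" where b: "bij_betw b UNIV B"
    using finite_same_card_bij[of "UNIV :: 'n set" B] card_B independent_imp_finite[OF B(2)] by auto
  have "L = range (\<lambda>k::'n \<Rightarrow> int. \<Sum>j\<in>UNIV. of_int (k j) *\<^sub>R b j)" (is "L = range ?comb")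
  proof -
    have reindex: "(\<Sum>v\<in>B. of_int (k v) *\<^sub>R v) = ?comb (\<lambda>j. k (b j))" for k :: "real ^ 'n \<Rightarrow> int"
      using b by (rule sum.reindex_bij_betw[symmetric])
    have "?comb k = (\<Sum>v\<in>B. of_int (k (inv b v)) *\<^sub>R v)" for k
      unfolding reindex using b by (simp add: bij_betw_def inv_f_f)
    then have "?comb k \<in> int_span B" for k
      unfolding int_span_def by (rule range_eqI)
    then show ?thesis
      unfolding L_eq by (auto simp: int_span_def reindex)
  qed
  then show ?thesis
    using b B(2) by (auto simp: lattice_basis_def bij_betw_def)
qed

lemma lattice_basisD:
  fixes b :: "'n \<Rightarrow> real ^ 'n"
  assumes "lattice_basis L b"
  shows "inj b" "independent (range b)" "b j \<in> L"
proof -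
  show "inj b" "independent (range b)"
    using assms by (simp_all add: lattice_basis_def)
  have "b j = (\<Sum>i\<in>UNIV. of_int (if i = j then 1 else 0) *\<^sub>R b i)"
    by (simp add: if_distrib if_distribR cong: if_cong)
  then show "b j \<in> L"
    using assms by (auto simp only: lattice_basis_def intro: range_eqI)
qed

section \<open>Integration over a fundamental domain\<close>

lemma set_lborel_integral_translate:
  fixes f :: "'a::euclidean_space \<Rightarrow> 'b::{banach, second_countable_topology}"
  assumes [measurable]: "f \<in> borel_measurable borel" "D \<in> sets borel"
  shows "(LINT x:D|lborel. f (c + x)) = (LINT x:(\<lambda>x. x - c) -` D|lborel. f x)"
proof -
  have "(LINT x:(\<lambda>x. x - c) -` D|lborel. f x) = (\<integral>x. indicator D (x - c) *\<^sub>R f x \<partial>distr lborel borel ((+) c))"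
    by (simp add: lborel_distr_plus set_lebesgue_integral_def indicator_vimage)
  also have "\<dots> = (LINT x:D|lborel. f (c + x))"
    unfolding set_lebesgue_integral_def by (subst integral_distr) auto
  finally show ?thesis ..
qed

locale lattice =
  fixes L :: "(real ^ 'n) set"
  assumes is_lattice: "is_lattice L"
begin

sublocale discrete_subgroup L
  using is_lattice by unfold_locales (auto simp: is_lattice_def)

definition basis :: "'n \<Rightarrow> real ^ 'n" where
  "basis = (SOME b. lattice_basis L b)"

lemma lattice_basis_basis: "lattice_basis L basis"
  unfolding basis_def by (rule someI_ex[OF lattice_basis_exists[OF is_lattice]])

lemmas inj_basis = lattice_basisD(1)[OF lattice_basis_basis]
  and independent_basis = lattice_basisD(2)[OF lattice_basis_basis]
  and basis_mem = lattice_basisD(3)[OF lattice_basis_basis]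

lemma exists_coordinates: "\<exists>g :: real ^ 'n \<Rightarrow> real ^ 'n. linear g \<and> (\<forall>j. g (basis j) = axis j 1)"
proof -
  obtain g :: "real ^ 'n \<Rightarrow> real ^ 'n"
    where "linear g" "\<And>x. x \<in> range basis \<Longrightarrow> g x = axis (inv basis x) 1"
    using linear_independent_extend[OF independent_basis, of "\<lambda>x. axis (inv basis x) 1"] by blast
  then show ?thesis
    by (intro exI[of _ g]) (simp add: inj_basis)
qed

definition coord :: "real ^ 'n \<Rightarrow> real ^ 'n" where
  "coord = (SOME g. linear g \<and> (\<forall>j. g (basis j) = axis j 1))"

lemma linear_coord: "linear coord" and coord_basis: "coord (basis j) = axis j 1"
  using someI_ex[OF exists_coordinates] unfolding coord_def by simp_all

lemma coord_basis_sum: "coord (\<Sum>j\<in>UNIV. t j *\<^sub>R basis j) $ i = t i"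
  by (simp add: linear_sum[OF linear_coord] linear_scale[OF linear_coord] coord_basis axis_def if_distrib
      cong: if_cong)

lemma basis_sum_coord: "(\<Sum>j\<in>UNIV. (coord x $ j) *\<^sub>R basis j) = x"
proof -
  have "dim (range basis) = DIM(real ^ 'n)"
    by (simp add: dim_eq_card_independent[OF independent_basis] card_image[OF inj_basis])
  then have "x \<in> span (range basis)"
    by (simp only: dim_eq_full UNIV_I)
  then obtain u where "x = (\<Sum>v\<in>range basis. u v *\<^sub>R v)"
    by (auto simp: span_finite)
  then have "x = (\<Sum>j\<in>UNIV. u (basis j) *\<^sub>R basis j)"
    by (simp add: sum.reindex[OF inj_basis])
  then show ?thesis
    using coord_basis_sum[of "\<lambda>j. u (basis j)"] by simp
qed

lemma fundamental_domain_eq: "fundamental_domain L = {x. \<forall>j. 0 \<le> coord x $ j \<and> coord x $ j < 1}"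
proof (intro equalityI subsetI)
  fix x assume "x \<in> fundamental_domain L"
  then show "x \<in> {x. \<forall>j. 0 \<le> coord x $ j \<and> coord x $ j < 1}"
    unfolding fundamental_domain_def Let_def basis_def[symmetric] using coord_basis_sum by auto
next
  fix x assume "x \<in> {x. \<forall>j. 0 \<le> coord x $ j \<and> coord x $ j < 1}"
  then show "x \<in> fundamental_domain L"
    unfolding fundamental_domain_def Let_def basis_def[symmetric]
    by (auto intro!: exI[of _ "\<lambda>j. coord x $ j"] simp: basis_sum_coord)
qed

lemma continuous_coord: "continuous_on A (\<lambda>x. coord x $ j)"
  by (intro continuous_intros linear_continuous_on_compose[OF _ linear_coord])

lemmas borel_measurable_coord [measurable] = borel_measurable_continuous_onI[OF continuous_coord]

lemma fundamental_domain_borel [measurable]: "fundamental_domain L \<in> sets borel"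
  unfolding fundamental_domain_eq by measurable

lemma bounded_fundamental_domain: "bounded (fundamental_domain L)"
  unfolding bounded_iff
proof (intro exI ballI)
  fix x assume "x \<in> fundamental_domain L"
  then have "\<bar>coord x $ j\<bar> \<le> 1" for j
    by (auto simp: fundamental_domain_eq less_imp_le)
  then have "norm (\<Sum>j\<in>UNIV. (coord x $ j) *\<^sub>R basis j) \<le> (\<Sum>j\<in>UNIV. norm (basis j))"
    by (intro sum_norm_le) (auto intro: mult_left_le_one_le)
  then show "norm x \<le> (\<Sum>j\<in>UNIV. norm (basis j))"
    by (simp only: basis_sum_coord)
qed

lemma measure_fundamental_domain_pos: "measure lborel (fundamental_domain L) > 0"
proof -
  define V where "V = (\<Inter>j. {x. 0 < coord x $ j} \<inter> {x. coord x $ j < 1})"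
  have "open V"
    unfolding V_def
    by (intro open_INT finite ballI open_Int open_Collect_less continuous_coord continuous_on_const)
  moreover have "(\<Sum>j\<in>UNIV. (1 / 2) *\<^sub>R basis j) \<in> V"
    by (simp add: V_def coord_basis_sum)
  ultimately have "V \<notin> null_sets lborel"
    using open_not_negligible negligible_iff_null_sets null_sets_completionI by blast
  moreover have "V \<subseteq> fundamental_domain L"
    by (auto simp: V_def fundamental_domain_eq less_imp_le)
  ultimately have "fundamental_domain L \<notin> null_sets lborel"
    using \<open>open V\<close> null_sets_subset[of "fundamental_domain L" lborel V] by auto
  then have "emeasure lborel (fundamental_domain L) \<noteq> 0"
    by (simp add: null_sets_def)
  then show ?thesis
    using emeasure_bounded_finite[OF bounded_fundamental_domain]
    by (simp add: measure_def enn2real_positive_iff zero_less_iff_neq_zero)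
qed

text \<open>
  Translating the parallelepiped by \<open>\<tau> b\<^sub>j\<close> moves a slab out of it; the period \<open>b\<^sub>j\<close> moves it back.
\<close>

lemma fundamental_domain_shift:
  fixes \<tau> :: real and j :: 'n
  assumes \<tau>: "0 \<le> \<tau>" "\<tau> < 1"
  defines "A \<equiv> fundamental_domain L \<inter> {x. \<tau> \<le> coord x $ j}"
    and "B' \<equiv> (\<lambda>x. x - basis j) -` (fundamental_domain L \<inter> {x. coord x $ j < \<tau>})"
  shows "(\<lambda>x. x - \<tau> *\<^sub>R basis j) -` fundamental_domain L = A \<union> B'" "A \<inter> B' = {}"
proof -
  have coord_minus: "coord (x - c *\<^sub>R basis j) $ i = (if i = j then coord x $ i - c else coord x $ i)" for x c i
    by (simp add: linear_diff[OF linear_coord] linear_scale[OF linear_coord] coord_basis axis_def)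
  define P where "P x \<longleftrightarrow> (\<forall>i. i \<noteq> j \<longrightarrow> 0 \<le> coord x $ i \<and> coord x $ i < 1)" for x
  have A: "x \<in> A \<longleftrightarrow> P x \<and> \<tau> \<le> coord x $ j \<and> coord x $ j < 1" for x
    unfolding A_def fundamental_domain_eq P_def using \<tau> by (auto intro: order_trans)
  have B': "x \<in> B' \<longleftrightarrow> P x \<and> 1 \<le> coord x $ j \<and> coord x $ j < 1 + \<tau>" for x
    using coord_minus[of x 1] \<tau>
    unfolding B'_def fundamental_domain_eq P_def by (auto split: if_splits)
  have shifted: "x - \<tau> *\<^sub>R basis j \<in> fundamental_domain L \<longleftrightarrow> P x \<and> \<tau> \<le> coord x $ j \<and> coord x $ j < 1 + \<tau>" for x
    unfolding fundamental_domain_eq P_def mem_Collect_eq coord_minus by (auto simp: algebra_simps)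
  show "(\<lambda>x. x - \<tau> *\<^sub>R basis j) -` fundamental_domain L = A \<union> B'"
  proof (rule set_eqI)
    show "x \<in> (\<lambda>x. x - \<tau> *\<^sub>R basis j) -` fundamental_domain L \<longleftrightarrow> x \<in> A \<union> B'" for x
      unfolding vimage_eq Un_iff shifted A B' using \<tau> by auto
  qed
  show "A \<inter> B' = {}"
    by (auto simp: A B')
qed

lemma integral_fundamental_domain_translate_basis:
  fixes G :: "real ^ 'n \<Rightarrow> 'b::{banach, second_countable_topology}"
  assumes G: "continuous_on UNIV G" and per: "\<And>x l. l \<in> L \<Longrightarrow> G (x + l) = G x"
    and \<tau>: "0 \<le> \<tau>" "\<tau> < 1"
  shows "(LINT x:fundamental_domain L|lborel. G (x + \<tau> *\<^sub>R basis j)) = (LINT x:fundamental_domain L|lborel. G x)"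
proof -
  let ?D = "fundamental_domain L"
  define A where "A = ?D \<inter> {x. \<tau> \<le> coord x $ j}"
  define B where "B = ?D \<inter> {x. coord x $ j < \<tau>}"
  define B' where "B' = (\<lambda>x. x - basis j) -` B"
  note [measurable] = borel_measurable_continuous_onI[OF G]
  have meas [measurable]: "A \<in> sets borel" "B \<in> sets borel"
    unfolding A_def B_def by measurable
  have meas' [measurable]: "B' \<in> sets borel"
    unfolding B'_def by (rule measurable_sets_borel[OF _ meas(2)]) measurable
  have bounded: "bounded A" "bounded B"
    unfolding A_def B_def by (intro bounded_subset[OF bounded_fundamental_domain]; blast)+
  have "x \<in> (\<lambda>x. basis j + x) ` B" if "x \<in> B'" for x
    using that by (intro image_eqI[of _ _ "x - basis j"]) (auto simp: B'_def)
  then have bounded': "bounded B'"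
    by (intro bounded_subset[OF bounded_translation[OF bounded(2)]] subsetI)
  have int: "set_integrable lborel S G" if "bounded S" "S \<in> sets borel" for S
    using that by (intro set_integrable_continuous_on_closure continuous_on_subset[OF G]) auto
  have partition: "A \<inter> B = {}" "A \<union> B = ?D"
    by (auto simp: A_def B_def)
  note shift = fundamental_domain_shift[OF \<tau>, where j = j, folded A_def B_def, folded B'_def]
  have "(LINT x:?D|lborel. G (x + \<tau> *\<^sub>R basis j)) = (LINT x:A \<union> B'|lborel. G x)"
    using set_lborel_integral_translate[of G ?D "\<tau> *\<^sub>R basis j"] by (simp add: shift(1) add.commute)
  also have "\<dots> = (LINT x:A|lborel. G x) + (LINT x:B'|lborel. G x)"
    by (intro set_integral_Un shift(2) int bounded bounded' meas meas')
  also have "(LINT x:B'|lborel. G x) = (LINT x:B|lborel. G (basis j + x))"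
    unfolding B'_def by (rule set_lborel_integral_translate[symmetric]) measurable
  also have "\<dots> = (LINT x:B|lborel. G x)"
    by (simp only: add.commute[of "basis j"] per[OF basis_mem])
  also have "(LINT x:A|lborel. G x) + (LINT x:B|lborel. G x) = (LINT x:A \<union> B|lborel. G x)"
    by (intro set_integral_Un[symmetric] partition int bounded meas)
  finally show ?thesis
    by (simp only: partition)
qed

lemma integral_fundamental_domain_translate:
  fixes G :: "real ^ 'n \<Rightarrow> 'b::{banach, second_countable_topology}"
  assumes G: "continuous_on UNIV G" and per: "\<And>x l. l \<in> L \<Longrightarrow> G (x + l) = G x"
  shows "(LINT x:fundamental_domain L|lborel. G (x + w)) = (LINT x:fundamental_domain L|lborel. G x)"
proof -
  define v where "v J = (\<Sum>j\<in>J. (coord w $ j) *\<^sub>R basis j)" for J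
  have "(LINT x:fundamental_domain L|lborel. G (x + v J)) = (LINT x:fundamental_domain L|lborel. G x)" for J
    using finite[of J]
  proof (induction J)
    case (insert j J)
    let ?c = "coord w $ j"
    have "G (x + v (insert j J)) = G (x + frac ?c *\<^sub>R basis j + v J)" for x
    proof -
      have "x + v (insert j J) = x + frac ?c *\<^sub>R basis j + v J + of_int \<lfloor>?c\<rfloor> *\<^sub>R basis j"
        using insert.hyps by (simp add: v_def frac_def algebra_simps)
      then show ?thesis
        by (simp only: per scale_int_mem basis_mem)
    qed
    moreover have "(LINT x:fundamental_domain L|lborel. G (x + frac ?c *\<^sub>R basis j + v J))
        = (LINT x:fundamental_domain L|lborel. G (x + v J))"
    proof (rule integral_fundamental_domain_translate_basis)
      show "continuous_on UNIV (\<lambda>x. G (x + v J))"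
        by (intro continuous_on_compose2[OF G] continuous_intros) auto
      show "G (x + l + v J) = G (x + v J)" if "l \<in> L" for x l
        using per[OF that, of "x + v J"] by (simp add: add.assoc add.commute add.left_commute)
    qed (simp_all add: frac_lt_1)
    ultimately show ?case
      by (simp add: insert.IH)
  qed (simp add: v_def)
  moreover have "v UNIV = w"
    by (simp add: v_def basis_sum_coord)
  ultimately show ?thesis
    by metis
qed

lemma integral_fundamental_domain_derivative_eq_0:
  fixes G :: "real ^ 'n \<Rightarrow> 'b::{banach, second_countable_topology}"
  assumes per: "\<And>x l. l \<in> L \<Longrightarrow> G (x + l) = G x"
    and der: "\<And>x. ((\<lambda>\<tau>. G (x + \<tau> *\<^sub>R v)) has_vector_derivative G' x) (at 0)"
    and G: "continuous_on UNIV G" and G': "continuous_on UNIV G'"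
  shows "(LINT x:fundamental_domain L|lborel. G' x) = 0"
proof -
  have "((\<lambda>\<tau>. LINT x:fundamental_domain L|lborel. G (x + \<tau> *\<^sub>R v)) has_vector_derivative
      (LINT x:fundamental_domain L|lborel. G' (x + 0 *\<^sub>R v))) (at 0)"
  proof (rule has_vector_derivative_set_integral[of _ UNIV])
    show "((\<lambda>\<tau>. G (x + \<tau> *\<^sub>R v)) has_vector_derivative G' (x + \<tau> *\<^sub>R v)) (at \<tau>)" for \<tau> x
    proof -
      have "((\<lambda>\<tau>'. G (x + \<tau> *\<^sub>R v + \<tau>' *\<^sub>R v)) \<circ> (\<lambda>\<sigma>. \<sigma> - \<tau>) has_vector_derivative 1 *\<^sub>R G' (x + \<tau> *\<^sub>R v)) (at \<tau>)"
        by (rule vector_diff_chain_at) (auto intro!: derivative_eq_intros simp: der)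
      then show ?thesis
        by (simp add: o_def scaleR_diff_left)
    qed
    show "continuous_on (UNIV \<times> UNIV) (\<lambda>(\<tau>, x). G (x + \<tau> *\<^sub>R v))"
      "continuous_on (UNIV \<times> UNIV) (\<lambda>(\<tau>, x). G' (x + \<tau> *\<^sub>R v))"
      unfolding case_prod_unfold
      by (auto intro!: continuous_on_compose2[OF G] continuous_on_compose2[OF G'] continuous_intros)
  qed (simp_all add: bounded_fundamental_domain)
  moreover have "((\<lambda>\<tau>. LINT x:fundamental_domain L|lborel. G (x + \<tau> *\<^sub>R v)) has_vector_derivative 0) (at 0)"
    by (simp add: integral_fundamental_domain_translate[OF G per])
  ultimately have "(LINT x:fundamental_domain L|lborel. G' (x + 0 *\<^sub>R v)) = 0"
    by (rule vector_derivative_unique_at)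
  then show ?thesis
    by simp
qed

end

section \<open>Linear ordinary differential equations of second order\<close>

definition ode_solution :: "(real \<Rightarrow> complex) \<Rightarrow> (real \<Rightarrow> complex) \<Rightarrow> bool" where
  "ode_solution q f \<longleftrightarrow>
     (\<exists>f'. \<forall>t>0. (f has_vector_derivative f' t) (at t) \<and> (f' has_vector_derivative q t * f t) (at t))"

lemma ode_solutionI:
  assumes "\<And>t. t > 0 \<Longrightarrow> (f has_vector_derivative f' t) (at t)"
    and "\<And>t. t > 0 \<Longrightarrow> (f' has_vector_derivative q t * f t) (at t)"
  shows "ode_solution q f"
  using assms by (auto simp: ode_solution_def)

lemma ode_solutionE:
  assumes "ode_solution q f"
  obtains f' where "\<And>t. t > 0 \<Longrightarrow> (f has_vector_derivative f' t) (at t)"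
    "\<And>t. t > 0 \<Longrightarrow> (f' has_vector_derivative q t * f t) (at t)"
  using assms by (auto simp: ode_solution_def)

lemma ode_solution_diff:
  assumes "ode_solution q f" "ode_solution q g"
  shows "ode_solution q (\<lambda>t. f t - c * g t)"
proof -
  obtain f' where f: "\<And>t. t > 0 \<Longrightarrow> (f has_vector_derivative f' t) (at t)"
    "\<And>t. t > 0 \<Longrightarrow> (f' has_vector_derivative q t * f t) (at t)"
    using ode_solutionE[OF assms(1)] by blast
  obtain g' where g: "\<And>t. t > 0 \<Longrightarrow> (g has_vector_derivative g' t) (at t)"
    "\<And>t. t > 0 \<Longrightarrow> (g' has_vector_derivative q t * g t) (at t)"
    using ode_solutionE[OF assms(2)] by blast
  show ?thesis
  proof (rule ode_solutionI)
    fix t :: real assume t: "t > 0"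
    show "((\<lambda>t. f t - c * g t) has_vector_derivative f' t - c * g' t) (at t)"
      by (intro has_vector_derivative_diff has_vector_derivative_mult_right f g t)
    have "((\<lambda>t. f' t - c * g' t) has_vector_derivative q t * f t - c * (q t * g t)) (at t)"
      by (intro has_vector_derivative_diff has_vector_derivative_mult_right f g t)
    then show "((\<lambda>t. f' t - c * g' t) has_vector_derivative q t * (f t - c * g t)) (at t)"
      by (simp add: algebra_simps)
  qed
qed

lemma has_real_derivative_inner:
  fixes f g :: "real \<Rightarrow> 'a::real_inner"
  assumes "(f has_vector_derivative f') (at t)" "(g has_vector_derivative g') (at t)"
  shows "((\<lambda>t. f t \<bullet> g t) has_real_derivative (f t \<bullet> g' + f' \<bullet> g t)) (at t)"
  unfolding has_field_derivative_def
  by (rule has_derivative_eq_rhs[OF has_derivative_inner[OF assms[unfolded has_vector_derivative_def]]])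
    (simp add: fun_eq_iff algebra_simps)

lemma gronwall_nonpos_backward:
  fixes E E' :: "real \<Rightarrow> real"
  assumes "t \<le> t1" "E t1 \<le> 0"
    and der: "\<And>\<tau>. t \<le> \<tau> \<Longrightarrow> \<tau> \<le> t1 \<Longrightarrow> (E has_real_derivative E' \<tau>) (at \<tau>)"
    and bound: "\<And>\<tau>. t \<le> \<tau> \<Longrightarrow> \<tau> \<le> t1 \<Longrightarrow> E' \<tau> \<ge> - (K * E \<tau>)"
  shows "E t \<le> 0"
proof -
  have "E t * exp (K * t) \<le> E t1 * exp (K * t1)"
  proof (rule DERIV_nonneg_imp_nondecreasing[OF \<open>t \<le> t1\<close>])
    fix \<tau> assume \<tau>: "t \<le> \<tau>" "\<tau> \<le> t1"
    have "((\<lambda>\<tau>. E \<tau> * exp (K * \<tau>)) has_real_derivative exp (K * \<tau>) * (E' \<tau> + K * E \<tau>)) (at \<tau>)"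
      by (rule derivative_eq_intros der[OF \<tau>] refl)+ (simp add: algebra_simps)
    moreover have "exp (K * \<tau>) * (E' \<tau> + K * E \<tau>) \<ge> 0"
      using bound[OF \<tau>] by simp
    ultimately show "\<exists>y. ((\<lambda>\<tau>. E \<tau> * exp (K * \<tau>)) has_real_derivative y) (at \<tau>) \<and> 0 \<le> y"
      by blast
  qed
  also have "\<dots> \<le> 0"
    using \<open>E t1 \<le> 0\<close> by (simp add: mult_le_0_iff)
  finally show ?thesis
    by (simp add: mult_le_0_iff)
qed

lemma second_order_zero_backward:
  fixes g g' g'' :: "real \<Rightarrow> 'a::real_inner"
  assumes "t \<le> t1" "g t1 = 0" "g' t1 = 0" "K \<ge> 0"
    and d1: "\<And>\<tau>. t \<le> \<tau> \<Longrightarrow> \<tau> \<le> t1 \<Longrightarrow> (g has_vector_derivative g' \<tau>) (at \<tau>)"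
    and d2: "\<And>\<tau>. t \<le> \<tau> \<Longrightarrow> \<tau> \<le> t1 \<Longrightarrow> (g' has_vector_derivative g'' \<tau>) (at \<tau>)"
    and K: "\<And>\<tau>. t \<le> \<tau> \<Longrightarrow> \<tau> \<le> t1 \<Longrightarrow> norm (g'' \<tau>) \<le> K * norm (g \<tau>)"
  shows "g t = 0"
proof -
  define E where "E \<tau> = g \<tau> \<bullet> g \<tau> + g' \<tau> \<bullet> g' \<tau>" for \<tau>
  have "E t \<le> 0"
  proof (rule gronwall_nonpos_backward[OF \<open>t \<le> t1\<close>])
    fix \<tau> assume \<tau>: "t \<le> \<tau>" "\<tau> \<le> t1"
    show "(E has_real_derivative 2 * (g \<tau> \<bullet> g' \<tau> + g' \<tau> \<bullet> g'' \<tau>)) (at \<tau>)"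
      unfolding E_def
      by (rule DERIV_cong[OF DERIV_add[OF has_real_derivative_inner[OF d1[OF \<tau>] d1[OF \<tau>]]
              has_real_derivative_inner[OF d2[OF \<tau>] d2[OF \<tau>]]]])
        (simp add: inner_commute)
    have "\<bar>g' \<tau> \<bullet> g'' \<tau>\<bar> \<le> norm (g' \<tau>) * (K * norm (g \<tau>))"
      by (rule order_trans[OF Cauchy_Schwarz_ineq2 mult_left_mono[OF K[OF \<tau>] norm_ge_zero]])
    moreover have "\<bar>g \<tau> \<bullet> g' \<tau>\<bar> \<le> norm (g \<tau>) * norm (g' \<tau>)"
      by (rule Cauchy_Schwarz_ineq2)
    ultimately have "\<bar>g \<tau> \<bullet> g' \<tau> + g' \<tau> \<bullet> g'' \<tau>\<bar> \<le> (1 + K) * (norm (g \<tau>) * norm (g' \<tau>))"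
      by (simp add: algebra_simps)
    moreover have "(1 + K) * (2 * (norm (g \<tau>) * norm (g' \<tau>))) \<le> (1 + K) * E \<tau>"
      using sum_squares_bound[of "norm (g \<tau>)" "norm (g' \<tau>)"] \<open>K \<ge> 0\<close>
      by (intro mult_left_mono) (simp_all add: E_def power2_norm_eq_inner[symmetric])
    ultimately show "2 * (g \<tau> \<bullet> g' \<tau> + g' \<tau> \<bullet> g'' \<tau>) \<ge> - ((1 + K) * E \<tau>)"
      by (simp add: mult.left_commute)
  qed (simp add: E_def assms)
  then have "g t \<bullet> g t = 0"
    using inner_ge_zero[of "g t"] inner_ge_zero[of "g' t"] unfolding E_def by linarith
  then show ?thesis
    by simp
qed

lemma convex_on_tendsto_0_nonpos:
  fixes f :: "real \<Rightarrow> real"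
  assumes conv: "convex_on {a..} f" and "f a \<le> 0" and lim: "(f \<longlongrightarrow> 0) at_top" and "a \<le> t"
  shows "f t \<le> 0"
proof (rule tendsto_lowerbound)
  show "((\<lambda>b. \<bar>f b\<bar>) \<longlongrightarrow> 0) at_top"
    using tendsto_rabs_zero[OF lim] .
  show "\<forall>\<^sub>F b in at_top. f t \<le> \<bar>f b\<bar>"
    using eventually_gt_at_top[of t]
  proof eventually_elim
    case (elim b)
    define w where "w = (t - a) / (b - a)"
    have w: "0 \<le> w" "w \<le> 1"
      using elim \<open>a \<le> t\<close> by (auto simp: w_def)
    have "w * (b - a) = t - a"
      using elim \<open>a \<le> t\<close> by (simp add: w_def)
    then have "t = (1 - w) *\<^sub>R a + w *\<^sub>R b"
      by (simp add: algebra_simps)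
    then have "f t \<le> (1 - w) * f a + w * f b"
      using convex_onD[OF conv w, of a b] elim \<open>a \<le> t\<close> by simp
    also have "\<dots> \<le> 0 + 1 * \<bar>f b\<bar>"
      using w \<open>f a \<le> 0\<close> by (intro add_mono mult_nonneg_nonpos order_trans[OF mult_left_mono mult_right_mono]) auto
    finally show ?case
      by simp
  qed
qed simp

text \<open>Where \<open>g \<bullet> g'' \<ge> 0\<close> the function \<open>\<bar>g\<bar>\<^sup>2\<close> is convex.\<close>

lemma second_order_zero_forward:
  fixes g g' g'' :: "real \<Rightarrow> 'a::real_inner"
  assumes d1: "\<And>t. t0 \<le> t \<Longrightarrow> (g has_vector_derivative g' t) (at t)"
    and d2: "\<And>t. t0 \<le> t \<Longrightarrow> (g' has_vector_derivative g'' t) (at t)"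
    and nonneg: "\<And>t. t0 \<le> t \<Longrightarrow> g t \<bullet> g'' t \<ge> 0"
    and "g t0 = 0" and lim: "(g \<longlongrightarrow> 0) at_top" and "t0 \<le> t"
  shows "g t = 0"
proof -
  have "convex_on {t0..} (\<lambda>t. g t \<bullet> g t)"
  proof (rule f''_ge0_imp_convex[where f' = "\<lambda>t. 2 * (g t \<bullet> g' t)"
          and f'' = "\<lambda>t. 2 * (g t \<bullet> g'' t + g' t \<bullet> g' t)"])
    fix t assume "t \<in> {t0..}"
    then have t: "t0 \<le> t" by simp
    show "((\<lambda>t. g t \<bullet> g t) has_real_derivative 2 * (g t \<bullet> g' t)) (at t)"
      using has_real_derivative_inner[OF d1[OF t] d1[OF t]] by (simp add: inner_commute)
    show "((\<lambda>t. 2 * (g t \<bullet> g' t)) has_real_derivative 2 * (g t \<bullet> g'' t + g' t \<bullet> g' t)) (at t)"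
      by (intro DERIV_cmult has_real_derivative_inner d1 d2 t)
    show "2 * (g t \<bullet> g'' t + g' t \<bullet> g' t) \<ge> 0"
      using nonneg[OF t] by simp
  qed simp
  moreover have "((\<lambda>t. g t \<bullet> g t) \<longlongrightarrow> 0) at_top"
    using tendsto_inner[OF lim lim] by simp
  ultimately have "g t \<bullet> g t \<le> 0"
    using \<open>g t0 = 0\<close> \<open>t0 \<le> t\<close> by (auto dest: convex_on_tendsto_0_nonpos)
  then have "g t \<bullet> g t = 0"
    using inner_ge_zero[of "g t"] by linarith
  then show ?thesis
    by simp
qed

lemma ode_solution_zero_of_decay:
  assumes sol: "ode_solution q g" and q: "continuous_on {0<..} q" and lim: "(g \<longlongrightarrow> 0) at_top"
    and t0: "t0 > 0" "g t0 = 0" and Re_q: "\<And>t. t \<ge> t0 \<Longrightarrow> Re (q t) \<ge> 0"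
    and t: "t > 0"
  shows "g t = 0"
proof -
  obtain g' where d1: "\<And>t. t > 0 \<Longrightarrow> (g has_vector_derivative g' t) (at t)"
    and d2: "\<And>t. t > 0 \<Longrightarrow> (g' has_vector_derivative q t * g t) (at t)"
    using ode_solutionE[OF sol] by blast
  have forward: "g \<tau> = 0" if "t0 \<le> \<tau>" for \<tau>
  proof (rule second_order_zero_forward[where g = g and g' = g' and g'' = "\<lambda>t. q t * g t"])
    show "g x \<bullet> (q x * g x) \<ge> 0" if "t0 \<le> x" for x
    proof -
      have "g x \<bullet> (q x * g x) = Re (q x) * (norm (g x))\<^sup>2"
        unfolding cmod_power2 by (simp add: inner_complex_def algebra_simps power2_eq_square)
      then show ?thesis
        using Re_q[OF that] by simp
    qed
  qed (use that t0 d1 d2 lim in auto)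
  show ?thesis
  proof (cases "t0 \<le> t")
    case False
    have "compact (q ` {t..t0 + 1})"
      using t by (intro compact_continuous_image continuous_on_subset[OF q]) auto
    then obtain K where K: "K > 0" "\<And>\<tau>. \<tau> \<in> {t..t0 + 1} \<Longrightarrow> norm (q \<tau>) \<le> K"
      using compact_imp_bounded[of "q ` {t..t0 + 1}"] by (auto simp: bounded_pos)
    have "((\<lambda>x. 0) has_vector_derivative g' (t0 + 1)) (at (t0 + 1))"
      by (rule has_vector_derivative_transform_within_open[OF d1, of _ "{t0<..}"])
        (use t0(1) forward in auto)
    then have "g' (t0 + 1) = 0"
      using vector_derivative_unique_at has_vector_derivative_const by blast
    show ?thesis
    proof (rule second_order_zero_backward[where g = g and g' = g' and g'' = "\<lambda>t. q t * g t" and ?t1.0 = "t0 + 1"])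
      show "norm (q \<tau> * g \<tau>) \<le> K * norm (g \<tau>)" if "t \<le> \<tau>" "\<tau> \<le> t0 + 1" for \<tau>
        using K(2)[of \<tau>] that by (simp add: norm_mult mult_right_mono)
    qed (use False t K(1) d1 d2 forward \<open>g' (t0 + 1) = 0\<close> in auto)
  qed (rule forward)
qed

lemma decaying_ode_solutions_proportional:
  assumes sol: "ode_solution q f" "ode_solution q g" and q: "continuous_on {0<..} q"
    and lim: "(f \<longlongrightarrow> 0) at_top" "(g \<longlongrightarrow> 0) at_top"
    and t0: "t0 > 0" "g t0 \<noteq> 0" and Re_q: "\<And>t. t \<ge> t0 \<Longrightarrow> Re (q t) \<ge> 0"
  obtains c where "\<And>t. t > 0 \<Longrightarrow> f t = c * g t"
proof
  let ?c = "f t0 / g t0"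
  fix t :: real assume "t > 0"
  have "((\<lambda>t. f t - ?c * g t) \<longlongrightarrow> 0) at_top"
    using tendsto_diff[OF lim(1) tendsto_mult_left[OF lim(2), of ?c]] by simp
  from ode_solution_zero_of_decay[OF ode_solution_diff[OF sol] q this t0(1) _ Re_q \<open>t > 0\<close>]
  have "f t - ?c * g t = 0"
    using t0(2) by simp
  then show "f t = ?c * g t"
    by simp
qed

lemma has_vector_derivative_powr_of_real:
  fixes a :: complex
  assumes "t > 0"
  shows "((\<lambda>t. of_real t powr a) has_vector_derivative a * of_real t powr (a - 1)) (at t)"
proof -
  have "((\<lambda>z. z powr a) has_field_derivative a * of_real t powr (a - 1)) (at (of_real t))"
    using assms by (auto intro!: derivative_eq_intros)
  then show ?thesis
    by (rule has_vector_derivative_real_field)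
qed

lemma euler_ode_first_integral:
  fixes a :: complex and f :: "real \<Rightarrow> complex"
  assumes d1: "\<And>t. t > 0 \<Longrightarrow> (f has_vector_derivative f' t) (at t)"
    and d2: "\<And>t. t > 0 \<Longrightarrow> (f' has_vector_derivative a * (a - 1) / (of_real t)\<^sup>2 * f t) (at t)"
  obtains c where "\<And>t. t > 0 \<Longrightarrow> of_real t * f' t - (1 - a) * f t = c * of_real t powr a"
proof -
  define k where "k t = (of_real t * f' t - (1 - a) * f t) * of_real t powr (- a)" for t
  have "(k has_vector_derivative 0) (at t within {0<..})" if t: "t \<in> {0<..}" for t
  proof -
    let ?z = "complex_of_real t"
    have z: "?z \<noteq> 0" and "t > 0"
      using t by auto
    have "((\<lambda>t. complex_of_real t) has_vector_derivative 1) (at t)"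
      using has_vector_derivative_of_real[OF DERIV_ident] by simp
    from has_vector_derivative_mult[OF this d2[OF \<open>t > 0\<close>]] d1[OF \<open>t > 0\<close>]
    have "((\<lambda>t. of_real t * f' t - (1 - a) * f t) has_vector_derivative
        ?z * (a * (a - 1) / ?z\<^sup>2 * f t) + 1 * f' t - (1 - a) * f' t) (at t)"
      by (intro has_vector_derivative_diff has_vector_derivative_mult_right)
    from has_vector_derivative_mult[OF this has_vector_derivative_powr_of_real[OF \<open>t > 0\<close>, of "- a"]]
    have "(k has_vector_derivative
        (?z * f' t - (1 - a) * f t) * (- a * ?z powr (- a - 1))
        + (?z * (a * (a - 1) / ?z\<^sup>2 * f t) + 1 * f' t - (1 - a) * f' t) * ?z powr (- a)) (at t)"
      unfolding k_def .
    also have "?z powr (- a) = ?z * ?z powr (- a - 1)"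
      using z by (simp add: powr_diff)
    also have "(?z * f' t - (1 - a) * f t) * (- a * ?z powr (- a - 1))
        + (?z * (a * (a - 1) / ?z\<^sup>2 * f t) + 1 * f' t - (1 - a) * f' t) * (?z * ?z powr (- a - 1)) = 0"
      using z by (simp add: power2_eq_square divide_simps) (simp add: algebra_simps)
    finally show ?thesis
      by (rule has_vector_derivative_at_within)
  qed
  then obtain c where c: "\<And>t. t \<in> {0<..} \<Longrightarrow> k t = c"
    using has_vector_derivative_zero_constant[of "{0<..}" k] convex_real_interval(3) by blast
  have "of_real t * f' t - (1 - a) * f t = c * of_real t powr a" if "t > 0" for t
    using c[of t] that by (simp add: k_def powr_minus field_simps)
  then show ?thesis
    using that by blast
qed

text \<open>The coefficient \<open>s (s - 1)\<close> is symmetric under \<open>s \<mapsto> 1 - s\<close>, which gives two first integrals.\<close>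

lemma euler_ode_general_solution:
  fixes s :: complex
  assumes "s \<noteq> 1 / 2" and sol: "ode_solution (\<lambda>t. s * (s - 1) / (of_real t)\<^sup>2) f"
  obtains c1 c2 where "\<And>t. t > 0 \<Longrightarrow> f t = c1 * of_real t powr s + c2 * of_real t powr (1 - s)"
proof -
  obtain f' where f: "\<And>t. t > 0 \<Longrightarrow> (f has_vector_derivative f' t) (at t)"
    "\<And>t. t > 0 \<Longrightarrow> (f' has_vector_derivative s * (s - 1) / (of_real t)\<^sup>2 * f t) (at t)"
    using ode_solutionE[OF sol] by blast
  have sym: "(1 - s) * (1 - s - 1) = s * (s - 1)"
    by (simp add: algebra_simps)
  obtain c1 where c1: "\<And>t. t > 0 \<Longrightarrow> of_real t * f' t - (1 - s) * f t = c1 * of_real t powr s"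
    using euler_ode_first_integral[OF f] by blast
  obtain c2 where c2: "\<And>t. t > 0 \<Longrightarrow> of_real t * f' t - (1 - (1 - s)) * f t = c2 * of_real t powr (1 - s)"
    using euler_ode_first_integral[of f f' "1 - s"] f unfolding sym by blast
  have s2: "2 * s - 1 \<noteq> 0"
    using \<open>s \<noteq> 1 / 2\<close> by (simp add: field_simps)
  have "f t = c1 / (2 * s - 1) * of_real t powr s + (- c2 / (2 * s - 1)) * of_real t powr (1 - s)"
    if "t > 0" for t
  proof -
    have "(2 * s - 1) * f t = c1 * of_real t powr s - c2 * of_real t powr (1 - s)"
      using c1[OF that] c2[OF that] by (simp add: algebra_simps)
    then have "f t = (c1 * of_real t powr s - c2 * of_real t powr (1 - s)) / (2 * s - 1)"
      using s2 by (simp add: eq_divide_eq mult.commute)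
    then show ?thesis
      by (simp add: diff_divide_distrib)
  qed
  then show ?thesis
    using that by blast
qed

lemma euler_ode_solution_asymptotic:
  fixes s b :: complex
  assumes s: "Re s > 1 / 2" and sol: "ode_solution (\<lambda>t. s * (s - 1) / (of_real t)\<^sup>2) f"
    and bound: "\<And>t. t > 0 \<Longrightarrow> norm (f t - b * of_real t powr s) \<le> C * t powr (1 - Re s)"
  obtains c where "\<And>t. t > 0 \<Longrightarrow> f t = b * of_real t powr s + c * of_real t powr (1 - s)"
proof -
  have "Re s \<noteq> Re (1 / 2)"
    using s by simp
  then have "s \<noteq> 1 / 2"
    by metis
  then obtain c1 c2 where c: "\<And>t. t > 0 \<Longrightarrow> f t = c1 * of_real t powr s + c2 * of_real t powr (1 - s)"
    using euler_ode_general_solution[OF _ sol] by blast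
  have "norm (c1 - b) \<le> (C + norm c2) * t powr (1 - 2 * Re s)" if t: "t > 0" for t
  proof -
    have "norm (c1 - b) * t powr Re s = norm ((c1 - b) * of_real t powr s)"
      using t by (simp add: norm_mult norm_powr_real_powr)
    also have "(c1 - b) * of_real t powr s = (f t - b * of_real t powr s) - c2 * of_real t powr (1 - s)"
      by (simp add: c[OF t] algebra_simps)
    also have "norm \<dots> \<le> C * t powr (1 - Re s) + norm c2 * t powr (1 - Re s)"
      by (rule order_trans[OF norm_triangle_ineq4 add_mono[OF bound[OF t]]])
        (use t in \<open>simp add: norm_mult norm_powr_real_powr\<close>)
    finally have "norm (c1 - b) \<le> (C + norm c2) * (t powr (1 - Re s) / t powr Re s)"
      using t by (simp add: field_simps)
    then show ?thesis
      by (simp flip: powr_diff)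
  qed
  then have "\<forall>\<^sub>F t in at_top. norm (c1 - b) \<le> (C + norm c2) * t powr (1 - 2 * Re s)"
    using eventually_gt_at_top[of 0] by (rule eventually_mono[rotated])
  moreover have "((\<lambda>t. (C + norm c2) * t powr (1 - 2 * Re s)) \<longlongrightarrow> (C + norm c2) * 0) at_top"
    using s by (intro tendsto_mult tendsto_const tendsto_neg_powr filterlim_ident) auto
  ultimately have "norm (c1 - b) \<le> (C + norm c2) * 0"
    using tendsto_lowerbound trivial_limit_at_top_linorder by blast
  then show ?thesis
    using that c by simp
qed

section \<open>The Tricomi integral\<close>

definition tricomi_kernel :: "complex \<Rightarrow> complex \<Rightarrow> real \<Rightarrow> real \<Rightarrow> complex" where
  "tricomi_kernel a b x t = indicator {0<..} t *\<^sub>R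
     (of_real (exp (- x * t)) * of_real t powr (a - 1) * of_real (1 + t) powr (b - a - 1))"

definition tricomi_laplace :: "complex \<Rightarrow> complex \<Rightarrow> real \<Rightarrow> complex" where
  "tricomi_laplace a b x = (\<integral>t. tricomi_kernel a b x t \<partial>lborel)"

lemma tricomi_integral_eq: "tricomi_integral a b x = rGamma a * tricomi_laplace a b x"
  by (simp add: tricomi_integral_def tricomi_laplace_def tricomi_kernel_def set_lebesgue_integral_def)

lemma tricomi_kernel_measurable [measurable]: "tricomi_kernel a b x \<in> borel_measurable borel"
  unfolding tricomi_kernel_def
  by (intro borel_measurable_continuous_on_indicator continuous_intros) (auto simp: complex_eq_iff)

lemma tricomi_kernel_continuous: "continuous_on {0<..} (tricomi_kernel a b x)"
proof (rule continuous_on_eq)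
  show "continuous_on {0<..} (\<lambda>t. of_real (exp (- x * t)) * of_real t powr (a - 1)
      * of_real (1 + t) powr (b - a - 1))"
    by (intro continuous_intros) (auto simp: complex_eq_iff complex_nonpos_Reals_iff)
qed (simp add: tricomi_kernel_def)

lemma norm_tricomi_kernel:
  "norm (tricomi_kernel a b x t) =
     indicator {0<..} t * (exp (- x * t) * t powr (Re a - 1) * (1 + t) powr (Re b - Re a - 1))"
  by (cases "t > 0") (simp_all add: tricomi_kernel_def norm_mult norm_powr_real_powr del: of_real_add)

lemma tricomi_kernel_shift: "tricomi_kernel (a + 1) (b + 1) x t = of_real t * tricomi_kernel a b x t"
proof (cases "t > 0")
  case True
  have "complex_of_real t powr a = of_real t powr (a - 1) * of_real t"
    using True by (simp add: powr_diff)
  then show ?thesis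
    using True by (simp add: tricomi_kernel_def)
qed (simp add: tricomi_kernel_def)

lemma integrable_powr_exp:
  fixes \<alpha> \<delta> :: real
  assumes "\<alpha> > 0" "\<delta> > 0"
  shows "integrable lborel (\<lambda>t. indicator {0<..} t * (t powr (\<alpha> - 1) * exp (- \<delta> * t)))"
proof -
  have "set_integrable lborel {0<..} (\<lambda>t. complex_of_real t powr (of_real \<alpha> - 1) / of_real (exp (\<delta> * t)))"
    using absolutely_integrable_Gamma_integral[of "of_real \<alpha>" \<delta>] assms
    unfolding set_integrable_def by (subst (asm) integrable_completion)
      (auto intro!: borel_measurable_continuous_on_indicator continuous_intros)
  then have "integrable lborel (\<lambda>t. norm (indicator {0<..} t *\<^sub>R
      (complex_of_real t powr (of_real \<alpha> - 1) / of_real (exp (\<delta> * t)))))"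
    unfolding set_integrable_def by (rule integrable_norm)
  moreover have "norm (indicator {0<..} t *\<^sub>R (complex_of_real t powr (of_real \<alpha> - 1) / of_real (exp (\<delta> * t))))
      = indicator {0<..} t * (t powr (\<alpha> - 1) * exp (- \<delta> * t))" for t
    by (cases "t > 0") (simp_all add: norm_mult norm_inverse norm_powr_real_powr exp_minus divide_inverse)
  ultimately show ?thesis
    by (simp only:)
qed

lemma powr_le_exp:
  fixes \<beta> \<delta> :: real
  assumes "\<delta> > 0"
  obtains C where "\<And>t. t \<ge> 0 \<Longrightarrow> (1 + t) powr \<beta> \<le> C * exp (\<delta> * t)"
proof
  define \<epsilon> where "\<epsilon> = \<delta> / (\<bar>\<beta>\<bar> + 1)"
  have \<epsilon>: "\<epsilon> > 0" "\<bar>\<beta>\<bar> * \<epsilon> \<le> \<delta>"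
    using assms by (auto simp: \<epsilon>_def field_simps)
  fix t :: real assume t: "t \<ge> 0"
  have "ln (1 + t) = ln (\<epsilon> * (1 + t)) - ln \<epsilon>"
    using \<epsilon> t by (simp add: ln_mult)
  also have "\<dots> \<le> \<epsilon> * (1 + t) - 1 - ln \<epsilon>"
    using ln_le_minus_one[of "\<epsilon> * (1 + t)"] \<epsilon> t by simp
  finally have "\<bar>\<beta>\<bar> * ln (1 + t) \<le> \<bar>\<beta>\<bar> * (\<epsilon> * (1 + t) - 1 - ln \<epsilon>)"
    by (rule mult_left_mono) simp
  also have "\<dots> = \<bar>\<beta>\<bar> * \<epsilon> * t + \<bar>\<beta>\<bar> * (\<epsilon> - 1 - ln \<epsilon>)"
    by (simp add: algebra_simps)
  also have "\<dots> \<le> \<delta> * t + \<bar>\<beta>\<bar> * (\<epsilon> - 1 - ln \<epsilon>)"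
    using \<epsilon>(2) t by (intro add_right_mono mult_right_mono)
  finally have "(1 + t) powr \<bar>\<beta>\<bar> \<le> exp (\<bar>\<beta>\<bar> * (\<epsilon> - 1 - ln \<epsilon>)) * exp (\<delta> * t)"
    using t by (simp add: powr_def flip: exp_add)
  moreover have "(1 + t) powr \<beta> \<le> (1 + t) powr \<bar>\<beta>\<bar>"
    using t by (intro powr_mono) auto
  ultimately show "(1 + t) powr \<beta> \<le> exp (\<bar>\<beta>\<bar> * (\<epsilon> - 1 - ln \<epsilon>)) * exp (\<delta> * t)"
    by linarith
qed

lemma integrable_tricomi_kernel:
  assumes "Re a > 0" "x > 0"
  shows "integrable lborel (tricomi_kernel a b x)"
proof -
  obtain C where C: "\<And>t. t \<ge> 0 \<Longrightarrow> (1 + t) powr (Re b - Re a - 1) \<le> C * exp (x / 2 * t)"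
    using powr_le_exp[of "x / 2"] assms(2) by auto
  show ?thesis
  proof (rule Bochner_Integration.integrable_bound)
    show "integrable lborel (\<lambda>t. C * (indicator {0<..} t * (t powr (Re a - 1) * exp (- (x / 2) * t))))"
      using assms by (intro integrable_mult_right integrable_powr_exp) auto
    show "AE t in lborel. norm (tricomi_kernel a b x t)
        \<le> norm (C * (indicator {0<..} t * (t powr (Re a - 1) * exp (- (x / 2) * t))))"
    proof (intro AE_I2)
      fix t :: real
      show "norm (tricomi_kernel a b x t)
          \<le> norm (C * (indicator {0<..} t * (t powr (Re a - 1) * exp (- (x / 2) * t))))"
      proof (cases "t > 0")
        case True
        then have "norm (tricomi_kernel a b x t) \<le> exp (- x * t) * t powr (Re a - 1) * (C * exp (x / 2 * t))"
          using C[of t] by (simp add: norm_tricomi_kernel)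
        also have "\<dots> = C * (t powr (Re a - 1) * exp (- (x / 2) * t))"
          by (simp add: mult_ac flip: exp_add)
        finally show ?thesis
          using True by (simp add: abs_le_iff)
      qed (simp add: norm_tricomi_kernel)
    qed
  qed simp
qed

lemma norm_tricomi_kernel_mono:
  assumes "y \<le> x"
  shows "norm (tricomi_kernel a b x t) \<le> norm (tricomi_kernel a b y t)"
  using assms by (cases "t > 0") (auto simp: norm_tricomi_kernel intro!: mult_right_mono)

lemma has_vector_derivative_of_real_exp:
  "((\<lambda>x. of_real (exp (u * x)) :: complex) has_vector_derivative of_real (u * exp (u * x))) (at x)"
  by (rule has_vector_derivative_of_real) (auto intro!: derivative_eq_intros)

lemma tricomi_laplace_has_vector_derivative:
  assumes a: "Re a > 0" and x: "x > 0"
  shows "(tricomi_laplace a b has_vector_derivative - tricomi_laplace (a + 1) (b + 1) x) (at x)"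
proof -
  have "((\<lambda>x. \<integral>t. tricomi_kernel a b x t \<partial>lborel) has_derivative
      (\<lambda>h. \<integral>t. h *\<^sub>R (- tricomi_kernel (a + 1) (b + 1) x t) \<partial>lborel)) (at x)"
  proof (rule has_derivative_integral_dominated[where r = "x / 2"
        and g = "\<lambda>t. norm (tricomi_kernel (a + 1) (b + 1) (x / 2) t)"])
    fix y t h :: real assume "y \<in> ball x (x / 2)"
    then have y: "y \<ge> x / 2"
      using abs_ge_self[of "x - y"] by (simp add: dist_real_def)
    have "((\<lambda>x. tricomi_kernel a b x t) has_vector_derivative - tricomi_kernel (a + 1) (b + 1) y t) (at y)"
    proof -
      define k where "k = indicator {0<..} t *\<^sub>R (complex_of_real t powr (a - 1) * of_real (1 + t) powr (b - a - 1))"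
      have k: "tricomi_kernel a b x t = of_real (exp (- t * x)) * k" for x
        by (simp add: k_def tricomi_kernel_def mult_ac)
      show ?thesis
        unfolding tricomi_kernel_shift k
        by (rule has_vector_derivative_eq_rhs[OF
              has_vector_derivative_mult_left[OF has_vector_derivative_of_real_exp]]) simp
    qed
    then show "((\<lambda>x. tricomi_kernel a b x t) has_derivative
        (\<lambda>h. h *\<^sub>R (- tricomi_kernel (a + 1) (b + 1) y t))) (at y)"
      by (simp add: has_vector_derivative_def)
    show "norm (h *\<^sub>R (- tricomi_kernel (a + 1) (b + 1) y t))
        \<le> norm (tricomi_kernel (a + 1) (b + 1) (x / 2) t) * norm h"
      using norm_tricomi_kernel_mono[OF y] by (simp add: mult.commute mult_left_mono)
    show "integrable lborel (tricomi_kernel a b y)"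
      using integrable_tricomi_kernel[OF a] x y by simp
  qed (use x a in \<open>auto intro!: integrable_norm integrable_tricomi_kernel\<close>)
  then show ?thesis
    by (simp add: has_vector_derivative_def tricomi_laplace_def[abs_def])
qed

lemma integral_derivative_Ioi_eq_0:
  fixes F :: "real \<Rightarrow> 'a::euclidean_space"
  assumes der: "\<And>t. t > 0 \<Longrightarrow> (F has_vector_derivative f t) (at t)"
    and cont: "continuous_on {0<..} f" and int: "set_integrable lborel {0<..} f"
    and lim: "(F \<longlongrightarrow> 0) (at_right 0)" "(F \<longlongrightarrow> 0) at_top"
  shows "(LINT t:{0<..}|lborel. f t) = 0"
proof -
  have Ioi: "einterval 0 \<infinity> = {0<..}"
    by (auto simp: einterval_def)
  have "(LBINT t=0..\<infinity>. f t) = 0 - 0"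
  proof (rule interval_integral_FTC_integrable)
    show "isCont f t" if "0 < ereal t" for t
      using cont that by (simp add: continuous_on_eq_continuous_at)
  qed (use der int lim in \<open>simp_all add: Ioi ereal_tendsto_simps zero_ereal_def\<close>)
  then show ?thesis
    by (simp add: interval_lebesgue_integral_def Ioi)
qed

lemma tricomi_primitive_has_vector_derivative:
  fixes a b :: complex
  assumes t: "t > 0"
  shows "((\<lambda>t. of_real (exp (- x * t)) * of_real t powr a * of_real (1 + t) powr (b - a)) has_vector_derivative
    a * tricomi_kernel a b x t + (b - of_real x) * tricomi_kernel (a + 1) (b + 1) x t
      - of_real x * tricomi_kernel (a + 2) (b + 2) x t) (at t)"
proof -
  define E P Q where "E = complex_of_real (exp (- x * t))" and "P = complex_of_real t powr (a - 1)"
    and "Q = complex_of_real (1 + t) powr (b - a - 1)"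
  have kernel: "tricomi_kernel a b x t = E * P * Q"
    using t by (simp add: tricomi_kernel_def E_def P_def Q_def)
  have kernel_shift: "tricomi_kernel (a + 1) (b + 1) x t = of_real t * (E * P * Q)"
    "tricomi_kernel (a + 2) (b + 2) x t = of_real t * (of_real t * (E * P * Q))"
    using tricomi_kernel_shift[of a b x t] tricomi_kernel_shift[of "a + 1" "b + 1" x t]
    by (simp_all add: kernel add.assoc)
  have powr: "complex_of_real t powr a = of_real t * P" "complex_of_real (1 + t) powr (b - a) = of_real (1 + t) * Q"
    using t by (simp_all add: P_def Q_def powr_diff del: of_real_add)
  have "((\<lambda>z. (1 + z) powr (b - a)) has_field_derivative (b - a) * Q) (at (of_real t))"
    using t by (auto intro!: derivative_eq_intros simp: complex_nonpos_Reals_iff Q_def)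
  from has_vector_derivative_real_field[OF this]
  have "((\<lambda>t. of_real (1 + t) powr (b - a)) has_vector_derivative (b - a) * Q) (at t)"
    by simp
  from has_vector_derivative_mult[OF has_vector_derivative_mult[OF has_vector_derivative_of_real_exp
        has_vector_derivative_powr_of_real[OF t, of a]] this, of "- x"]
  show ?thesis
    unfolding kernel kernel_shift powr E_def[symmetric] P_def[symmetric]
    by (rule has_vector_derivative_eq_rhs) (simp add: E_def algebra_simps)
qed

lemma tricomi_primitive_tendsto_0:
  fixes a b :: complex
  assumes "Re a > 0" "x > 0"
  defines "F \<equiv> \<lambda>t. complex_of_real (exp (- x * t)) * of_real t powr a * of_real (1 + t) powr (b - a)"
  shows "(F \<longlongrightarrow> 0) (at_right 0)" "(F \<longlongrightarrow> 0) at_top"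
proof -
  define \<alpha> \<beta> where "\<alpha> = Re a" and "\<beta> = Re (b - a)"
  have \<alpha>: "\<alpha> > 0"
    using assms(1) by (simp add: \<alpha>_def)
  have norm_F: "norm (F t) = exp (- x * t) * t powr \<alpha> * (1 + t) powr \<beta>" if "t > 0" for t
    using that by (simp add: F_def \<alpha>_def \<beta>_def norm_mult norm_powr_real_powr del: of_real_add)
  have ev: "\<forall>\<^sub>F t in at_right 0. norm (F t) = exp (- x * t) * t powr \<alpha> * (1 + t) powr \<beta>"
    using eventually_at_right_less[of 0] by eventually_elim (rule norm_F)
  have ev': "\<forall>\<^sub>F t in at_top. norm (F t) = exp (- x * t) * t powr \<alpha> * (1 + t) powr \<beta>"
    using eventually_gt_at_top[of 0] by eventually_elim (rule norm_F)
  have "((\<lambda>t. exp (- x * t) * t powr \<alpha> * (1 + t) powr \<beta>) \<longlongrightarrow> 0) (at_right 0)"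
    using \<alpha> by real_asymp
  then show "(F \<longlongrightarrow> 0) (at_right 0)"
    using tendsto_cong[OF ev] tendsto_norm_zero_iff by blast
  have "((\<lambda>t. exp (- x * t) * t powr \<alpha> * (1 + t) powr \<beta>) \<longlongrightarrow> 0) at_top"
    using \<open>x > 0\<close> by real_asymp
  then show "(F \<longlongrightarrow> 0) at_top"
    using tendsto_cong[OF ev'] tendsto_norm_zero_iff by blast
qed

text \<open>This is Kummer's equation \<open>x w'' + (b - x) w' - a w = 0\<close> for \<open>w = tricomi_laplace a b\<close>.\<close>

lemma tricomi_laplace_kummer:
  assumes a: "Re a > 0" and x: "x > 0"
  shows "of_real x * tricomi_laplace (a + 2) (b + 2) x
    = (b - of_real x) * tricomi_laplace (a + 1) (b + 1) x + a * tricomi_laplace a b x"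
proof -
  let ?k = "\<lambda>n t. tricomi_kernel (a + n) (b + n) x t"
  define f where "f t = a * ?k 0 t + (b - of_real x) * ?k 1 t - of_real x * ?k 2 t" for t
  have int: "integrable lborel (?k 0)" "integrable lborel (?k 1)" "integrable lborel (?k 2)"
    using a x by (auto intro!: integrable_tricomi_kernel)
  have f_indicator: "indicator {0<..} t *\<^sub>R f t = f t" for t
    by (cases "t > 0") (simp_all add: f_def tricomi_kernel_def)
  have "(LINT t:{0<..}|lborel. f t) = 0"
  proof (rule integral_derivative_Ioi_eq_0)
    show "((\<lambda>t. of_real (exp (- x * t)) * of_real t powr a * of_real (1 + t) powr (b - a))
        has_vector_derivative f t) (at t)"
      if "t > 0" for t
      using tricomi_primitive_has_vector_derivative[OF that] by (simp add: f_def)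
    show "continuous_on {0<..} f"
      unfolding f_def by (intro continuous_intros tricomi_kernel_continuous)
    show "set_integrable lborel {0<..} f"
      unfolding set_integrable_def f_indicator using int by (simp add: f_def)
  qed (use tricomi_primitive_tendsto_0[OF a x] in auto)
  then have "(\<integral>t. f t \<partial>lborel) = 0"
    by (simp add: set_lebesgue_integral_def f_indicator)
  then show ?thesis
    using int by (simp add: f_def tricomi_laplace_def algebra_simps)
qed

lemma norm_tricomi_kernel_le_strip:
  assumes "l \<le> Re a" "Re a \<le> u" "Re b - Re a - 1 \<le> N"
  shows "norm (tricomi_kernel a b x t) \<le> norm (tricomi_kernel (of_real l) (of_real (N + l + 1)) x t)
    + norm (tricomi_kernel (of_real u) (of_real (N + u + 1)) x t)"
proof (cases "t > 0")
  case True
  have "t powr (Re a - 1) \<le> t powr (l - 1) + t powr (u - 1)"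
  proof (cases "t \<le> 1")
    case True
    with \<open>t > 0\<close> have "t powr (Re a - 1) \<le> t powr (l - 1)"
      using assms by (intro powr_mono') auto
    then show ?thesis
      by (simp add: add_increasing2)
  next
    case False
    then have "t powr (Re a - 1) \<le> t powr (u - 1)"
      using assms by (intro powr_mono) auto
    then show ?thesis
      by (simp add: add_increasing)
  qed
  moreover have "(1 + t) powr (Re b - Re a - 1) \<le> (1 + t) powr N"
    using assms True by (intro powr_mono) auto
  ultimately have "norm (tricomi_kernel a b x t)
      \<le> exp (- x * t) * (t powr (l - 1) + t powr (u - 1)) * (1 + t) powr N"
    using True unfolding norm_tricomi_kernel by (auto intro!: mult_mono)
  then show ?thesis
    using True by (simp add: norm_tricomi_kernel algebra_simps)
qed (simp add: norm_tricomi_kernel)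

lemma tricomi_laplace_holomorphic:
  assumes U: "open U" and \<alpha>: "\<alpha> holomorphic_on U" and \<beta>: "\<beta> holomorphic_on U"
    and pos: "\<And>s. s \<in> U \<Longrightarrow> Re (\<alpha> s) > 0" and x: "x > 0"
  shows "(\<lambda>s. tricomi_laplace (\<alpha> s) (\<beta> s) x) holomorphic_on U"
  unfolding holomorphic_on_def
proof
  fix s0 assume s0: "s0 \<in> U"
  define l u N where "l = Re (\<alpha> s0) / 2" and "u = Re (\<alpha> s0) + 1" and "N = Re (\<beta> s0) - Re (\<alpha> s0)"
  have l: "l > 0" "u > 0"
    using pos[OF s0] by (auto simp: l_def u_def)
  define V where "V = (U \<inter> (\<lambda>s. Re (\<alpha> s)) -` {l<..<u}) \<inter> (U \<inter> (\<lambda>s. Re (\<beta> s) - Re (\<alpha> s)) -` {..<N + 1})"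
  have "open V"
    unfolding V_def using U holomorphic_on_imp_continuous_on[OF \<alpha>] holomorphic_on_imp_continuous_on[OF \<beta>]
    by (intro open_Int continuous_open_preimage continuous_intros) auto
  have "s0 \<in> V"
    using s0 pos[OF s0] by (simp add: V_def l_def u_def N_def)
  have "(\<lambda>s. \<integral>t. tricomi_kernel (\<alpha> s) (\<beta> s) x t \<partial>lborel) holomorphic_on V"
  proof (rule holomorphic_on_integral_dominated[OF \<open>open V\<close>])
    show "(\<lambda>s. tricomi_kernel (\<alpha> s) (\<beta> s) x t) holomorphic_on V" for t
    proof (cases "t > 0")
      case True
      have "\<alpha> holomorphic_on V" "\<beta> holomorphic_on V"
        using \<alpha> \<beta> by (auto intro: holomorphic_on_subset simp: V_def)
      then show ?thesis
        using True unfolding tricomi_kernel_def by (auto intro!: holomorphic_intros simp: complex_eq_iff)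
    qed (simp add: tricomi_kernel_def)
    show "integrable lborel (\<lambda>t. norm (tricomi_kernel (of_real l) (of_real (N + l + 1)) x t)
        + norm (tricomi_kernel (of_real u) (of_real (N + u + 1)) x t))"
      using l x by (intro Bochner_Integration.integrable_add integrable_norm integrable_tricomi_kernel) auto
  qed (auto simp: V_def simp del: of_real_add intro!: norm_tricomi_kernel_le_strip)
  then have "(\<lambda>s. tricomi_laplace (\<alpha> s) (\<beta> s) x) field_differentiable (at s0)"
    unfolding tricomi_laplace_def using \<open>open V\<close> \<open>s0 \<in> V\<close> by (intro holomorphic_on_imp_differentiable_at)
  then show "(\<lambda>s. tricomi_laplace (\<alpha> s) (\<beta> s) x) field_differentiable (at s0 within U)"
    by (rule field_differentiable_at_within)
qed

lemma tricomi_laplace_Gamma: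
  assumes a: "Re a > 0"
  shows "tricomi_laplace a (a + 1) 1 = Gamma a"
proof -
  let ?f = "\<lambda>t. of_real t powr (a - 1) / complex_of_real (exp t)"
  have kernel: "tricomi_kernel a (a + 1) 1 = (\<lambda>t. indicator {0<..} t *\<^sub>R ?f t)"
  proof
    fix t :: real
    have "1 + complex_of_real t \<noteq> 0" if "t > 0"
      using that by (auto simp: complex_eq_iff)
    then show "tricomi_kernel a (a + 1) 1 t = indicator {0<..} t *\<^sub>R ?f t"
      by (cases "t > 0") (simp_all add: tricomi_kernel_def exp_minus field_simps)
  qed
  have "set_integrable lborel {0<..} ?f"
    using integrable_tricomi_kernel[OF a, of 1 "a + 1"] by (simp add: set_integrable_def kernel)
  from set_borel_integral_eq_integral(2)[OF this]
  have "tricomi_laplace a (a + 1) 1 = integral {0<..} ?f"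
    by (simp add: tricomi_laplace_def kernel set_lebesgue_integral_def)
  also have "\<dots> = Gamma a"
    using a by (intro integral_unique Gamma_integral_complex')
  finally show ?thesis .
qed

definition tricomi_kernel_rescaled :: "complex \<Rightarrow> complex \<Rightarrow> real \<Rightarrow> real \<Rightarrow> complex" where
  "tricomi_kernel_rescaled a b x u = of_real x powr (a - 1) * tricomi_kernel a b x (u / x)"

lemma tricomi_kernel_rescaled_measurable [measurable]: "tricomi_kernel_rescaled a b x \<in> borel_measurable borel"
  unfolding tricomi_kernel_rescaled_def[abs_def] by measurable

lemma tricomi_kernel_rescaled_eq:
  assumes "x > 0"
  shows "tricomi_kernel_rescaled a b x u = indicator {0<..} u *\<^sub>R
    (of_real (exp (- u)) * of_real u powr (a - 1) * of_real (1 + u / x) powr (b - a - 1))"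
proof (cases "u > 0")
  case True
  have "complex_of_real u = of_real x * of_real (u / x)"
    using assms by simp
  then have "complex_of_real u powr (a - 1) = of_real x powr (a - 1) * of_real (u / x) powr (a - 1)"
    using assms True by (simp add: powr_times_real del: of_real_divide)
  then show ?thesis
    using assms True
    by (simp add: tricomi_kernel_rescaled_def tricomi_kernel_def mult_ac del: of_real_divide of_real_add)
qed (use assms in \<open>simp add: tricomi_kernel_rescaled_def tricomi_kernel_def divide_simps\<close>)

lemma integral_tricomi_kernel_rescaled:
  assumes "x > 0"
  shows "(\<integral>u. tricomi_kernel_rescaled a b x u \<partial>lborel) = of_real x powr a * tricomi_laplace a b x"
proof -
  have "tricomi_laplace a b x = \<bar>1 / x\<bar> *\<^sub>R (\<integral>u. tricomi_kernel a b x (0 + 1 / x * u) \<partial>lborel)"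
    unfolding tricomi_laplace_def using assms by (intro lborel_integral_real_affine) simp
  then show ?thesis
    using assms by (simp add: tricomi_kernel_rescaled_def powr_diff scaleR_conv_of_real)
qed

lemma norm_tricomi_kernel_rescaled_le:
  assumes "x \<ge> 1"
  shows "norm (tricomi_kernel_rescaled a b x u) \<le> norm (tricomi_kernel a (a + 1 + of_real \<bar>Re b - Re a - 1\<bar>) 1 u)"
proof (cases "u > 0")
  case True
  let ?N = "\<bar>Re b - Re a - 1\<bar>"
  have u: "1 \<le> 1 + u / x" "1 + u / x \<le> 1 + u"
    using True assms by (auto simp: field_simps)
  have "(1 + u / x) powr (Re b - Re a - 1) \<le> (1 + u / x) powr ?N"
    using u by (intro powr_mono) auto
  also have "\<dots> \<le> (1 + u) powr ?N"
    using u by (intro powr_mono2) auto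
  finally show ?thesis
    using True assms u
    by (simp add: tricomi_kernel_rescaled_eq norm_tricomi_kernel norm_mult norm_powr_real_powr
        mult_left_mono del: of_real_add of_real_divide)
qed (use assms in \<open>simp add: tricomi_kernel_rescaled_eq\<close>)

lemma tricomi_kernel_rescaled_tendsto:
  "((\<lambda>x. tricomi_kernel_rescaled a b x u) \<longlongrightarrow> tricomi_kernel a (a + 1) 1 u) at_top"
proof (rule Lim_transform_eventually)
  define k where "k y = indicator {0<..} u *\<^sub>R
    (of_real (exp (- u)) * of_real u powr (a - 1) * complex_of_real y powr (b - a - 1))" for y
  have lim: "((\<lambda>x. 1 + u / x) \<longlongrightarrow> 1 + 0) at_top"
    by (intro tendsto_add tendsto_const tendsto_divide_0[OF tendsto_const]
        filterlim_at_top_imp_at_infinity filterlim_ident)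
  have "((\<lambda>x. k (1 + u / x)) \<longlongrightarrow> k (1 + 0)) at_top"
    unfolding k_def
    by (intro tendsto_scaleR tendsto_mult tendsto_const tendsto_powr_complex tendsto_of_real lim) simp
  moreover have "1 + complex_of_real u \<noteq> 0" if "u > 0"
    using that by (auto simp: complex_eq_iff)
  ultimately show "((\<lambda>x. k (1 + u / x)) \<longlongrightarrow> tricomi_kernel a (a + 1) 1 u) at_top"
    by (cases "u > 0") (simp_all add: k_def tricomi_kernel_def)
  show "\<forall>\<^sub>F x in at_top. k (1 + u / x) = tricomi_kernel_rescaled a b x u"
    using eventually_gt_at_top[of 0] by eventually_elim (simp add: k_def tricomi_kernel_rescaled_eq)
qed

lemma tricomi_laplace_asymptotic:
  assumes a: "Re a > 0"
  shows "((\<lambda>x. of_real x powr a * tricomi_laplace a b x) \<longlongrightarrow> Gamma a) at_top"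
proof (rule Lim_transform_eventually)
  have "((\<lambda>x. \<integral>u. tricomi_kernel_rescaled a b x u \<partial>lborel) \<longlongrightarrow> (\<integral>u. tricomi_kernel a (a + 1) 1 u \<partial>lborel)) at_top"
  proof (rule integral_dominated_convergence_at_top)
    show "integrable lborel (\<lambda>u. norm (tricomi_kernel a (a + 1 + of_real \<bar>Re b - Re a - 1\<bar>) 1 u))"
      using a by (intro integrable_norm integrable_tricomi_kernel) auto
    show "\<forall>\<^sub>F x in at_top. AE u in lborel. norm (tricomi_kernel_rescaled a b x u)
        \<le> norm (tricomi_kernel a (a + 1 + of_real \<bar>Re b - Re a - 1\<bar>) 1 u)"
      using eventually_ge_at_top[of 1] by eventually_elim (simp add: norm_tricomi_kernel_rescaled_le)
  qed (simp_all add: tricomi_kernel_rescaled_tendsto)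
  then show "((\<lambda>x. \<integral>u. tricomi_kernel_rescaled a b x u \<partial>lborel) \<longlongrightarrow> Gamma a) at_top"
    by (simp add: tricomi_laplace_Gamma[OF a] flip: tricomi_laplace_def)
  show "\<forall>\<^sub>F x in at_top. (\<integral>u. tricomi_kernel_rescaled a b x u \<partial>lborel) = of_real x powr a * tricomi_laplace a b x"
    using eventually_gt_at_top[of 0] by eventually_elim (rule integral_tricomi_kernel_rescaled)
qed

section \<open>Whittaker functions\<close>

definition whittaker_fun :: "complex \<Rightarrow> real \<Rightarrow> complex \<Rightarrow> real \<Rightarrow> complex" where
  "whittaker_fun \<kappa> \<theta> s t =
     of_real t powr s * of_real (exp (- \<theta> * t)) * tricomi_laplace (s - \<kappa>) (2 * s) (2 * \<theta> * t)"

definition whittaker_coeff :: "complex \<Rightarrow> real \<Rightarrow> complex \<Rightarrow> real \<Rightarrow> complex" where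
  "whittaker_coeff \<kappa> \<theta> s t = (of_real \<theta>)\<^sup>2 - 2 * of_real \<theta> * \<kappa> / of_real t + s * (s - 1) / (of_real t)\<^sup>2"

lemma powr_exp_has_vector_derivative:
  fixes s :: complex
  assumes "t > 0"
  shows "((\<lambda>t. of_real t powr s * of_real (exp (- \<theta> * t))) has_vector_derivative
    of_real t powr s * of_real (exp (- \<theta> * t)) * (s / of_real t - of_real \<theta>)) (at t)"
  by (rule has_vector_derivative_eq_rhs[OF has_vector_derivative_mult[OF
        has_vector_derivative_powr_of_real[OF assms] has_vector_derivative_of_real_exp]])
    (use assms in \<open>simp add: powr_diff algebra_simps\<close>)

lemma tricomi_laplace_scaled_has_vector_derivative:
  assumes "Re a > 0" "\<theta> > 0" "t > 0"
  shows "((\<lambda>t. tricomi_laplace a b (2 * \<theta> * t)) has_vector_derivative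
    - (2 * of_real \<theta>) * tricomi_laplace (a + 1) (b + 1) (2 * \<theta> * t)) (at t)"
proof -
  have "((\<lambda>t. 2 * \<theta> * t) has_vector_derivative 2 * \<theta>) (at t)"
    by (auto intro!: derivative_eq_intros)
  from vector_diff_chain_at[OF this, of "tricomi_laplace a b", OF tricomi_laplace_has_vector_derivative]
  show ?thesis
    using assms by (simp add: o_def scaleR_conv_of_real)
qed

lemma whittaker_kummer_identity:
  fixes \<kappa> s w z P :: complex
  assumes z: "z \<noteq> 0" and kummer: "2 * w * z * J2 = (2 * s - 2 * w * z) * J1 + (s - \<kappa>) * J0"
  shows "P * ((s / z - w) * (- (2 * w) * J1) + - s / z\<^sup>2 * J0 - 2 * w * (- (2 * w) * J2))
      + P * (s / z - w) * ((s / z - w) * J0 - 2 * w * J1)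
    = (w\<^sup>2 - 2 * w * \<kappa> / z + s * (s - 1) / z\<^sup>2) * (P * J0)"
proof -
  have "4 * w\<^sup>2 * J2 = 2 * w / z * (2 * w * z * J2)"
    using z by (simp add: power2_eq_square)
  also have "\<dots> = 2 * w / z * ((2 * s - 2 * w * z) * J1 + (s - \<kappa>) * J0)"
    unfolding kummer ..
  finally have J2: "4 * w\<^sup>2 * J2 = \<dots>" .
  have "P * ((s / z - w) * (- (2 * w) * J1) + - s / z\<^sup>2 * J0 - 2 * w * (- (2 * w) * J2))
      + P * (s / z - w) * ((s / z - w) * J0 - 2 * w * J1)
    = P * (((s / z - w)\<^sup>2 - s / z\<^sup>2) * J0 - 4 * w * (s / z - w) * J1 + 4 * w\<^sup>2 * J2)"
    by (simp add: algebra_simps power2_eq_square)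
  also have "\<dots> = P * ((w\<^sup>2 - 2 * w * \<kappa> / z + s * (s - 1) / z\<^sup>2) * J0)"
    unfolding J2 using z by (simp add: divide_simps) (simp add: algebra_simps power2_eq_square)
  finally show ?thesis
    by (simp only: mult.left_commute)
qed

lemma whittaker_fun_ode_solution:
  assumes a: "Re (s - \<kappa>) > 0" and \<theta>: "\<theta> > 0"
  shows "ode_solution (whittaker_coeff \<kappa> \<theta> s) (whittaker_fun \<kappa> \<theta> s)"
proof -
  define P where "P = (\<lambda>t. of_real t powr s * complex_of_real (exp (- \<theta> * t)))"
  define J where "J n = (\<lambda>t. tricomi_laplace (s - \<kappa> + n) (2 * s + n) (2 * \<theta> * t))" for n
  define w where "w = complex_of_real \<theta>"
  have P': "(P has_vector_derivative P t * (s / of_real t - w)) (at t)" if "t > 0" for t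
    using powr_exp_has_vector_derivative[OF that, of s \<theta>] by (simp add: P_def w_def)
  have J': "(J n has_vector_derivative - (2 * w) * J (n + 1) t) (at t)" if "t > 0" "Re n \<ge> 0" for n t
    using tricomi_laplace_scaled_has_vector_derivative[of "s - \<kappa> + n" \<theta> t "2 * s + n"] a \<theta> that
    by (simp add: J_def w_def add.assoc)
  show ?thesis
  proof (rule ode_solutionI)
    fix t :: real assume t: "t > 0"
    define z where "z = complex_of_real t"
    have z: "z \<noteq> 0"
      using t by (simp add: z_def)
    have J0': "(J 0 has_vector_derivative - (2 * w) * J 1 t) (at t)"
      and J1': "(J 1 has_vector_derivative - (2 * w) * J 2 t) (at t)"
      using J'[OF t, of 0] J'[OF t, of 1] by simp_all
    show "(whittaker_fun \<kappa> \<theta> s has_vector_derivative P t * ((s / of_real t - w) * J 0 t - 2 * w * J 1 t)) (at t)"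
      using has_vector_derivative_mult[OF P'[OF t] J0']
      by (simp add: whittaker_fun_def[abs_def] P_def J_def algebra_simps)
    have "((\<lambda>v. s / v - w) has_field_derivative - s / z\<^sup>2) (at (of_real t))"
      using z by (auto intro!: derivative_eq_intros simp: z_def power2_eq_square)
    from has_vector_derivative_real_field[OF this]
    have u': "((\<lambda>t. s / of_real t - w) has_vector_derivative - s / z\<^sup>2) (at t)" .
    have "((\<lambda>t. P t * ((s / of_real t - w) * J 0 t - 2 * w * J 1 t)) has_vector_derivative
        P t * ((s / z - w) * (- (2 * w) * J 1 t) + - s / z\<^sup>2 * J 0 t - 2 * w * (- (2 * w) * J 2 t))
        + P t * (s / z - w) * ((s / z - w) * J 0 t - 2 * w * J 1 t)) (at t)"
      using u' unfolding z_def
      by (intro has_vector_derivative_mult has_vector_derivative_diff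
          has_vector_derivative_mult_right P'[OF t] J0' J1')
    moreover have "2 * w * z * J 2 t = (2 * s - 2 * w * z) * J 1 t + (s - \<kappa>) * J 0 t"
      using tricomi_laplace_kummer[OF a, of "2 * \<theta> * t" "2 * s"] \<theta> t by (simp add: J_def w_def z_def)
    note whittaker_kummer_identity[OF z this, of "P t"]
    moreover have "whittaker_coeff \<kappa> \<theta> s t = w\<^sup>2 - 2 * w * \<kappa> / z + s * (s - 1) / z\<^sup>2"
      by (simp add: whittaker_coeff_def w_def z_def)
    moreover have "whittaker_fun \<kappa> \<theta> s t = P t * J 0 t"
      by (simp add: whittaker_fun_def P_def J_def)
    ultimately show "((\<lambda>t. P t * ((s / of_real t - w) * J 0 t - 2 * w * J 1 t)) has_vector_derivative
        whittaker_coeff \<kappa> \<theta> s t * whittaker_fun \<kappa> \<theta> s t) (at t)"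
      by (simp only:)
  qed
qed

lemma whittaker_fun_asymptotic:
  assumes a: "Re (s - \<kappa>) > 0" and \<theta>: "\<theta> > 0"
  shows "((\<lambda>t. of_real (exp (\<theta> * t)) * of_real t powr (- \<kappa>) * whittaker_fun \<kappa> \<theta> s t)
    \<longlongrightarrow> of_real (2 * \<theta>) powr (\<kappa> - s) * Gamma (s - \<kappa>)) at_top"
proof (rule Lim_transform_eventually)
  have "filterlim (\<lambda>t. 2 * \<theta> * t) at_top at_top"
    using \<theta> by real_asymp
  from filterlim_compose[OF tricomi_laplace_asymptotic[OF a, of "2 * s"] this]
  show "((\<lambda>t. of_real (2 * \<theta>) powr (\<kappa> - s)
        * (of_real (2 * \<theta> * t) powr (s - \<kappa>) * tricomi_laplace (s - \<kappa>) (2 * s) (2 * \<theta> * t)))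
      \<longlongrightarrow> of_real (2 * \<theta>) powr (\<kappa> - s) * Gamma (s - \<kappa>)) at_top"
    by (rule tendsto_mult_left)
  show "\<forall>\<^sub>F t in at_top. of_real (2 * \<theta>) powr (\<kappa> - s)
        * (of_real (2 * \<theta> * t) powr (s - \<kappa>) * tricomi_laplace (s - \<kappa>) (2 * s) (2 * \<theta> * t))
      = of_real (exp (\<theta> * t)) * of_real t powr (- \<kappa>) * whittaker_fun \<kappa> \<theta> s t"
    using eventually_gt_at_top[of 0]
  proof eventually_elim
    case (elim t)
    have "complex_of_real (2 * \<theta> * t) powr (s - \<kappa>) = of_real (2 * \<theta>) powr (s - \<kappa>) * of_real t powr (s - \<kappa>)"
      unfolding of_real_mult[of "2 * \<theta>" t] using elim \<theta> by (intro powr_times_real) auto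
    moreover have "complex_of_real (2 * \<theta>) powr (\<kappa> - s) * of_real (2 * \<theta>) powr (s - \<kappa>) = 1"
      using \<theta> by (simp flip: powr_add)
    moreover have "complex_of_real t powr (- \<kappa>) * of_real t powr s = of_real t powr (s - \<kappa>)"
      by (simp flip: powr_add)
    moreover have "complex_of_real (exp (\<theta> * t)) * of_real (exp (- \<theta> * t)) = 1"
      by (simp flip: of_real_mult exp_add)
    ultimately show ?case
      unfolding whittaker_fun_def by algebra
  qed
qed

lemma eventually_whittaker_fun_nonzero:
  assumes a: "Re (s - \<kappa>) > 0" and \<theta>: "\<theta> > 0"
  shows "\<forall>\<^sub>F t in at_top. whittaker_fun \<kappa> \<theta> s t \<noteq> 0"
proof -
  have "z \<notin> \<int>\<^sub>\<le>\<^sub>0" if "Re z > 0" for z :: complex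
    using that by (auto elim!: nonpos_Ints_cases)
  then have "Gamma (s - \<kappa>) \<noteq> 0"
    using a by (simp add: Gamma_eq_zero_iff)
  then have "of_real (2 * \<theta>) powr (\<kappa> - s) * Gamma (s - \<kappa>) \<noteq> 0"
    using \<theta> by simp
  from tendsto_imp_eventually_ne[OF whittaker_fun_asymptotic[OF a \<theta>] this]
  show ?thesis
    by (rule eventually_mono) auto
qed

lemma whittaker_fun_tendsto_0:
  assumes a: "Re (s - \<kappa>) > 0" and \<theta>: "\<theta> > 0"
  shows "(whittaker_fun \<kappa> \<theta> s \<longlongrightarrow> 0) at_top"
proof (rule Lim_transform_eventually)
  have "((\<lambda>t. exp (- \<theta> * t) * t powr Re \<kappa>) \<longlongrightarrow> 0) at_top"
    using \<theta> by real_asymp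
  moreover have "\<forall>\<^sub>F t in at_top. exp (- \<theta> * t) * t powr Re \<kappa>
      = norm (of_real (exp (- \<theta> * t)) * complex_of_real t powr \<kappa>)"
    using eventually_gt_at_top[of 0] by eventually_elim (simp add: norm_mult norm_powr_real_powr)
  ultimately have "((\<lambda>t. norm (of_real (exp (- \<theta> * t)) * complex_of_real t powr \<kappa>)) \<longlongrightarrow> 0) at_top"
    by (rule Lim_transform_eventually)
  from tendsto_mult[OF tendsto_norm_zero_cancel[OF this] whittaker_fun_asymptotic[OF a \<theta>]]
  show "((\<lambda>t. of_real (exp (- \<theta> * t)) * of_real t powr \<kappa>
      * (of_real (exp (\<theta> * t)) * of_real t powr (- \<kappa>) * whittaker_fun \<kappa> \<theta> s t)) \<longlongrightarrow> 0) at_top"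
    by simp
  show "\<forall>\<^sub>F t in at_top. of_real (exp (- \<theta> * t)) * of_real t powr \<kappa>
      * (of_real (exp (\<theta> * t)) * of_real t powr (- \<kappa>) * whittaker_fun \<kappa> \<theta> s t) = whittaker_fun \<kappa> \<theta> s t"
    using eventually_gt_at_top[of 0]
  proof eventually_elim
    case (elim t)
    have "complex_of_real t powr \<kappa> * of_real t powr (- \<kappa>) = 1"
      using elim by (simp flip: powr_add)
    moreover have "complex_of_real (exp (- \<theta> * t)) * of_real (exp (\<theta> * t)) = 1"
      by (simp flip: of_real_mult exp_add)
    ultimately show ?case
      by algebra
  qed
qed

lemma whittaker_coeff_continuous: "continuous_on {0<..} (whittaker_coeff \<kappa> \<theta> s)"
  unfolding whittaker_coeff_def by (intro continuous_intros) auto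

lemma eventually_whittaker_coeff_Re_pos:
  assumes "\<theta> > 0"
  shows "\<forall>\<^sub>F t in at_top. Re (whittaker_coeff \<kappa> \<theta> s t) > 0"
proof -
  have inv: "((\<lambda>t. inverse (complex_of_real t)) \<longlongrightarrow> of_real 0) at_top"
    unfolding of_real_inverse[symmetric] by (intro tendsto_of_real tendsto_inverse_0_at_top filterlim_ident)
  have "((\<lambda>t. (of_real \<theta>)\<^sup>2 - 2 * of_real \<theta> * \<kappa> * inverse (of_real t) + s * (s - 1) * (inverse (of_real t))\<^sup>2)
      \<longlongrightarrow> (of_real \<theta>)\<^sup>2 - 2 * of_real \<theta> * \<kappa> * of_real 0 + s * (s - 1) * (of_real 0)\<^sup>2) at_top"
    by (intro tendsto_intros inv)
  then have "((\<lambda>t. Re (whittaker_coeff \<kappa> \<theta> s t)) \<longlongrightarrow> Re ((of_real \<theta>)\<^sup>2)) at_top"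
    unfolding whittaker_coeff_def by (intro tendsto_Re) (simp add: divide_inverse power_inverse)
  moreover have "Re ((complex_of_real \<theta>)\<^sup>2) > 0"
    using assms by (simp flip: of_real_power)
  ultimately show ?thesis
    by (rule order_tendstoD(1))
qed

lemma whittaker_fun_unique:
  assumes a: "Re (s - \<kappa>) > 0" and \<theta>: "\<theta> > 0"
    and sol: "ode_solution (whittaker_coeff \<kappa> \<theta> s) h" and lim: "(h \<longlongrightarrow> 0) at_top"
  obtains c where "\<And>t. t > 0 \<Longrightarrow> h t = c * whittaker_fun \<kappa> \<theta> s t"
proof -
  have "\<forall>\<^sub>F t in at_top. t > 0 \<and> whittaker_fun \<kappa> \<theta> s t \<noteq> 0 \<and> Re (whittaker_coeff \<kappa> \<theta> s t) > 0"
    by (intro eventually_conj eventually_gt_at_top eventually_whittaker_fun_nonzero[OF a \<theta>]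
        eventually_whittaker_coeff_Re_pos[OF \<theta>])
  then obtain t0 where t0: "t0 > 0" "whittaker_fun \<kappa> \<theta> s t0 \<noteq> 0"
    "\<And>t. t \<ge> t0 \<Longrightarrow> Re (whittaker_coeff \<kappa> \<theta> s t) \<ge> 0"
    unfolding eventually_at_top_linorder by (meson less_imp_le order_refl)
  show ?thesis
    using decaying_ode_solutions_proportional[OF sol whittaker_fun_ode_solution[OF a \<theta>]
        whittaker_coeff_continuous lim whittaker_fun_tendsto_0[OF a \<theta>] t0] that by blast
qed

lemma whittaker_fun_holomorphic:
  assumes "\<And>s. s \<in> S \<Longrightarrow> Re (s - \<kappa>) > 0" "\<theta> > 0" "t > 0"
  shows "(\<lambda>s. whittaker_fun \<kappa> \<theta> s t) holomorphic_on S"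
proof (rule holomorphic_on_subset)
  show "(\<lambda>s. whittaker_fun \<kappa> \<theta> s t) holomorphic_on {s. Re (s - \<kappa>) > 0}"
    unfolding whittaker_fun_def using assms(2,3)
    by (intro holomorphic_intros tricomi_laplace_holomorphic open_Collect_less continuous_intros) auto
qed (use assms(1) in auto)

definition tau_factor :: "complex \<Rightarrow> complex \<Rightarrow> complex" where
  "tau_factor \<kappa> s = of_real (2 * pi) powr (2 * s) * exp (- (\<i> * of_real pi * \<kappa>)) * rGamma (s + \<kappa>) * rGamma (s - \<kappa>)"

definition signed_weight :: "real \<Rightarrow> int \<Rightarrow> complex" where
  "signed_weight x p = of_real (sgn x) * of_int p / 2"

lemma tau_eq_whittaker_fun:
  assumes "\<xi> \<noteq> 0" "y > 0" "Re s > \<bar>of_int p / 2\<bar>"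
  shows "of_real y powr s * tau (s + of_int p / 2) (s - of_int p / 2) (\<xi> * y)
    = tau_factor (signed_weight \<xi> p) s * whittaker_fun (signed_weight \<xi> p) (2 * pi * \<bar>\<xi>\<bar>) s y"
proof -
  have Re_pos: "Re (s - of_int p / 2) > 0" "Re (s + of_int p / 2) > 0"
    using assms(3) by auto
  have sum: "s + of_int p / 2 + (s - of_int p / 2) = 2 * s"
    by simp
  show ?thesis
  proof (cases "\<xi> > 0")
    case True
    then have "\<xi> * y > 0"
      using assms by simp
    then show ?thesis
      using True Re_pos unfolding tau_def sum signed_weight_def tricomi_U_def tricomi_integral_eq
      by (simp add: tau_factor_def whittaker_fun_def mult_ac algebra_simps)
  next
    case False
    then have "\<xi> < 0" "\<not> \<xi> * y > 0"
      using assms by (auto simp: zero_less_mult_iff)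
    then show ?thesis
      using Re_pos assms(2) unfolding tau_def sum signed_weight_def tricomi_U_def tricomi_integral_eq
      by (simp add: tau_factor_def whittaker_fun_def abs_mult mult_ac algebra_simps)
  qed
qed

lemma tau_factor_nonzero:
  assumes "Re (s - \<kappa>) > 0" "Re (s + \<kappa>) > 0"
  shows "tau_factor \<kappa> s \<noteq> 0"
proof -
  have "rGamma z \<noteq> 0" if "Re z > 0" for z :: complex
    using that by (auto simp: rGamma_eq_zero_iff elim!: nonpos_Ints_cases)
  then show ?thesis
    using assms by (simp add: tau_factor_def)
qed

lemma tau_factor_holomorphic: "tau_factor \<kappa> holomorphic_on S"
  unfolding tau_factor_def by (auto intro!: holomorphic_intros)

section \<open>Partial derivatives on the product of upper half-planes\<close>

lemma open_upper_half_space: "open (upper_half_space :: (complex ^ 'n) set)"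
proof -
  have "upper_half_space = (\<Inter>j. {z :: complex ^ 'n. 0 < Im (z $ j)})"
    by (auto simp: upper_half_space_def)
  moreover have "open \<dots>"
    by (intro open_INT finite ballI open_Collect_less) (auto intro!: continuous_intros)
  ultimately show ?thesis
    by (simp only:)
qed

lemma Complex_vec_nth [simp]: "Complex_vec x y $ j = Complex (x $ j) (y $ j)"
  by (simp add: Complex_vec_def)

lemma Complex_vec_mem_upper_half_space [simp]: "Complex_vec x y \<in> upper_half_space \<longleftrightarrow> (\<forall>j. y $ j > 0)"
  by (simp add: upper_half_space_def)

lemma Im_vec_Complex_vec [simp]: "Im_vec (Complex_vec x y) = y"
  by (simp add: Im_vec_def vec_eq_iff)

lemma Complex_vec_add_real: "Complex_vec (x + h) y = Complex_vec x y + Complex_vec h 0"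
  by (simp add: vec_eq_iff complex_eq_iff)

lemma bounded_linear_Complex_vec_real: "bounded_linear (\<lambda>x::real ^ 'n. Complex_vec x 0)"
proof -
  have "linear (\<lambda>x::real ^ 'n. Complex_vec x 0)"
    by (rule linearI) (simp_all add: vec_eq_iff complex_eq_iff)
  then show ?thesis
    by (rule linear_conv_bounded_linear[THEN iffD1])
qed

lemmas continuous_on_Complex_vec_real [continuous_intros] =
  bounded_linear.continuous_on[OF bounded_linear_Complex_vec_real]

lemma continuous_on_Complex_vec [continuous_intros]:
  assumes "continuous_on A f"
  shows "continuous_on A (\<lambda>w. Complex_vec (f w) y)"
proof -
  have "continuous_on A (\<lambda>w. Complex_vec 0 y + Complex_vec (f w) 0)"
    by (intro continuous_intros assms)
  then show ?thesis
    by (simp flip: Complex_vec_add_real)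
qed

definition vec_upd :: "'a ^ 'n \<Rightarrow> 'n \<Rightarrow> 'a \<Rightarrow> 'a ^ 'n" where
  "vec_upd y j t = (\<chi> i. if i = j then t else y $ i)"

lemma vec_upd_nth [simp]: "vec_upd y j t $ i = (if i = j then t else y $ i)"
  by (simp add: vec_upd_def)

lemma Complex_vec_upd_add:
  "Complex_vec x (vec_upd y j t) + \<tau> *\<^sub>R axis j \<i> = Complex_vec x (vec_upd y j (t + \<tau>))"
  by (simp add: vec_eq_iff complex_eq_iff axis_def)

lemma differentiable_has_vector_derivative_line:
  assumes "f differentiable (at z)"
  shows "((\<lambda>t::real. f (z + t *\<^sub>R v)) has_vector_derivative frechet_derivative f (at z) v) (at 0)"
proof -
  have "(f has_derivative frechet_derivative f (at z)) (at (z + 0 *\<^sub>R v))"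
    using assms by (simp add: frechet_derivative_works)
  then have "((\<lambda>t::real. f (z + t *\<^sub>R v)) has_derivative (\<lambda>t. frechet_derivative f (at z) (t *\<^sub>R v))) (at 0)"
    by (rule has_derivative_compose[rotated]) (auto intro!: derivative_eq_intros)
  then show ?thesis
    by (simp add: has_vector_derivative_def linear_scale[OF linear_frechet_derivative[OF assms]])
qed

lemma
  fixes \<psi> :: "complex ^ 'n \<Rightarrow> complex"
  assumes \<psi>: "real_analytic_on \<psi> upper_half_space"
  shows partial_x_has_vector_derivative: "z \<in> upper_half_space \<Longrightarrow>
      ((\<lambda>t::real. \<psi> (z + t *\<^sub>R axis j 1)) has_vector_derivative partial_x j \<psi> z) (at 0)"
    and partial_y_has_vector_derivative: "z \<in> upper_half_space \<Longrightarrow>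
      ((\<lambda>t::real. \<psi> (z + t *\<^sub>R axis j \<i>)) has_vector_derivative partial_y j \<psi> z) (at 0)"
    and real_analytic_on_partial_x: "real_analytic_on (partial_x j \<psi>) upper_half_space"
    and real_analytic_on_partial_y: "real_analytic_on (partial_y j \<psi>) upper_half_space"
proof -
  have line: "((\<lambda>t::real. \<psi> (z + t *\<^sub>R v)) has_vector_derivative frechet_derivative \<psi> (at z) v) (at 0)"
    if "z \<in> upper_half_space" for z v
    using differentiable_has_vector_derivative_line
      eventually_nhds_x_imp_x[OF real_analytic_on_differentiable[OF \<psi> that]] .
  have px: "frechet_derivative \<psi> (at z) (axis j 1) = partial_x j \<psi> z"
    and py: "frechet_derivative \<psi> (at z) (axis j \<i>) = partial_y j \<psi> z" if "z \<in> upper_half_space" for z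
    using vector_derivative_at[OF line[OF that]] by (simp_all add: partial_x_def partial_y_def)
  show "((\<lambda>t::real. \<psi> (z + t *\<^sub>R axis j 1)) has_vector_derivative partial_x j \<psi> z) (at 0)"
    "((\<lambda>t::real. \<psi> (z + t *\<^sub>R axis j \<i>)) has_vector_derivative partial_y j \<psi> z) (at 0)"
    if "z \<in> upper_half_space"
    using line[OF that, of "axis j 1"] line[OF that, of "axis j \<i>"] by (simp_all add: px[OF that] py[OF that])
  have "axis j 1 \<in> (Basis :: (complex ^ 'n) set)" "axis j \<i> \<in> (Basis :: (complex ^ 'n) set)"
    by (auto simp: Basis_vec_def Basis_complex_def)
  then show "real_analytic_on (partial_x j \<psi>) upper_half_space" "real_analytic_on (partial_y j \<psi>) upper_half_space"
    using real_analytic_on_cong[OF real_analytic_on_frechet_derivative[OF \<psi>] open_upper_half_space order_refl] px py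
    by blast+
qed

lemma partial_y_has_vector_derivative_upd:
  fixes \<psi> :: "complex ^ 'n \<Rightarrow> complex"
  assumes \<psi>: "real_analytic_on \<psi> upper_half_space" and y: "\<And>i. i \<noteq> j \<Longrightarrow> y $ i > 0" and t: "t > 0"
  shows "((\<lambda>t. \<psi> (Complex_vec x (vec_upd y j t))) has_vector_derivative
    partial_y j \<psi> (Complex_vec x (vec_upd y j t))) (at t)"
proof -
  let ?z = "Complex_vec x (vec_upd y j t)"
  have "?z \<in> upper_half_space"
    using y t by simp
  then have "((\<lambda>\<tau>. \<psi> (?z + \<tau> *\<^sub>R axis j \<i>)) has_vector_derivative partial_y j \<psi> ?z) (at (t - t))"
    by (simp add: partial_y_has_vector_derivative[OF \<psi>])
  then have "(((\<lambda>\<tau>. \<psi> (?z + \<tau> *\<^sub>R axis j \<i>)) \<circ> (\<lambda>\<sigma>. \<sigma> - t)) has_vector_derivative 1 *\<^sub>R partial_y j \<psi> ?z) (at t)"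
    by (intro vector_diff_chain_at) (auto intro!: derivative_eq_intros)
  then show ?thesis
    by (simp add: o_def Complex_vec_upd_add)
qed

lemma Laplacian_eigen_partial_yy:
  assumes "Laplacian j p \<psi> z = s * (1 - s) * \<psi> z" "Im (z $ j) \<noteq> 0"
  defines "r \<equiv> complex_of_real (Im (z $ j))"
  shows "partial_y j (partial_y j \<psi>) z = - partial_x j (partial_x j \<psi>) z
    + \<i> * of_int p / r * partial_x j \<psi> z + s * (s - 1) / r\<^sup>2 * \<psi> z"
proof -
  have r: "r \<noteq> 0"
    using assms(2) by (simp add: r_def)
  have "r\<^sup>2 * partial_y j (partial_y j \<psi>) z
      = r\<^sup>2 * (- partial_x j (partial_x j \<psi>) z) + \<i> * of_int p * r * partial_x j \<psi> z + s * (s - 1) * \<psi> z"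
    using assms(1) by (simp add: Laplacian_def r_def algebra_simps)
  also have "\<dots> = r\<^sup>2 * (- partial_x j (partial_x j \<psi>) z
      + \<i> * of_int p / r * partial_x j \<psi> z + s * (s - 1) / r\<^sup>2 * \<psi> z)"
    using r by (simp add: field_simps power2_eq_square)
  finally show ?thesis
    using r by simp
qed

lemma partial_x_periodic:
  assumes "\<And>z. z \<in> upper_half_space \<Longrightarrow> \<psi> (z + Complex_vec l 0) = \<psi> z" and z: "z \<in> upper_half_space"
  shows "partial_x j \<psi> (z + Complex_vec l 0) = partial_x j \<psi> z"
proof -
  have "\<psi> (z + Complex_vec l 0 + t *\<^sub>R axis j 1) = \<psi> (z + t *\<^sub>R axis j 1)" for t :: real
    using assms(1)[of "z + t *\<^sub>R axis j 1"] z
    by (simp add: upper_half_space_def axis_def add.assoc add.commute add.left_commute)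
  then show ?thesis
    by (simp add: partial_x_def)
qed

section \<open>Fourier coefficients\<close>

definition fourier_char :: "real ^ 'n \<Rightarrow> real ^ 'n \<Rightarrow> complex" where
  "fourier_char \<xi> x = exp (- 2 * of_real pi * \<i> * of_real (\<xi> \<bullet> x))"

definition fourier_mean ::
    "(real ^ 'n) set \<Rightarrow> (complex ^ 'n \<Rightarrow> complex) \<Rightarrow> real ^ 'n \<Rightarrow> real ^ 'n \<Rightarrow> complex" where
  "fourier_mean L \<psi> \<xi> y =
     (LINT x:fundamental_domain L|lborel. \<psi> (Complex_vec x y) * fourier_char \<xi> x)
       / of_real (measure lborel (fundamental_domain L))"

lemma Tr_mult_eq_inner: "Tr (\<xi> * x) = \<xi> \<bullet> x"
  by (simp add: Tr_def inner_vec_def)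

lemma fourier_coeff_eq_fourier_mean: "fourier_coeff L F \<xi> y s = fourier_mean L (\<lambda>z. F z s) \<xi> y"
  by (simp add: fourier_coeff_def fourier_mean_def fourier_char_def Tr_mult_eq_inner)

lemma norm_fourier_char [simp]: "norm (fourier_char \<xi> x) = 1"
proof -
  have "fourier_char \<xi> x = exp (\<i> * of_real (- 2 * pi * (\<xi> \<bullet> x)))"
    by (simp add: fourier_char_def mult_ac)
  then show ?thesis
    by (simp only: norm_exp_i_times)
qed

lemma fourier_char_has_vector_derivative:
  "((\<lambda>\<tau>. fourier_char \<xi> (x + \<tau> *\<^sub>R v)) has_vector_derivative
    - (2 * of_real pi * \<i> * of_real (\<xi> \<bullet> v)) * fourier_char \<xi> x) (at 0)"
proof -
  have "((\<lambda>w. exp (- 2 * of_real pi * \<i> * (of_real (\<xi> \<bullet> x) + w * of_real (\<xi> \<bullet> v)))) has_field_derivative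
      - (2 * of_real pi * \<i> * of_real (\<xi> \<bullet> v)) * fourier_char \<xi> x) (at (of_real 0))"
    by (auto intro!: derivative_eq_intros simp: fourier_char_def)
  from has_vector_derivative_real_field[OF this] show ?thesis
    by (simp add: fourier_char_def inner_add_right)
qed

lemma continuous_on_fourier_char [continuous_intros]:
  "continuous_on A f \<Longrightarrow> continuous_on A (\<lambda>w. fourier_char \<xi> (f w))"
  unfolding fourier_char_def by (intro continuous_intros)

lemma fourier_char_periodic:
  assumes "\<xi> \<in> dual_lattice L" "l \<in> L"
  shows "fourier_char \<xi> (x + l) = fourier_char \<xi> x"
proof -
  obtain n where n: "\<xi> \<bullet> l = of_int n"
    using assms by (auto simp: dual_lattice_def Tr_mult_eq_inner elim: Ints_cases)
  have "fourier_char \<xi> (x + l) = fourier_char \<xi> x * exp (2 * of_real pi * of_int (- n) * \<i>)"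
    unfolding fourier_char_def by (simp add: inner_add_right n algebra_simps flip: exp_add)
  also have "exp (2 * of_real pi * of_int (- n) * \<i>) = 1"
    using exp_integer_2pi[of "of_int (- n)"] by (simp add: mult_ac)
  finally show ?thesis
    by simp
qed

lemma fourier_integrand_continuous:
  assumes "continuous_on upper_half_space \<psi>" "\<And>i. y $ i > 0"
  shows "continuous_on UNIV (\<lambda>x. \<psi> (Complex_vec x y) * fourier_char \<xi> x)"
  using assms(2) by (intro continuous_intros continuous_on_compose2[OF assms(1)]) auto

lemma fourier_mean_cong:
  assumes "\<And>x. \<psi> (Complex_vec x y) = \<phi> (Complex_vec x y)"
  shows "fourier_mean L \<psi> \<xi> y = fourier_mean L \<phi> \<xi> y"
  by (simp add: fourier_mean_def assms)

lemma fourier_mean_cmult: "fourier_mean L (\<lambda>z. c * \<psi> z) \<xi> y = c * fourier_mean L \<psi> \<xi> y"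
  by (simp add: fourier_mean_def mult.assoc)

text \<open>Here \<open>c\<close> is the symbol of \<open>\<partial>/\<partial>x\<^sub>j\<close> at the frequency \<open>\<xi>\<^sub>j = x\<close>.\<close>

lemma whittaker_coeff_sgn_abs:
  fixes x :: real and p :: int
  defines "c \<equiv> 2 * of_real pi * \<i> * complex_of_real x"
  shows "whittaker_coeff (signed_weight x p) (2 * pi * \<bar>x\<bar>) s t
    = \<i> * of_int p / of_real t * c - c * c + s * (s - 1) / (of_real t)\<^sup>2"
proof -
  have "complex_of_real \<bar>x\<bar> * of_real (sgn x) = of_real x"
    by (simp flip: of_real_mult add: abs_mult_sgn)
  then have linear: "2 * complex_of_real (2 * pi * \<bar>x\<bar>) * signed_weight x p = - (\<i> * of_int p * c)"
    by (simp add: signed_weight_def c_def algebra_simps)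
  have "(complex_of_real (2 * pi * \<bar>x\<bar>))\<^sup>2 = - (c * c)"
    by (simp add: c_def power_mult_distrib power2_eq_square[symmetric] flip: of_real_power)
  then show ?thesis
    unfolding whittaker_coeff_def linear by simp
qed

context lattice
begin

lemma fourier_integrand_integrable:
  assumes "continuous_on upper_half_space \<psi>" "\<And>i. y $ i > 0"
  shows "set_integrable lborel (fundamental_domain L) (\<lambda>x. \<psi> (Complex_vec x y) * fourier_char \<xi> x)"
  using fourier_integrand_continuous[OF assms]
  by (intro set_integrable_continuous_on_closure bounded_fundamental_domain fundamental_domain_borel)
    (auto intro: continuous_on_subset)

lemma fourier_mean_add:
  assumes "continuous_on upper_half_space \<psi>" "continuous_on upper_half_space \<phi>" "\<And>i. y $ i > 0"
  shows "fourier_mean L (\<lambda>z. \<psi> z + \<phi> z) \<xi> y = fourier_mean L \<psi> \<xi> y + fourier_mean L \<phi> \<xi> y"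
  using assms
  by (simp add: fourier_mean_def distrib_right set_integral_add fourier_integrand_integrable add_divide_distrib)

lemma norm_fourier_mean_le:
  assumes \<psi>: "continuous_on upper_half_space \<psi>" and y: "\<And>i. y $ i > 0"
    and bound: "\<And>x. norm (\<psi> (Complex_vec x y)) \<le> C"
  shows "norm (fourier_mean L \<psi> \<xi> y) \<le> C"
proof -
  let ?D = "fundamental_domain L" and ?g = "\<lambda>x. \<psi> (Complex_vec x y) * fourier_char \<xi> x"
  have fin: "emeasure lborel ?D < \<infinity>"
    using emeasure_bounded_finite[OF bounded_fundamental_domain] .
  have "norm (LINT x:?D|lborel. ?g x) \<le> (\<integral>x. norm (indicator ?D x *\<^sub>R ?g x) \<partial>lborel)"
    unfolding set_lebesgue_integral_def by (rule integral_norm_bound)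
  also have "\<dots> \<le> (\<integral>x. indicator ?D x * C \<partial>lborel)"
  proof (rule integral_mono)
    show "integrable lborel (\<lambda>x. norm (indicator ?D x *\<^sub>R ?g x))"
      using fourier_integrand_integrable[OF \<psi> y] unfolding set_integrable_def by (rule integrable_norm)
    show "norm (indicator ?D x *\<^sub>R ?g x) \<le> indicator ?D x * C" for x
      using bound[of x] by (cases "x \<in> ?D") (simp_all add: norm_mult)
  qed (use fin in \<open>auto intro!: integrable_mult_left integrable_real_indicator\<close>)
  also have "\<dots> = measure lborel ?D * C"
    by simp
  finally show ?thesis
    using measure_fundamental_domain_pos by (simp add: fourier_mean_def norm_divide divide_le_eq mult.commute)
qed

lemma fourier_mean_0_const: "fourier_mean L (\<lambda>z. c) 0 y = c"
  using measure_fundamental_domain_pos emeasure_bounded_finite[OF bounded_fundamental_domain]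
  by (simp add: fourier_mean_def fourier_char_def set_lebesgue_integral_def scaleR_conv_of_real)

lemma fourier_mean_const_eq_0:
  assumes \<xi>: "\<xi> \<in> dual_lattice L" "\<xi> \<noteq> 0"
  shows "fourier_mean L (\<lambda>z. c) \<xi> y = 0"
proof -
  define k where "k = - (2 * of_real pi * \<i> * complex_of_real (\<xi> \<bullet> \<xi>))"
  have "(LINT x:fundamental_domain L|lborel. k * fourier_char \<xi> x) = 0"
    unfolding k_def
    by (rule integral_fundamental_domain_derivative_eq_0[OF
          fourier_char_periodic[OF \<xi>(1)] fourier_char_has_vector_derivative])
      (auto intro!: continuous_intros)
  moreover have "k \<noteq> 0"
    using \<xi>(2) by (simp add: k_def)
  ultimately have "(LINT x:fundamental_domain L|lborel. fourier_char \<xi> x) = 0"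
    by (simp only: set_integral_mult_right mult_eq_0_iff simp_thms)
  then show ?thesis
    by (simp add: fourier_mean_def)
qed

lemma fourier_mean_partial_x:
  assumes \<psi>: "real_analytic_on \<psi> upper_half_space"
    and per: "\<And>z l. z \<in> upper_half_space \<Longrightarrow> l \<in> L \<Longrightarrow> \<psi> (z + Complex_vec l 0) = \<psi> z"
    and \<xi>: "\<xi> \<in> dual_lattice L" and y: "\<And>i. y $ i > 0"
  shows "fourier_mean L (partial_x j \<psi>) \<xi> y = 2 * of_real pi * \<i> * of_real (\<xi> $ j) * fourier_mean L \<psi> \<xi> y"
proof -
  let ?D = "fundamental_domain L" and ?c = "2 * of_real pi * \<i> * complex_of_real (\<xi> $ j)"
  define G where "G x = \<psi> (Complex_vec x y) * fourier_char \<xi> x" for x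
  define H where "H x = partial_x j \<psi> (Complex_vec x y) * fourier_char \<xi> x" for x
  have cont: "continuous_on upper_half_space \<psi>" "continuous_on upper_half_space (partial_x j \<psi>)"
    using \<psi> by (auto intro: real_analytic_on_continuous real_analytic_on_partial_x)
  have cont_GH: "continuous_on UNIV G" "continuous_on UNIV H"
    unfolding G_def H_def by (intro fourier_integrand_continuous cont y)+
  have "(LINT x:?D|lborel. H x - ?c * G x) = 0"
  proof (rule integral_fundamental_domain_derivative_eq_0)
    show "G (x + l) = G x" if "l \<in> L" for x l
      using per[of "Complex_vec x y" l] that y by (simp add: G_def fourier_char_periodic[OF \<xi>] Complex_vec_add_real)
    show "((\<lambda>\<tau>. G (x + \<tau> *\<^sub>R axis j 1)) has_vector_derivative H x - ?c * G x) (at 0)" for x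
    proof -
      have "Complex_vec x y \<in> upper_half_space"
        using y by simp
      from has_vector_derivative_mult[OF partial_x_has_vector_derivative[OF \<psi> this, of j]
          fourier_char_has_vector_derivative[of \<xi> x "axis j 1"]]
      have "((\<lambda>\<tau>. \<psi> (Complex_vec x y + \<tau> *\<^sub>R axis j 1) * fourier_char \<xi> (x + \<tau> *\<^sub>R axis j 1))
          has_vector_derivative H x - ?c * G x) (at 0)"
        by (simp add: G_def H_def inner_axis algebra_simps)
      moreover have "Complex_vec (x + \<tau> *\<^sub>R axis j 1) y = Complex_vec x y + \<tau> *\<^sub>R axis j 1" for \<tau>
        by (simp add: vec_eq_iff complex_eq_iff axis_def)
      ultimately show ?thesis
        by (simp add: G_def)
    qed
  qed (intro continuous_intros cont_GH)+
  also have "(LINT x:?D|lborel. H x - ?c * G x) = (LINT x:?D|lborel. H x) - ?c * (LINT x:?D|lborel. G x)"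
    unfolding G_def H_def using fourier_integrand_integrable[OF cont(1) y] fourier_integrand_integrable[OF cont(2) y]
    by (subst set_integral_diff) auto
  finally show ?thesis
    by (simp add: fourier_mean_def G_def H_def)
qed

lemma fourier_mean_has_vector_derivative:
  assumes \<psi>: "real_analytic_on \<psi> upper_half_space" and y: "\<And>i. i \<noteq> j \<Longrightarrow> y $ i > 0" and t: "t > 0"
  shows "((\<lambda>t. fourier_mean L \<psi> \<xi> (vec_upd y j t)) has_vector_derivative
    fourier_mean L (partial_y j \<psi>) \<xi> (vec_upd y j t)) (at t)"
proof -
  have cont: "continuous_on ({0<..} \<times> UNIV) (\<lambda>(t, x). \<phi> (Complex_vec x (vec_upd y j t)) * fourier_char \<xi> x)"
    if "real_analytic_on \<phi> upper_half_space" for \<phi>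
  proof -
    have "continuous_on ({0<..} \<times> UNIV) (\<lambda>p. \<phi> (Complex_vec (snd p) (vec_upd y j (fst p))))"
    proof (rule continuous_on_compose2[OF real_analytic_on_continuous[OF that]])
      have "continuous_on ({0<..} \<times> UNIV) (\<lambda>p. Complex_vec (snd p) (vec_upd y j 0) + fst p *\<^sub>R axis j \<i>)"
        by (intro continuous_intros)
      then show "continuous_on ({0<..} \<times> UNIV) (\<lambda>p. Complex_vec (snd p) (vec_upd y j (fst p)))"
        by (simp add: Complex_vec_upd_add)
    qed (use y in auto)
    then show ?thesis
      unfolding case_prod_unfold by (intro continuous_intros)
  qed
  show ?thesis
    unfolding fourier_mean_def
    by (intro has_vector_derivative_divide has_vector_derivative_set_integral[of _ "{0<..}"]
        bounded_fundamental_domain fundamental_domain_borel cont \<psi> real_analytic_on_partial_y has_vector_derivative_mult_left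
        partial_y_has_vector_derivative_upd[OF \<psi>])
      (use t y in auto)
qed

lemma fourier_mean_partial_yy:
  assumes \<psi>: "real_analytic_on \<psi> upper_half_space"
    and per: "\<And>z l. z \<in> upper_half_space \<Longrightarrow> l \<in> L \<Longrightarrow> \<psi> (z + Complex_vec l 0) = \<psi> z"
    and eigen: "\<And>z. z \<in> upper_half_space \<Longrightarrow> Laplacian j p \<psi> z = s * (1 - s) * \<psi> z"
    and \<xi>: "\<xi> \<in> dual_lattice L" and y: "\<And>i. y $ i > 0"
  shows "fourier_mean L (partial_y j (partial_y j \<psi>)) \<xi> y
    = whittaker_coeff (signed_weight (\<xi> $ j) p) (2 * pi * \<bar>\<xi> $ j\<bar>) s (y $ j) * fourier_mean L \<psi> \<xi> y"
proof -
  define r where "r = complex_of_real (y $ j)"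
  define c where "c = 2 * of_real pi * \<i> * complex_of_real (\<xi> $ j)"
  note px = real_analytic_on_partial_x[OF \<psi>]
  have cont: "continuous_on upper_half_space \<psi>" "continuous_on upper_half_space (partial_x j \<psi>)"
    "continuous_on upper_half_space (partial_x j (partial_x j \<psi>))"
    using \<psi> by (auto intro: real_analytic_on_continuous real_analytic_on_partial_x)
  have mean_x: "fourier_mean L (partial_x j \<psi>) \<xi> y = c * fourier_mean L \<psi> \<xi> y"
    unfolding c_def by (rule fourier_mean_partial_x[OF \<psi> per \<xi> y])
  have per_x: "partial_x j \<psi> (z + Complex_vec l 0) = partial_x j \<psi> z" if "z \<in> upper_half_space" "l \<in> L" for z l
    using partial_x_periodic[of \<psi> l z j] per that by blast
  have mean_xx: "fourier_mean L (partial_x j (partial_x j \<psi>)) \<xi> y = c * (c * fourier_mean L \<psi> \<xi> y)"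
    unfolding mean_x[symmetric] unfolding c_def by (rule fourier_mean_partial_x[OF px per_x \<xi> y])
  have "fourier_mean L (partial_y j (partial_y j \<psi>)) \<xi> y
      = fourier_mean L (\<lambda>z. - 1 * partial_x j (partial_x j \<psi>) z
          + (\<i> * of_int p / r * partial_x j \<psi> z + s * (s - 1) / r\<^sup>2 * \<psi> z)) \<xi> y"
  proof (rule fourier_mean_cong)
    fix x
    have "Complex_vec x y \<in> upper_half_space"
      using y by simp
    moreover have "Im (Complex_vec x y $ j) \<noteq> 0"
      using y[of j] by simp
    ultimately
    show "partial_y j (partial_y j \<psi>) (Complex_vec x y) = - 1 * partial_x j (partial_x j \<psi>) (Complex_vec x y)
        + (\<i> * of_int p / r * partial_x j \<psi> (Complex_vec x y) + s * (s - 1) / r\<^sup>2 * \<psi> (Complex_vec x y))"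
      using Laplacian_eigen_partial_yy[OF eigen, of "Complex_vec x y"] by (simp add: r_def)
  qed
  also have "\<dots> = - 1 * (c * (c * fourier_mean L \<psi> \<xi> y))
      + (\<i> * of_int p / r * (c * fourier_mean L \<psi> \<xi> y) + s * (s - 1) / r\<^sup>2 * fourier_mean L \<psi> \<xi> y)"
    by (simp only: fourier_mean_add fourier_mean_cmult cont continuous_on_mult continuous_on_add
        continuous_on_const y mean_x mean_xx)
  finally show ?thesis
    unfolding whittaker_coeff_sgn_abs c_def[symmetric] r_def[symmetric] by (simp add: algebra_simps)
qed

lemma fourier_mean_ode_solution:
  assumes \<psi>: "real_analytic_on \<psi> upper_half_space"
    and per: "\<And>z l. z \<in> upper_half_space \<Longrightarrow> l \<in> L \<Longrightarrow> \<psi> (z + Complex_vec l 0) = \<psi> z"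
    and eigen: "\<And>z. z \<in> upper_half_space \<Longrightarrow> Laplacian j p \<psi> z = s * (1 - s) * \<psi> z"
    and \<xi>: "\<xi> \<in> dual_lattice L" and y: "\<And>i. i \<noteq> j \<Longrightarrow> y $ i > 0"
  shows "ode_solution (whittaker_coeff (signed_weight (\<xi> $ j) p) (2 * pi * \<bar>\<xi> $ j\<bar>) s)
    (\<lambda>t. fourier_mean L \<psi> \<xi> (vec_upd y j t))"
proof (rule ode_solutionI)
  fix t :: real assume t: "t > 0"
  show "((\<lambda>t. fourier_mean L \<psi> \<xi> (vec_upd y j t)) has_vector_derivative
      fourier_mean L (partial_y j \<psi>) \<xi> (vec_upd y j t)) (at t)"
    by (rule fourier_mean_has_vector_derivative[OF \<psi> y t])
  have "vec_upd y j t $ i > 0" for i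
    using y t by simp
  from fourier_mean_partial_yy[OF \<psi> per eigen \<xi> this]
  have "fourier_mean L (partial_y j (partial_y j \<psi>)) \<xi> (vec_upd y j t)
      = whittaker_coeff (signed_weight (\<xi> $ j) p) (2 * pi * \<bar>\<xi> $ j\<bar>) s t * fourier_mean L \<psi> \<xi> (vec_upd y j t)"
    by simp
  moreover have "((\<lambda>t. fourier_mean L (partial_y j \<psi>) \<xi> (vec_upd y j t)) has_vector_derivative
      fourier_mean L (partial_y j (partial_y j \<psi>)) \<xi> (vec_upd y j t)) (at t)"
    by (rule fourier_mean_has_vector_derivative[OF real_analytic_on_partial_y[OF \<psi>] y t])
  ultimately show "((\<lambda>t. fourier_mean L (partial_y j \<psi>) \<xi> (vec_upd y j t)) has_vector_derivative
      whittaker_coeff (signed_weight (\<xi> $ j) p) (2 * pi * \<bar>\<xi> $ j\<bar>) s t * fourier_mean L \<psi> \<xi> (vec_upd y j t)) (at t)"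
    by simp
qed

end

section \<open>Holomorphic dependence on \<open>s\<close>\<close>

lemma discrete_imp_countable:
  fixes T :: "'a::second_countable_topology set"
  assumes "discrete T"
  shows "countable T"
proof -
  obtain B :: "'a set set" where B: "countable B" "topological_basis B"
    using ex_countable_basis by blast
  have "\<exists>V\<in>B. V \<inter> T = {x}" if x: "x \<in> T" for x
  proof -
    obtain U where U: "open U" "U \<inter> T = {x}"
      using assms x unfolding discrete_def isolated_in_def by blast
    then obtain V where "V \<in> B" "x \<in> V" "V \<subseteq> U"
      using topological_basisE[OF B(2) U(1), of x] by blast
    then show ?thesis
      using U x by blast
  qed
  then obtain v where v: "\<And>x. x \<in> T \<Longrightarrow> v x \<in> B \<and> v x \<inter> T = {x}"
    by metis
  have "inj_on v T"
  proof (rule inj_onI)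
    fix x y assume x: "x \<in> T" and y: "y \<in> T" and eq: "v x = v y"
    have "{x} = v x \<inter> T"
      using v[OF x] by (simp only:)
    also have "\<dots> = {y}"
      using v[OF y] by (simp only: eq)
    finally show "x = y"
      by simp
  qed
  moreover have "countable (v ` T)"
    using v B(1) countable_subset[of "v ` T" B] by blast
  ultimately show ?thesis
    using countable_image_inj_on by blast
qed

lemma has_derivative_complex_linear:
  fixes g :: "complex \<Rightarrow> complex"
  assumes U: "open U" and T: "countable T" and s0: "s0 \<in> U - T"
    and der: "(g has_derivative g') (at s0)" and diff: "g field_differentiable (at s0 within U - T)"
  shows "g' h = g' 1 * h"
proof -
  obtain d where d: "(g has_derivative (*) d) (at s0 within U - T)"
    using diff by (auto simp: field_differentiable_def has_field_derivative_def)
  have "g' = (*) d"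
  proof (rule frechet_derivative_unique_within[OF has_derivative_at_withinI[OF der] d])
    fix i :: complex and e :: real assume i: "i \<in> Basis" and e: "e > 0"
    obtain r where r: "r > 0" "ball s0 r \<subseteq> U"
      using U s0 open_contains_ball by blast
    have "inj_on (\<lambda>t. s0 + t *\<^sub>R i) A" for A
      using i nonzero_Basis by (auto intro!: inj_onI)
    moreover have "countable ((\<lambda>t. s0 + t *\<^sub>R i) ` ((\<lambda>t. s0 + t *\<^sub>R i) -` T))"
      by (rule countable_subset[OF image_vimage_subset T])
    ultimately have "countable ((\<lambda>t. s0 + t *\<^sub>R i) -` T)"
      using countable_image_inj_on by blast
    moreover have "uncountable {0<..<min e r}"
      using e r(1) by (intro uncountable_open_interval[THEN iffD2]) simp
    ultimately obtain t where t: "0 < t" "t < e" "t < r" "s0 + t *\<^sub>R i \<notin> T"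
      using countable_subset[of "{0<..<min e r}" "(\<lambda>t. s0 + t *\<^sub>R i) -` T"] by force
    then have "s0 + t *\<^sub>R i \<in> U"
      using i by (intro subsetD[OF r(2)]) (simp add: dist_norm)
    then show "\<exists>d. 0 < \<bar>d\<bar> \<and> \<bar>d\<bar> < e \<and> s0 + d *\<^sub>R i \<in> U - T"
      using t by (intro exI[of _ t]) auto
  qed
  then show ?thesis
    by simp
qed

lemma field_differentiable_set_integral:
  fixes f :: "complex \<Rightarrow> 'b::euclidean_space \<Rightarrow> complex"
  assumes D: "bounded D" "D \<in> sets borel" and \<Omega>: "open \<Omega>" "{s0} \<times> closure D \<subseteq> \<Omega>"
    and der: "\<And>s x. (s, x) \<in> \<Omega> \<Longrightarrow> ((\<lambda>s. f s x) has_derivative f' s x) (at s)"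
    and cont: "continuous_on \<Omega> (\<lambda>(s, x). f s x)" "\<And>h. continuous_on \<Omega> (\<lambda>(s, x). f' s x h)"
    and UT: "open U" "countable T" "s0 \<in> U - T"
    and diff: "\<And>x. x \<in> D \<Longrightarrow> (\<lambda>s. f s x) field_differentiable (at s0 within U - T)"
  shows "(\<lambda>s. LINT x:D|lborel. f s x) field_differentiable (at s0)"
proof -
  have "((\<lambda>s. LINT x:D|lborel. f s x) has_derivative (\<lambda>h. LINT x:D|lborel. f' s0 x h)) (at s0)"
    by (rule has_derivative_set_integral[OF D \<Omega> der cont])
  also have "(\<lambda>h. LINT x:D|lborel. f' s0 x h) = (*) (LINT x:D|lborel. f' s0 x 1)"
  proof
    fix h
    have "(s0, x) \<in> \<Omega>" if "x \<in> D" for x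
      using \<Omega>(2) closure_subset that by blast
    then have "f' s0 x h = f' s0 x 1 * h" if "x \<in> D" for x
      using has_derivative_complex_linear[OF UT der diff[OF that]] that by blast
    then have "(LINT x:D|lborel. f' s0 x h) = (LINT x:D|lborel. f' s0 x 1 * h)"
      by (intro set_lebesgue_integral_cong) (use D(2) in auto)
    then show "(LINT x:D|lborel. f' s0 x h) = (LINT x:D|lborel. f' s0 x 1) * h"
      by simp
  qed
  finally show ?thesis
    unfolding field_differentiable_def has_field_derivative_def by blast
qed

lemma has_derivative_Pair_right:
  assumes "f differentiable (at (z, s))"
  shows "((\<lambda>s. f (z, s)) has_derivative (\<lambda>h. frechet_derivative f (at (z, s)) (0, h))) (at s)"
  using assms unfolding frechet_derivative_works
  by (rule has_derivative_compose[rotated]) (auto intro!: derivative_eq_intros)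

lemma (in lattice) fourier_coeff_holomorphic:
  assumes U: "open U" and T: "countable T"
    and analytic: "real_analytic_on (\<lambda>(z, s). F z s) (upper_half_space \<times> (U - T))"
    and holo: "\<And>z. z \<in> upper_half_space \<Longrightarrow> (\<lambda>s. F z s) holomorphic_on (U - T)"
    and y: "\<And>i. y $ i > 0"
  shows "(\<lambda>s. fourier_coeff L F \<xi> y s) holomorphic_on (U - T)"
  unfolding holomorphic_on_def
proof
  fix s0 assume s0: "s0 \<in> U - T"
  define f where "f = (\<lambda>(z, s). F z s)"
  define f' where "f' s x h = frechet_derivative f (at (Complex_vec x y, s)) (0, h)" for s x h
  obtain \<Omega> where \<Omega>: "open \<Omega>" "upper_half_space \<times> (U - T) \<subseteq> \<Omega>" "\<And>w. w \<in> \<Omega> \<Longrightarrow> f differentiable (at w)"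
    "\<And>h. continuous_on \<Omega> (\<lambda>w. frechet_derivative f (at w) h)"
    by (rule real_analytic_on_C1[OF analytic, folded f_def]) blast
  define \<Omega>' where "\<Omega>' = (\<lambda>(s, x). (Complex_vec x y, s)) -` \<Omega>"
  have "continuous_on UNIV (\<lambda>(s, x). (Complex_vec x y, s))"
    unfolding case_prod_unfold by (intro continuous_intros)
  then have "open \<Omega>'"
    unfolding \<Omega>'_def by (rule open_vimage[OF \<Omega>(1)])
  have cont: "continuous_on \<Omega>' (\<lambda>(s, x). g (Complex_vec x y, s) * fourier_char \<xi> x)"
    if "continuous_on \<Omega> g" for g :: "_ \<Rightarrow> complex"
  proof -
    have "continuous_on \<Omega>' (\<lambda>p. g (Complex_vec (snd p) y, fst p))"
      by (rule continuous_on_compose2[OF that]) (auto simp: \<Omega>'_def intro!: continuous_intros)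
    then show ?thesis
      unfolding case_prod_unfold by (intro continuous_intros)
  qed
  have "(\<lambda>s. LINT x:fundamental_domain L|lborel. f (Complex_vec x y, s) * fourier_char \<xi> x)
      field_differentiable (at s0)"
  proof (rule field_differentiable_set_integral[OF bounded_fundamental_domain fundamental_domain_borel
        \<open>open \<Omega>'\<close> _ _ _ _ U T s0])
    show "{s0} \<times> closure (fundamental_domain L) \<subseteq> \<Omega>'"
      using y s0 by (auto simp: \<Omega>'_def intro!: subsetD[OF \<Omega>(2)])
    show "((\<lambda>s. f (Complex_vec x y, s) * fourier_char \<xi> x) has_derivative
        (\<lambda>h. f' s x h * fourier_char \<xi> x)) (at s)" if "(s, x) \<in> \<Omega>'" for s x
      using \<Omega>(3) that unfolding f'_def \<Omega>'_def
      by (intro has_derivative_mult_left has_derivative_Pair_right) auto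
    show "continuous_on \<Omega>' (\<lambda>(s, x). f (Complex_vec x y, s) * fourier_char \<xi> x)"
      using \<Omega>(1,3) by (intro cont continuous_at_imp_continuous_on ballI differentiable_imp_continuous_within)
    show "continuous_on \<Omega>' (\<lambda>(s, x). f' s x h * fourier_char \<xi> x)" for h
      unfolding f'_def by (rule cont[OF \<Omega>(4)])
    show "(\<lambda>s. f (Complex_vec x y, s) * fourier_char \<xi> x) field_differentiable (at s0 within U - T)" for x
      using holo[of "Complex_vec x y"] y s0 unfolding f_def holomorphic_on_def
      by (intro field_differentiable_mult field_differentiable_const) auto
  qed
  then show "(\<lambda>s. fourier_coeff L F \<xi> y s) field_differentiable (at s0 within U - T)"
    unfolding fourier_coeff_eq_fourier_mean fourier_mean_def divide_inverse f_def prod.case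
    by (intro field_differentiable_at_within[OF field_differentiable_mult[OF _ field_differentiable_const]])
qed

section \<open>Products of functions of one variable\<close>

lemma separated_function_proportional:
  fixes A :: "real ^ 'n \<Rightarrow> complex" and W :: "'n \<Rightarrow> real \<Rightarrow> complex"
  assumes sep: "\<And>y j. (\<And>i. y $ i > 0) \<Longrightarrow> \<exists>c. \<forall>t>0. A (vec_upd y j t) = c * W j t"
    and u: "\<And>i. u $ i > 0" and y: "\<And>i. y $ i > 0"
  shows "A y * (\<Prod>j\<in>UNIV. W j (u $ j)) = A u * (\<Prod>j\<in>UNIV. W j (y $ j))"
proof -
  define mix where "mix J = (\<chi> i. if i \<in> J then u $ i else y $ i)" for J
  have "A y * (\<Prod>j\<in>J. W j (u $ j)) = A (mix J) * (\<Prod>j\<in>J. W j (y $ j))" for J :: "'n set"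
    using finite[of J]
  proof (induction J)
    case empty
    then show ?case
      by (simp add: mix_def)
  next
    case (insert k J)
    have "mix J $ i > 0" for i
      using y u by (simp add: mix_def)
    then obtain c where c: "\<And>t. t > 0 \<Longrightarrow> A (vec_upd (mix J) k t) = c * W k t"
      using sep by blast
    have "vec_upd (mix J) k (y $ k) = mix J" "vec_upd (mix J) k (u $ k) = mix (insert k J)"
      using insert.hyps by (auto simp: mix_def vec_eq_iff)
    then have "A (mix J) * W k (u $ k) = A (mix (insert k J)) * W k (y $ k)"
      using c[OF y[of k]] c[OF u[of k]] by simp
    then have "A y * (\<Prod>j\<in>J. W j (u $ j)) * W k (u $ k)
        = (\<Prod>j\<in>J. W j (y $ j)) * (A (mix (insert k J)) * W k (y $ k))"
      unfolding insert.IH by (simp add: mult_ac)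
    then show ?case
      using insert.hyps by (simp add: mult_ac)
  qed
  moreover have "mix UNIV = u"
    by (simp add: mix_def)
  ultimately show ?thesis
    by metis
qed

lemma powr_prod_of_real:
  fixes y :: "'i \<Rightarrow> real" and s :: complex
  assumes "finite I" "\<And>i. i \<in> I \<Longrightarrow> y i > 0"
  shows "of_real (\<Prod>i\<in>I. y i) powr s = (\<Prod>i\<in>I. of_real (y i) powr s)"
  using assms
proof (induction I)
  case (insert i I)
  then have "(\<Prod>i\<in>I. y i) > 0" "y i > 0"
    by (auto intro: prod_pos)
  then have "complex_of_real (y i * prod y I) powr s = of_real (y i) powr s * of_real (prod y I) powr s"
    unfolding of_real_mult by (intro powr_times_real) (auto simp del: of_real_prod)
  then show ?case
    using insert by (simp del: of_real_prod of_real_mult)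
qed simp

lemma Norm_pos: "(\<And>i. y $ i > 0) \<Longrightarrow> Norm y > 0"
  unfolding Norm_def by (intro prod_pos) auto

lemma Norm_powr:
  assumes "\<And>i. y $ i > 0"
  shows "of_real \<bar>Norm y\<bar> powr s = (\<Prod>j\<in>UNIV. of_real (y $ j) powr (s :: complex))"
  using Norm_pos[OF assms] powr_prod_of_real[of UNIV "\<lambda>j. y $ j" s] assms
  by (simp add: Norm_def del: of_real_prod)

lemma Norm_vec_upd: "Norm (vec_upd y j t) = t * (\<Prod>i\<in>UNIV - {j}. y $ i)"
  unfolding Norm_def by (subst prod.remove[of UNIV j]) auto

lemma holomorphic_on_proportionality_factor:
  fixes f g :: "'i \<Rightarrow> complex \<Rightarrow> complex"
  assumes f: "\<And>y. y \<in> Y \<Longrightarrow> f y holomorphic_on S" and g: "\<And>y. y \<in> Y \<Longrightarrow> g y holomorphic_on S"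
    and proportional: "\<And>s y u. s \<in> S \<Longrightarrow> y \<in> Y \<Longrightarrow> u \<in> Y \<Longrightarrow> f y s * g u s = f u s * g y s"
    and nonzero: "\<And>s. s \<in> S \<Longrightarrow> \<exists>u\<in>Y. g u s \<noteq> 0"
  obtains c where "c holomorphic_on S" "\<And>s y. s \<in> S \<Longrightarrow> y \<in> Y \<Longrightarrow> f y s = c s * g y s"
proof -
  obtain u where u: "\<And>s. s \<in> S \<Longrightarrow> u s \<in> Y" "\<And>s. s \<in> S \<Longrightarrow> g (u s) s \<noteq> 0"
    using nonzero by metis
  define c where "c s = f (u s) s / g (u s) s" for s
  have c: "f y s = c s * g y s" if "s \<in> S" "y \<in> Y" for s y
    using proportional[OF that u(1)[OF that(1)]] u(2)[OF that(1)] by (simp add: c_def field_simps)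
  have "c field_differentiable (at s0 within S)" if s0: "s0 \<in> S" for s0
  proof -
    have diff: "f (u s0) field_differentiable (at s0 within S)" "g (u s0) field_differentiable (at s0 within S)"
      using f g u(1) s0 by (auto simp: holomorphic_on_def)
    obtain e where e: "e > 0" "\<And>s. s \<in> S \<Longrightarrow> dist s s0 < e \<Longrightarrow> g (u s0) s \<noteq> 0"
      using continuous_within_avoid[OF field_differentiable_imp_continuous_at[OF diff(2)] u(2)[OF s0]]
      by (metis dist_commute)
    show ?thesis
    proof (rule field_differentiable_transform_within[OF e(1) s0])
      show "(\<lambda>s. f (u s0) s / g (u s0) s) field_differentiable (at s0 within S)"
        using u(2)[OF s0] by (intro field_differentiable_divide diff)
      show "f (u s0) s / g (u s0) s = c s" if "s \<in> S" "dist s s0 < e" for s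
        using c[OF that(1) u(1)[OF s0]] e(2)[OF that] by simp
    qed
  qed
  then have "c holomorphic_on S"
    by (simp add: holomorphic_on_def)
  then show ?thesis
    using c that by blast
qed

section \<open>The product \<open>B_coeff\<close> of Whittaker functions\<close>

lemma abs_le_m_p: "\<bar>of_int (p $ j) / 2\<bar> \<le> m_p p"
proof -
  have "of_int (p $ j) / 2 \<le> m_p p" "- (of_int (p $ j) / 2) \<le> m_p p"
    unfolding m_p_def by (rule Max_ge, simp, blast)+
  then show ?thesis
    by linarith
qed

lemma Re_signed_weight:
  assumes "Re s > m_p p"
  shows "Re (s - signed_weight x (p $ j)) > 0" "Re (s + signed_weight x (p $ j)) > 0"
proof -
  have "\<bar>Re (signed_weight x (p $ j))\<bar> \<le> \<bar>of_int (p $ j) / 2\<bar>"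
    by (simp add: signed_weight_def abs_mult abs_sgn_eq)
  then show "Re (s - signed_weight x (p $ j)) > 0" "Re (s + signed_weight x (p $ j)) > 0"
    using abs_le_m_p[of p j] assms by auto
qed

definition whittaker_prod :: "real ^ 'n \<Rightarrow> int ^ 'n \<Rightarrow> complex \<Rightarrow> real ^ 'n \<Rightarrow> complex" where
  "whittaker_prod \<xi> p s y =
     (\<Prod>j\<in>UNIV. whittaker_fun (signed_weight (\<xi> $ j) (p $ j)) (2 * pi * \<bar>\<xi> $ j\<bar>) s (y $ j))"

lemma Norm_powr_B_coeff:
  assumes "Re s > m_p p" "\<And>j. \<xi> $ j \<noteq> 0" "\<And>i. y $ i > 0"
  shows "of_real \<bar>Norm y\<bar> powr s * B_coeff \<xi> y p s
    = (\<Prod>j\<in>UNIV. tau_factor (signed_weight (\<xi> $ j) (p $ j)) s) * whittaker_prod \<xi> p s y"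
  unfolding B_coeff_def Norm_powr[OF assms(3)] whittaker_prod_def prod.distrib[symmetric]
  by (intro prod.cong refl tau_eq_whittaker_fun assms order_le_less_trans[OF abs_le_m_p])

lemma Norm_powr_B_coeff_holomorphic:
  assumes "\<And>s. s \<in> S \<Longrightarrow> Re s > m_p p" "\<And>j. \<xi> $ j \<noteq> 0" "\<And>i. y $ i > 0"
  shows "(\<lambda>s. of_real \<bar>Norm y\<bar> powr s * B_coeff \<xi> y p s) holomorphic_on S"
proof (rule holomorphic_transform)
  show "(\<lambda>s. (\<Prod>j\<in>UNIV. tau_factor (signed_weight (\<xi> $ j) (p $ j)) s) * whittaker_prod \<xi> p s y) holomorphic_on S"
    using Re_signed_weight(1)[OF assms(1)] assms(2,3) unfolding whittaker_prod_def
    by (intro holomorphic_intros tau_factor_holomorphic whittaker_fun_holomorphic) auto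
qed (use assms in \<open>simp add: Norm_powr_B_coeff\<close>)

lemma exists_Norm_powr_B_coeff_nonzero:
  assumes s: "Re s > m_p p" and \<xi>: "\<And>j. \<xi> $ j \<noteq> 0"
  shows "\<exists>y. (\<forall>i. y $ i > 0) \<and> of_real \<bar>Norm y\<bar> powr s * B_coeff \<xi> y p s \<noteq> 0"
proof -
  define W where "W j = whittaker_fun (signed_weight (\<xi> $ j) (p $ j)) (2 * pi * \<bar>\<xi> $ j\<bar>) s" for j
  have "\<forall>\<^sub>F t in at_top. \<forall>j\<in>UNIV. W j t \<noteq> 0"
    unfolding W_def using \<xi>
    by (intro eventually_ball_finite ballI finite eventually_whittaker_fun_nonzero Re_signed_weight s) simp
  then obtain t where t: "t > 0" "\<And>j. W j t \<noteq> 0"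
    using eventually_happens'[OF _ eventually_conj[OF _ eventually_gt_at_top[of 0]]] by force
  have "tau_factor (signed_weight (\<xi> $ j) (p $ j)) s \<noteq> 0" for j
    by (intro tau_factor_nonzero Re_signed_weight s)
  with t show ?thesis
    by (intro exI[of _ "\<chi> i. t"]) (simp add: Norm_powr_B_coeff[OF s \<xi>] whittaker_prod_def W_def)
qed

section \<open>Eigenfunctions with a constant term of moderate growth\<close>

lemma half_plane_open: "open (half_plane a)"
  unfolding half_plane_def by (intro open_Collect_less continuous_intros)

locale periodic_eigenfunction = lattice L
  for L :: "(real ^ 'n) set" +
  fixes T :: "complex set" and F :: "complex ^ 'n \<Rightarrow> complex \<Rightarrow> complex"
    and \<phi> :: "complex \<Rightarrow> complex" and p :: "int ^ 'n"
  assumes discrete_T: "discrete T"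
    and analytic: "real_analytic_on (\<lambda>(z, s). F z s) (upper_half_space \<times> (half_plane 1 - T))"
    and holomorphic: "z \<in> upper_half_space \<Longrightarrow> (\<lambda>s. F z s) holomorphic_on (half_plane 1 - T)"
    and periodic: "z \<in> upper_half_space \<Longrightarrow> s \<in> half_plane 1 - T \<Longrightarrow> l \<in> L \<Longrightarrow>
      F (z + Complex_vec l 0) s = F z s"
    and growth: "s \<in> half_plane 1 - T \<Longrightarrow> \<exists>C>0. \<forall>z\<in>upper_half_space.
      norm (F z s - \<phi> s * of_real \<bar>Norm (Im_vec z)\<bar> powr s) \<le> C * norm (of_real \<bar>Norm (Im_vec z)\<bar> powr (1 - s))"
    and eigen: "z \<in> upper_half_space \<Longrightarrow> s \<in> half_plane 1 - T \<Longrightarrow>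
      Laplacian j (p $ j) (\<lambda>w. F w s) z = s * (1 - s) * F z s"
begin

lemma real_analytic_F: "s \<in> half_plane 1 - T \<Longrightarrow> real_analytic_on (\<lambda>z. F z s) upper_half_space"
  using real_analytic_on_slice[OF analytic] by simp

lemma coeff_holomorphic:
  assumes "\<And>i. y $ i > 0" "S \<subseteq> half_plane 1 - T"
  shows "(\<lambda>s. fourier_coeff L F \<xi> y s) holomorphic_on S"
  using fourier_coeff_holomorphic[OF half_plane_open discrete_imp_countable[OF discrete_T]
      analytic holomorphic assms(1)]
    assms(2) by (rule holomorphic_on_subset)

lemma coeff_ode_solution:
  assumes "s \<in> half_plane 1 - T" "\<xi> \<in> dual_lattice L" "\<And>i. i \<noteq> j \<Longrightarrow> y $ i > 0"
  shows "ode_solution (whittaker_coeff (signed_weight (\<xi> $ j) (p $ j)) (2 * pi * \<bar>\<xi> $ j\<bar>) s)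
    (\<lambda>t. fourier_coeff L F \<xi> (vec_upd y j t) s)"
  unfolding fourier_coeff_eq_fourier_mean
  using real_analytic_F periodic eigen assms by (intro fourier_mean_ode_solution) auto

lemma coeff_growth:
  assumes s: "s \<in> half_plane 1 - T"
  obtains C where "\<And>\<xi> y. \<xi> \<in> dual_lattice L \<Longrightarrow> (\<And>i. y $ i > 0) \<Longrightarrow>
    norm (fourier_coeff L F \<xi> y s - (if \<xi> = 0 then \<phi> s * of_real (Norm y) powr s else 0))
      \<le> C * Norm y powr (1 - Re s)"
proof -
  obtain C where C: "\<And>z. z \<in> upper_half_space \<Longrightarrow>
      norm (F z s - \<phi> s * of_real \<bar>Norm (Im_vec z)\<bar> powr s) \<le> C * norm (of_real \<bar>Norm (Im_vec z)\<bar> powr (1 - s))"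
    using growth[OF s] by blast
  show ?thesis
  proof
    fix \<xi> y :: "real ^ 'n" assume \<xi>: "\<xi> \<in> dual_lattice L" and y: "\<And>i. y $ i > 0"
    define c where "c = \<phi> s * of_real (Norm y) powr s"
    note cont = real_analytic_on_continuous[OF real_analytic_F[OF s]]
    have "norm (fourier_mean L (\<lambda>z. F z s + - c) \<xi> y) \<le> C * Norm y powr (1 - Re s)"
    proof (rule norm_fourier_mean_le[OF continuous_on_add[OF cont continuous_on_const] y])
      show "norm (F (Complex_vec x y) s + - c) \<le> C * Norm y powr (1 - Re s)" for x
        using C[of "Complex_vec x y"] y Norm_pos[OF y] by (simp add: c_def norm_powr_real_powr)
    qed
    moreover have "fourier_mean L (\<lambda>z. F z s + - c) \<xi> y = fourier_coeff L F \<xi> y s - (if \<xi> = 0 then c else 0)"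
      unfolding fourier_mean_add[OF cont continuous_on_const y] fourier_coeff_eq_fourier_mean
      by (auto simp: fourier_mean_0_const fourier_mean_const_eq_0[OF \<xi>])
    ultimately show "norm (fourier_coeff L F \<xi> y s - (if \<xi> = 0 then \<phi> s * of_real (Norm y) powr s else 0))
        \<le> C * Norm y powr (1 - Re s)"
      unfolding c_def[symmetric] by simp
  qed
qed

lemma coeff_0_in_one_variable:
  assumes s: "s \<in> half_plane 1 - T" and y: "\<And>i. y $ i > 0"
  obtains c where "\<And>t. t > 0 \<Longrightarrow> fourier_coeff L F 0 (vec_upd y j t) s
    = \<phi> s * of_real (Norm (vec_upd y j t)) powr s + c * of_real t powr (1 - s)"
proof -
  have zero: "0 \<in> dual_lattice L"
    by (simp add: dual_lattice_def Tr_def)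
  have Re_s: "Re s > 1 / 2"
    using s by (simp add: half_plane_def)
  obtain C where C: "\<And>\<xi> y. \<xi> \<in> dual_lattice L \<Longrightarrow> (\<And>i. y $ i > 0) \<Longrightarrow>
      norm (fourier_coeff L F \<xi> y s - (if \<xi> = 0 then \<phi> s * of_real (Norm y) powr s else 0))
        \<le> C * Norm y powr (1 - Re s)"
    using coeff_growth[OF s] by blast
  define P where "P = (\<Prod>i\<in>UNIV - {j}. y $ i)"
  have P: "P > 0"
    unfolding P_def using y by (intro prod_pos) auto
  have Norm_eq: "Norm (vec_upd y j t) = t * P" for t
    by (simp add: Norm_vec_upd P_def)
  have powr_eq: "of_real (Norm (vec_upd y j t)) powr s = of_real P powr s * complex_of_real t powr s"
    if "t > 0" for t
    unfolding Norm_eq using that P by (simp add: powr_times_real)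
  have "ode_solution (\<lambda>t. s * (s - 1) / (of_real t)\<^sup>2) (\<lambda>t. fourier_coeff L F 0 (vec_upd y j t) s)"
    using coeff_ode_solution[OF s zero, of j y] y by (simp add: whittaker_coeff_def[abs_def])
  moreover have "norm (fourier_coeff L F 0 (vec_upd y j t) s - \<phi> s * of_real P powr s * of_real t powr s)
      \<le> C * P powr (1 - Re s) * t powr (1 - Re s)" if "t > 0" for t
    using C[OF zero, of "vec_upd y j t"] that y P
    by (simp add: powr_eq mult.assoc) (simp add: Norm_eq powr_mult mult_ac)
  ultimately obtain c where "\<And>t. t > 0 \<Longrightarrow> fourier_coeff L F 0 (vec_upd y j t) s
      = \<phi> s * of_real P powr s * of_real t powr s + c * of_real t powr (1 - s)"
    using euler_ode_solution_asymptotic[OF Re_s] by blast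
  then show ?thesis
    by (intro that[of c]) (simp add: powr_eq)
qed

lemma constant_term:
  assumes s: "s \<in> half_plane 1 - T" and y: "\<And>i. y $ i > 0"
  shows "fourier_coeff L F 0 y s = \<phi> s * of_real \<bar>Norm y\<bar> powr s
    + (fourier_coeff L F 0 1 s - \<phi> s) * of_real \<bar>Norm y\<bar> powr (1 - s)"
proof -
  define G where "G y = fourier_coeff L F 0 y s - \<phi> s * of_real (Norm y) powr s" for y
  have "\<exists>c. \<forall>t>0. G (vec_upd y j t) = c * of_real t powr (1 - s)" if "\<And>i. y $ i > 0" for y j
    using coeff_0_in_one_variable[OF s that, of j] unfolding G_def by (metis add_diff_cancel_left')
  then have "G y * (\<Prod>j\<in>(UNIV::'n set). of_real ((1 :: real ^ 'n) $ j) powr (1 - s))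
      = G 1 * (\<Prod>j\<in>UNIV. of_real (y $ j) powr (1 - s))"
    by (rule separated_function_proportional) (use y in auto)
  then have "G y = G 1 * of_real \<bar>Norm y\<bar> powr (1 - s)"
    by (simp add: Norm_powr[OF y])
  moreover have "\<bar>Norm y\<bar> = Norm y" "Norm (1 :: real ^ 'n) = 1"
    using Norm_pos[OF y] by (simp_all add: Norm_def)
  ultimately show ?thesis
    by (simp add: G_def algebra_simps)
qed

text \<open>The constant term at two values of \<open>y\<close> determines \<open>\<phi>\<close>.\<close>

lemma growth_factor_holomorphic: "\<phi> holomorphic_on (half_plane 1 - T)"
proof -
  define y2 :: "real ^ 'n" where "y2 = (\<chi> i. 2)"
  define N where "N = (2::real) ^ CARD('n)"
  have N: "N > 1" and y2: "\<And>i. y2 $ i > 0" "\<bar>Norm y2\<bar> = N"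
    by (simp_all add: N_def y2_def Norm_def)
  define num where "num s = fourier_coeff L F 0 y2 s - of_real N powr (1 - s) * fourier_coeff L F 0 1 s" for s
  define den where "den s = complex_of_real N powr s - of_real N powr (1 - s)" for s
  have den: "den s \<noteq> 0" if "s \<in> half_plane 1 - T" for s
  proof
    assume "den s = 0"
    then have "norm (complex_of_real N powr s) = norm (complex_of_real N powr (1 - s))"
      by (simp add: den_def)
    then have "Re s = 1 - Re s"
      using N by (simp add: norm_powr_real_powr powr_inj)
    then show False
      using that by (simp add: half_plane_def)
  qed
  have "(\<lambda>s. num s / den s) holomorphic_on (half_plane 1 - T)"
    unfolding num_def den_def
    by (intro holomorphic_intros coeff_holomorphic) (use y2 N den in \<open>auto simp: den_def\<close>)
  moreover have "num s / den s = \<phi> s" if "s \<in> half_plane 1 - T" for s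
    using constant_term[OF that y2(1)] den[OF that] unfolding y2(2) num_def den_def by (simp add: field_simps)
  ultimately show ?thesis
    by (rule holomorphic_transform)
qed

lemma coeff_tendsto_0:
  assumes s: "s \<in> half_plane 1 - T" and \<xi>: "\<xi> \<in> dual_lattice L" "\<xi> \<noteq> 0" and y: "\<And>i. y $ i > 0"
  shows "((\<lambda>t. fourier_coeff L F \<xi> (vec_upd y j t) s) \<longlongrightarrow> 0) at_top"
proof -
  obtain C where C: "\<And>\<xi> y. \<xi> \<in> dual_lattice L \<Longrightarrow> (\<And>i. y $ i > 0) \<Longrightarrow>
      norm (fourier_coeff L F \<xi> y s - (if \<xi> = 0 then \<phi> s * of_real (Norm y) powr s else 0))
        \<le> C * Norm y powr (1 - Re s)"
    using coeff_growth[OF s] by blast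
  define P where "P = (\<Prod>i\<in>UNIV - {j}. y $ i)"
  have P: "P > 0"
    unfolding P_def using y by (intro prod_pos) auto
  show ?thesis
  proof (rule Lim_null_comparison)
    show "\<forall>\<^sub>F t in at_top. norm (fourier_coeff L F \<xi> (vec_upd y j t) s)
        \<le> C * P powr (1 - Re s) * t powr (1 - Re s)"
      using eventually_gt_at_top[of 0]
    proof eventually_elim
      case (elim t)
      then show ?case
        using C[OF \<xi>(1), of "vec_upd y j t"] \<xi>(2) y P
        by (simp add: Norm_vec_upd P_def[symmetric] powr_mult mult_ac)
    qed
    have "((\<lambda>t::real. t powr (1 - Re s)) \<longlongrightarrow> 0) at_top"
      using s by (intro tendsto_neg_powr filterlim_ident) (simp add: half_plane_def)
    then show "((\<lambda>t. C * P powr (1 - Re s) * t powr (1 - Re s)) \<longlongrightarrow> 0) at_top"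
      by (rule tendsto_mult_right_zero)
  qed
qed

lemma coeff_proportional_whittaker_prod:
  assumes s: "s \<in> half_plane 1 - T" "Re s > m_p p"
    and \<xi>: "\<xi> \<in> dual_lattice L" "\<And>j. \<xi> $ j \<noteq> 0" and u: "\<And>i. u $ i > 0" and y: "\<And>i. y $ i > 0"
  shows "fourier_coeff L F \<xi> y s * whittaker_prod \<xi> p s u = fourier_coeff L F \<xi> u s * whittaker_prod \<xi> p s y"
  unfolding whittaker_prod_def
proof (rule separated_function_proportional[OF _ u y])
  fix y :: "real ^ 'n" and j assume y: "\<And>i. y $ i > 0"
  have "\<xi> \<noteq> 0"
    using \<xi>(2) by (metis zero_index)
  moreover have "2 * pi * \<bar>\<xi> $ j\<bar> > 0"
    using \<xi>(2) by simp
  ultimately obtain c where "\<And>t. t > 0 \<Longrightarrow> fourier_coeff L F \<xi> (vec_upd y j t) s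
      = c * whittaker_fun (signed_weight (\<xi> $ j) (p $ j)) (2 * pi * \<bar>\<xi> $ j\<bar>) s t"
    using whittaker_fun_unique[OF Re_signed_weight(1)[OF s(2)] _ coeff_ode_solution[OF s(1) \<xi>(1) y]
        coeff_tendsto_0[OF s(1) \<xi>(1) _ y]] by blast
  then show "\<exists>c. \<forall>t>0. fourier_coeff L F \<xi> (vec_upd y j t) s
      = c * whittaker_fun (signed_weight (\<xi> $ j) (p $ j)) (2 * pi * \<bar>\<xi> $ j\<bar>) s t"
    by blast
qed

lemma nonconstant_term:
  assumes \<xi>: "\<xi> \<in> dual_lattice L" "\<And>j. \<xi> $ j \<noteq> 0"
    and S: "S \<subseteq> half_plane 1 - T" "S \<subseteq> half_plane (m_p p)"
  obtains c where "c holomorphic_on S" "\<And>y s. (\<And>j. y $ j > 0) \<Longrightarrow> s \<in> S \<Longrightarrow>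
    fourier_coeff L F \<xi> y s = c s * of_real \<bar>Norm y\<bar> powr s * B_coeff \<xi> y p s"
proof -
  define Y where "Y = {y :: real ^ 'n. \<forall>i. y $ i > 0}"
  define B where "B y s = of_real \<bar>Norm y\<bar> powr s * B_coeff \<xi> y p s" for y s
  have Re_s: "Re s > m_p p" if "s \<in> S" for s
    using that S(2) by (auto simp: half_plane_def)
  obtain c where "c holomorphic_on S" "\<And>s y. s \<in> S \<Longrightarrow> y \<in> Y \<Longrightarrow> fourier_coeff L F \<xi> y s = c s * B y s"
  proof (rule holomorphic_on_proportionality_factor[of Y "fourier_coeff L F \<xi>" S B])
    fix y assume y: "y \<in> Y"
    then show "fourier_coeff L F \<xi> y holomorphic_on S"
      using S(1) by (intro coeff_holomorphic) (auto simp: Y_def)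
    show "B y holomorphic_on S"
      using y unfolding B_def by (intro Norm_powr_B_coeff_holomorphic Re_s \<xi>(2)) (auto simp: Y_def)
  next
    fix s y u assume "s \<in> S" "y \<in> Y" "u \<in> Y"
    then show "fourier_coeff L F \<xi> y s * B u s = fourier_coeff L F \<xi> u s * B y s"
      using coeff_proportional_whittaker_prod[OF _ Re_s \<xi>, of s u y] S(1) \<xi>(2)
      by (auto simp: B_def Y_def Norm_powr_B_coeff Re_s)
  next
    show "\<exists>u\<in>Y. B u s \<noteq> 0" if "s \<in> S" for s
      using exists_Norm_powr_B_coeff_nonzero[OF Re_s[OF that] \<xi>(2)] by (auto simp: B_def Y_def)
  qed (rule that)
  then show ?thesis
    by (intro that[of c]) (auto simp: Y_def B_def mult.assoc)
qed

end

theorem mainTheorem6: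
  fixes T :: "complex set"
    and F :: "complex ^ 'n \<Rightarrow> complex \<Rightarrow> complex"
    and L :: "(real ^ 'n) set"
    and phi1 :: "complex \<Rightarrow> complex"
    and p :: "int ^ 'n"
  assumes T: "discrete T"
    and analytic: "real_analytic_on (\<lambda>(z, s). F z s) (upper_half_space \<times> (half_plane 1 - T))"
    and holo: "\<And>z. z \<in> upper_half_space \<Longrightarrow> (\<lambda>s. F z s) holomorphic_on (half_plane 1 - T)"
    and lattice: "is_lattice L"
    and periodic: "\<And>z s l. z \<in> upper_half_space \<Longrightarrow> s \<in> half_plane 1 - T \<Longrightarrow> l \<in> L \<Longrightarrow>
          F (z + Complex_vec l 0) s = F z s"
    and growth: "\<And>s. s \<in> half_plane 1 - T \<Longrightarrow>
          \<exists>C>0. \<forall>z\<in>upper_half_space.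
            norm (F z s - phi1 s * of_real \<bar>Norm (Im_vec z)\<bar> powr s)
              \<le> C * norm (of_real \<bar>Norm (Im_vec z)\<bar> powr (1 - s))"
    and eigen: "\<And>j z s. z \<in> upper_half_space \<Longrightarrow> s \<in> half_plane 1 - T \<Longrightarrow>
          Laplacian j (p $ j) (\<lambda>w. F w s) z = s * (1 - s) * F z s"
  shows "phi1 holomorphic_on (half_plane 1 - T) \<and>
         (\<exists>phi2. phi2 holomorphic_on (half_plane 1 - T) \<and>
            (\<forall>y s. (\<forall>j. y $ j > 0) \<longrightarrow> s \<in> half_plane 1 - T \<longrightarrow>
               fourier_coeff L F 0 y s =
                 phi1 s * of_real \<bar>Norm y\<bar> powr s + phi2 s * of_real \<bar>Norm y\<bar> powr (1 - s))) \<and>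
         (\<forall>\<xi> \<in> dual_lattice L - {0}. (\<forall>j. \<xi> $ j \<noteq> 0) \<longrightarrow>
            (\<exists>c. c holomorphic_on (half_plane (M_p p) - T) \<and>
               (\<forall>y s. (\<forall>j. y $ j > 0) \<longrightarrow> s \<in> half_plane (M_p p) - T \<longrightarrow>
                  fourier_coeff L F \<xi> y s =
                    c s * of_real \<bar>Norm y\<bar> powr s * B_coeff \<xi> y p s)))"
proof -
  interpret periodic_eigenfunction L T F phi1 p
    by unfold_locales (fact T analytic holo lattice periodic growth eigen)+
  have "(\<lambda>s. fourier_coeff L F 0 1 s - phi1 s) holomorphic_on (half_plane 1 - T)"
    by (intro holomorphic_intros coeff_holomorphic growth_factor_holomorphic) auto
  then have "\<exists>phi2. phi2 holomorphic_on (half_plane 1 - T) \<and>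
      (\<forall>y s. (\<forall>j. y $ j > 0) \<longrightarrow> s \<in> half_plane 1 - T \<longrightarrow>
        fourier_coeff L F 0 y s = phi1 s * of_real \<bar>Norm y\<bar> powr s + phi2 s * of_real \<bar>Norm y\<bar> powr (1 - s))"
    by (intro exI[of _ "\<lambda>s. fourier_coeff L F 0 1 s - phi1 s"] conjI allI impI constant_term) auto
  moreover have "\<exists>c. c holomorphic_on (half_plane (M_p p) - T) \<and>
      (\<forall>y s. (\<forall>j. y $ j > 0) \<longrightarrow> s \<in> half_plane (M_p p) - T \<longrightarrow>
        fourier_coeff L F \<xi> y s = c s * of_real \<bar>Norm y\<bar> powr s * B_coeff \<xi> y p s)"
    if "\<xi> \<in> dual_lattice L" "\<forall>j. \<xi> $ j \<noteq> 0" for \<xi>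
  proof (rule nonconstant_term[of \<xi> "half_plane (M_p p) - T"])
    show "half_plane (M_p p) - T \<subseteq> half_plane 1 - T" "half_plane (M_p p) - T \<subseteq> half_plane (m_p p)"
      using abs_le_m_p[of p undefined] by (auto simp: half_plane_def M_p_def)
  qed (use that in auto)
  ultimately show ?thesis
    using growth_factor_holomorphic by (intro conjI ballI impI) auto
qed

end
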